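(* Let $f$ and $g$ satisfy the standing assumptions (A) of the context, let $F=f+g$, and take $\gamma\in(0,1/L)$. Consider the sequences $(x_k),(y_k)$ generated by the proximal gradient algorithm with Riemannian Newton manifold update described in the context. If the Riemannian Hessian $\mathrm{Hess}\,F(x_k)$ (of the restriction of $F$ to $\mathcal{M}_k$) is positive definite at each step, then all limit points of $(x_k)$ are critical points of $F$ (i.e. $0\in\nabla f(x)+\partial g(x)$) and share the same functional value. Furthermore, assume that the sequence $(y_k)$ admits a limit point $x^\star$ such that (i) $x^\star\in\mathcal{M}$ is an $r$-structured critical point for $(f,g)$ with $r<1/\gamma$, where $\mathcal{M}$ is a $\mathcal{C}^2$ submanifold of $\mathbb{R}^n$; (ii) $\mathrm{Hess}_{\mathcal{M}}F(x^\star)\succ0$ and $\mathrm{Hess}_{\mathcal{M}}F$ is locally Lipschitz around $x^\star$. Then, after some finite time, (a) the sequence $(x_k)$ lies on $\mathcal{M}$; (b) $x_k$ converges to $x^\star$ quadratically: there exists $c>0$ such that, for all large $k$, $$\mathrm{dist}_{\mathcal{M}}(x_{k+1},x^\star)\le c\,\mathrm{dist}_{\mathcal{M}}(x_k,x^\star)^2.$$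
   Context: Standing assumptions (A): $f,g$ are proper; $f:\mathbb{R}^n\to\mathbb{R}$ is $\mathcal{C}^2$ with $L$-Lipschitz gradient; $g:\mathbb{R}^n\to\mathbb{R}\cup\{+\infty\}$ is lower semi-continuous; $\mathrm{prox}_{\gamma g}$ is non-empty on $\mathbb{R}^n$ for any $\gamma>0$; $F=f+g$ is bounded below. Here $\mathrm{prox}_{\gamma g}(y)=\operatorname{argmin}_{u}\{g(u)+\frac{1}{2\gamma}\|u-y\|^2\}$ (set-valued). Algorithm: from an arbitrary starting point, iterate for $k=1,2,\dots$: (1) compute $x_k\in\mathrm{prox}_{\gamma g}(y_{k-1}-\gamma\nabla f(y_{k-1}))$ and get a submanifold $\mathcal{M}_k\ni x_k$ (the current active manifold, delivered along with the proximal point); the returned manifold is the active one, so that $\mathcal{M}_k=\mathcal{M}$ whenever $x_k\in\mathcal{M}$ is close enough to $x^\star$; (2) Riemannian Newton update on $\mathcal{M}_k$ for the restriction of $F$ to $\mathcal{M}_k$: find $d_k\in T_{x_k}\mathcal{M}_k$ with $\mathrm{grad}\,F(x_k)+\mathrm{Hess}\,F(x_k)[d_k]=0$; find by backtracking line search (trying $\alpha=1$ first, then reducing the stepsize geometrically) $\alpha_k>0$ satisfying the Armijo condition $F(\mathrm{R}_{x_k}(\alpha_k d_k))\le F(x_k)+m_1\alpha_k\langle\mathrm{grad}\,F(x_k),d_k\rangle$, with fixed $0<m_1<1/2$; set $y_k=\mathrm{R}_{x_k}(\alpha_k d_k)$. Riemannian notions: submanifolds of $\mathbb{R}^n$ carry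 the metric induced by the ambient scalar product; $\mathrm{grad}$ and $\mathrm{Hess}$ are the Riemannian gradient and Hessian of the restriction of $F$ to the current manifold; $\mathrm{Hess}_{\mathcal{M}}F$ is that of $F|_{\mathcal{M}}$; $\mathrm{dist}_{\mathcal{M}}$ is the Riemannian distance. A retraction $\mathrm{R}$ on $\mathcal{M}$ is a smooth map from the tangent bundle to $\mathcal{M}$ with $\mathrm{R}_x(0)=x$ and $\mathrm{D}\mathrm{R}_x(0)=\mathrm{Id}$; the retractions used are second-order: for all $(x,\eta)$, the curve $t\mapsto\mathrm{R}_x(t\eta)$ has zero Riemannian acceleration at $t=0$. Subdifferentials: the regular subdifferential is $\widehat\partial g(\bar x)=\{v: g(x)\ge g(\bar x)+\langle v,x-\bar x\rangle+o(\|x-\bar x\|)\}$, and the limiting subdifferential is $\partial g(\bar x)=\{\lim_k v_k: v_k\in\widehat\partial g(x_k),\ x_k\to\bar x,\ g(x_k)\to g(\bar x)\}$. $g$ is (Clarke) regular at $\bar x$ if the two coincide there. $\mathrm{ri}$ denotes relative interior. Prox-regularity ($r>0$): $g$ is $r$-prox-regular at $\bar x$ if $g$ is finite and locally lower semi-continuous at $\bar x$ and for every $\bar v\in\partial g(\bar x)$ there is $\varepsilon>0$ such that $g(x')\ge g(x)+\langle v,x'-x\rangle-\frac r2\|x'-x\|^2$ whenever $v\in\partial g(x)$, $\|x-\bar x\|<\varepsilon$, $\|x'-\bar x\|<\varepsilon$, $\|v-\bar v\|<\varepsilon$, $g(x)<g(\bar x)+\varepsilon$. Partial smoothness: $g$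 is partly smooth at $\bar x$ relative to $\mathcal{M}\ni\bar x$ if $\mathcal{M}$ is a $\mathcal{C}^2$ submanifold of $\mathbb{R}^n$ around $\bar x$ and: the restriction of $g$ to $\mathcal{M}$ is $\mathcal{C}^2$ near $\bar x$; $g$ is Clarke regular at all $x\in\mathcal{M}$ near $\bar x$, with $\partial g(x)\ne\emptyset$; the affine span of $\partial g(\bar x)$ is a translate of the normal space $N_{\bar x}\mathcal{M}$; the set-valued map $\partial g$ restricted to $\mathcal{M}$ is continuous at $\bar x$. $r$-structured critical point: $\bar x\in\mathcal{M}$ is an $r$-structured critical point for $(f,g)$ if (i) $\bar x=\mathrm{prox}_{g/r}(\bar x-\frac1r\nabla f(\bar x))$ (the prox set is exactly $\{\bar x\}$); (ii) $0\in\mathrm{ri}(\nabla f(\bar x)+\partial g(\bar x))$; (iii) $g$ is $r$-prox-regular at $\bar x$; (iv) $g$ is partly smooth at $\bar x$ relative to $\mathcal{M}$. *)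

theory Defs
  imports "HOL-Analysis.Analysis" "HOL-Library.Landau_Symbols"
begin

section \<open>Functions of class C2\<close>

definition C2_on :: "'a::real_normed_vector set \<Rightarrow> ('a \<Rightarrow> 'b::real_normed_vector) \<Rightarrow> bool" where
  "C2_on U h \<longleftrightarrow> open U \<and>
     (\<exists>(h' :: 'a \<Rightarrow> 'a \<Rightarrow>\<^sub>L 'b) (h'' :: 'a \<Rightarrow> 'a \<Rightarrow>\<^sub>L ('a \<Rightarrow>\<^sub>L 'b)).
        (\<forall>x\<in>U. (h has_derivative blinfun_apply (h' x)) (at x)) \<and>
        (\<forall>x\<in>U. (h' has_derivative blinfun_apply (h'' x)) (at x)) \<and>
        continuous_on U h'')"

text \<open>A map on an arbitrary subset \<open>S\<close> of a vector space (here a submanifold or its tangent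
  bundle) is C2 near \<open>x\<close> when it extends to a C2 map on an open neighbourhood of \<open>x\<close> in the
  ambient space.\<close>

definition C2_restriction_at ::
  "'a::real_normed_vector set \<Rightarrow> ('a \<Rightarrow> 'b::real_normed_vector) \<Rightarrow> 'a \<Rightarrow> bool" where
  "C2_restriction_at S h x \<longleftrightarrow> (\<exists>U H. x \<in> U \<and> C2_on U H \<and> (\<forall>z\<in>S \<inter> U. H z = h z))"

text \<open>For an extended-real function this includes finiteness on \<open>S\<close> near \<open>x\<close>.\<close>

definition C2_restriction_ereal_at :: "'a::real_normed_vector set \<Rightarrow> ('a \<Rightarrow> ereal) \<Rightarrow> 'a \<Rightarrow> bool" where
  "C2_restriction_ereal_at S g x \<longleftrightarrow>
     (\<exists>h :: 'a \<Rightarrow> real. C2_restriction_at S h x \<and>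
        (\<forall>\<^sub>F z in nhds x. z \<in> S \<longrightarrow> g z = ereal (h z)))"

definition gradient :: "('a::real_inner \<Rightarrow> real) \<Rightarrow> 'a \<Rightarrow> 'a" where
  "gradient f x = (THE D. GDERIV f x :> D)"


section \<open>Submanifolds of Euclidean space\<close>

text \<open>Slice charts: near \<open>x\<close>, an ambient C2 diffeomorphism \<open>\<Phi>\<close> (with inverse \<open>\<Psi>\<close>) maps \<open>M\<close> onto
  an open piece of a linear subspace of dimension \<open>p\<close>.\<close>

definition C2_submanifold_around :: "nat \<Rightarrow> 'a::euclidean_space set \<Rightarrow> 'a \<Rightarrow> bool" where
  "C2_submanifold_around p M x \<longleftrightarrow> x \<in> M \<and>
     (\<exists>U W \<Phi> \<Psi> (S :: 'a set). x \<in> U \<and> C2_on U \<Phi> \<and> C2_on W \<Psi> \<and> homeomorphism U W \<Phi> \<Psi> \<and>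
        subspace S \<and> dim S = p \<and> \<Phi> ` (M \<inter> U) = S \<inter> W)"

definition C2_submanifold :: "'a::euclidean_space set \<Rightarrow> bool" where
  "C2_submanifold M \<longleftrightarrow> (\<exists>p. \<forall>x\<in>M. C2_submanifold_around p M x)"

definition curve_through ::
  "'a::euclidean_space set \<Rightarrow> 'a \<Rightarrow> 'a \<Rightarrow> (real \<Rightarrow> 'a) \<Rightarrow> bool" where
  "curve_through M x v c \<longleftrightarrow>
     c 0 = x \<and> (c has_vector_derivative v) (at 0) \<and>
     (\<exists>\<epsilon>>0. c C1_differentiable_on {-\<epsilon><..<\<epsilon>} \<and> c ` {-\<epsilon><..<\<epsilon>} \<subseteq> M)"

definition tangent_space :: "'a::euclidean_space set \<Rightarrow> 'a \<Rightarrow> 'a set" where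
  "tangent_space M x = {v. \<exists>c. curve_through M x v c}"

definition normal_space :: "'a::euclidean_space set \<Rightarrow> 'a \<Rightarrow> 'a set" where
  "normal_space M x = orthogonal_comp (tangent_space M x)"

text \<open>As \<open>tangent_space M x\<close> is a linear subspace, the closest point is the orthogonal projection.\<close>

definition tangent_proj :: "'a::euclidean_space set \<Rightarrow> 'a \<Rightarrow> 'a \<Rightarrow> 'a" where
  "tangent_proj M x = closest_point (tangent_space M x)"

definition tangent_bundle :: "'a::euclidean_space set \<Rightarrow> ('a \<times> 'a) set" where
  "tangent_bundle M = Sigma M (tangent_space M)"


section \<open>Riemannian notions for the induced metric\<close>

text \<open>The gradient represents the differential of the restriction of \<open>h\<close> to \<open>M\<close>. The Levi-Civita
  connection of the induced metric is the tangential part of the ambient derivative, so the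
  Hessian at \<open>x\<close> applied to \<open>v\<close> is the tangential part of the derivative of the gradient field
  along curves in \<open>M\<close> with velocity \<open>v\<close>. Neither depends on values of \<open>h\<close> outside \<open>M\<close>; the Hessian is
  meaningful on tangent vectors only.\<close>

definition riem_grad :: "'a::euclidean_space set \<Rightarrow> ('a \<Rightarrow> real) \<Rightarrow> 'a \<Rightarrow> 'a" where
  "riem_grad M h x = (THE \<xi>. \<xi> \<in> tangent_space M x \<and>
     (\<forall>v c. curve_through M x v c \<longrightarrow>
        ((\<lambda>t. h (c t)) has_real_derivative (\<xi> \<bullet> v)) (at 0)))"

definition riem_hess :: "'a::euclidean_space set \<Rightarrow> ('a \<Rightarrow> real) \<Rightarrow> 'a \<Rightarrow> 'a \<Rightarrow> 'a" where
  "riem_hess M h x v = (THE w.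
     \<forall>c. curve_through M x v c \<longrightarrow>
       (\<exists>u. ((\<lambda>t. riem_grad M h (c t)) has_vector_derivative u) (at 0) \<and>
            w = tangent_proj M x u))"

definition pos_def_on :: "'a::real_inner set \<Rightarrow> ('a \<Rightarrow> 'a) \<Rightarrow> bool" where
  "pos_def_on V A \<longleftrightarrow> (\<forall>v\<in>V. v \<noteq> 0 \<longrightarrow> A v \<bullet> v > 0)"

text \<open>Hessians at different points act on different tangent spaces. They are compared as
  endomorphisms of the ambient space, after precomposition with the tangent projections.\<close>

definition hess_locally_lipschitz :: "'a::euclidean_space set \<Rightarrow> ('a \<Rightarrow> real) \<Rightarrow> 'a \<Rightarrow> bool" where
  "hess_locally_lipschitz M h x \<longleftrightarrow>
     (\<exists>U C. open U \<and> x \<in> U \<and>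
        (\<forall>y\<in>M \<inter> U. \<forall>z\<in>M \<inter> U. \<forall>v.
           norm (riem_hess M h y (tangent_proj M y v) - riem_hess M h z (tangent_proj M z v))
             \<le> C * dist y z * norm v))"

text \<open>The length of a piecewise C1 path is a nonnegative integral because the derivative may be
  unbounded near the finitely many exceptional points; the distance is infinite between points
  that no path in \<open>M\<close> joins.\<close>

definition riem_dist :: "'a::euclidean_space set \<Rightarrow> 'a \<Rightarrow> 'a \<Rightarrow> ennreal" where
  "riem_dist M x y =
     (INF c \<in> {c. valid_path c \<and> path_image c \<subseteq> M \<and> pathstart c = x \<and> pathfinish c = y}.
        \<integral>\<^sup>+t\<in>{0..1}. ennreal (norm (vector_derivative c (at t))) \<partial>lborel)"

definition riem_acceleration :: "'a::euclidean_space set \<Rightarrow> (real \<Rightarrow> 'a) \<Rightarrow> real \<Rightarrow> 'a" where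
  "riem_acceleration M c t =
     tangent_proj M (c t) (vector_derivative (\<lambda>s. vector_derivative c (at s)) (at t))"

text \<open>Smoothness of a retraction is taken to be C2, the regularity class of the submanifolds.\<close>

definition manifold_retraction :: "'a::euclidean_space set \<Rightarrow> ('a \<Rightarrow> 'a \<Rightarrow> 'a) \<Rightarrow> bool" where
  "manifold_retraction M R \<longleftrightarrow>
     (\<forall>(x, v) \<in> tangent_bundle M. R x v \<in> M) \<and>
     (\<forall>p \<in> tangent_bundle M. C2_restriction_at (tangent_bundle M) (\<lambda>(x, v). R x v) p) \<and>
     (\<forall>x\<in>M. R x 0 = x \<and> (R x has_derivative (\<lambda>v. v)) (at 0 within tangent_space M x))"

definition second_order_retraction :: "'a::euclidean_space set \<Rightarrow> ('a \<Rightarrow> 'a \<Rightarrow> 'a) \<Rightarrow> bool" where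
  "second_order_retraction M R \<longleftrightarrow> manifold_retraction M R \<and>
     (\<forall>(x, v) \<in> tangent_bundle M. riem_acceleration M (\<lambda>t. R x (t *\<^sub>R v)) 0 = 0)"


section \<open>Subdifferentials, prox-regularity, partial smoothness\<close>

definition regular_subdiff :: "('a::real_inner \<Rightarrow> ereal) \<Rightarrow> 'a \<Rightarrow> 'a set" where
  "regular_subdiff g xb = {v. \<bar>g xb\<bar> \<noteq> \<infinity> \<and>
     (\<exists>e \<in> o[at xb](\<lambda>x. norm (x - xb)).
        \<forall>\<^sub>F x in at xb. g x \<ge> g xb + ereal (v \<bullet> (x - xb) + e x))}"

definition limiting_subdiff :: "('a::real_inner \<Rightarrow> ereal) \<Rightarrow> 'a \<Rightarrow> 'a set" where
  "limiting_subdiff g xb = {v. \<bar>g xb\<bar> \<noteq> \<infinity> \<and>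
     (\<exists>vs xs. (\<forall>k. vs k \<in> regular_subdiff g (xs k)) \<and> vs \<longlonglongrightarrow> v \<and> xs \<longlonglongrightarrow> xb \<and>
        (\<lambda>k::nat. g (xs k)) \<longlonglongrightarrow> g xb)}"

definition clarke_regular :: "('a::real_inner \<Rightarrow> ereal) \<Rightarrow> 'a \<Rightarrow> bool" where
  "clarke_regular g x \<longleftrightarrow> regular_subdiff g x = limiting_subdiff g x"

text \<open>Rockafellar and Wets, Variational Analysis, Definition 1.33.\<close>

definition locally_lsc_at :: "('a::real_inner \<Rightarrow> ereal) \<Rightarrow> 'a \<Rightarrow> bool" where
  "locally_lsc_at g xb \<longleftrightarrow>
     (\<exists>\<epsilon>>0. \<forall>a. a \<le> g xb + ereal \<epsilon> \<longrightarrow> closed {x \<in> cball xb \<epsilon>. g x \<le> a})"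

definition prox_regular :: "real \<Rightarrow> ('a::real_inner \<Rightarrow> ereal) \<Rightarrow> 'a \<Rightarrow> bool" where
  "prox_regular r g xb \<longleftrightarrow> \<bar>g xb\<bar> \<noteq> \<infinity> \<and> locally_lsc_at g xb \<and>
     (\<forall>vb \<in> limiting_subdiff g xb. \<exists>\<epsilon>>0. \<forall>x x' v.
        v \<in> limiting_subdiff g x \<and> norm (x - xb) < \<epsilon> \<and> norm (x' - xb) < \<epsilon> \<and>
        norm (v - vb) < \<epsilon> \<and> g x < g xb + ereal \<epsilon> \<longrightarrow>
        g x' \<ge> g x + ereal (v \<bullet> (x' - x) - r / 2 * (norm (x' - x))\<^sup>2))"

text \<open>Continuity of a set-valued map at a point relative to \<open>M\<close>, in the sense of
  Painleve and Kuratowski: outer and inner semicontinuity.\<close>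

definition set_valued_continuous_at ::
  "'a::topological_space set \<Rightarrow> ('a \<Rightarrow> 'b::topological_space set) \<Rightarrow> 'a \<Rightarrow> bool" where
  "set_valued_continuous_at M S xb \<longleftrightarrow>
     (\<forall>xs vs v. (\<forall>k::nat. xs k \<in> M \<and> vs k \<in> S (xs k)) \<and> xs \<longlonglongrightarrow> xb \<and> vs \<longlonglongrightarrow> v \<longrightarrow> v \<in> S xb) \<and>
     (\<forall>v\<in>S xb. \<forall>xs. (\<forall>k::nat. xs k \<in> M) \<and> xs \<longlonglongrightarrow> xb \<longrightarrow>
        (\<exists>vs. (\<forall>\<^sub>F k in sequentially. vs k \<in> S (xs k)) \<and> vs \<longlonglongrightarrow> v))"

definition partly_smooth :: "('a::euclidean_space \<Rightarrow> ereal) \<Rightarrow> 'a set \<Rightarrow> 'a \<Rightarrow> bool" where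
  "partly_smooth g M xb \<longleftrightarrow>
     xb \<in> M \<and>
     (\<exists>p U. open U \<and> xb \<in> U \<and> (\<forall>x\<in>M \<inter> U. C2_submanifold_around p M x)) \<and>
     C2_restriction_ereal_at M g xb \<and>
     (\<forall>\<^sub>F x in nhds xb. x \<in> M \<longrightarrow> clarke_regular g x \<and> limiting_subdiff g x \<noteq> {}) \<and>
     (\<exists>a. affine hull (limiting_subdiff g xb) = (+) a ` normal_space M xb) \<and>
     set_valued_continuous_at M (limiting_subdiff g) xb"


section \<open>The composite problem\<close>

definition objective :: "('a \<Rightarrow> real) \<Rightarrow> ('a \<Rightarrow> ereal) \<Rightarrow> 'a \<Rightarrow> ereal" where
  "objective f g x = ereal (f x) + g x"

text \<open>Real-valued version, used only near points of manifolds on which the objective is finite.\<close>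

definition objective_real :: "('a \<Rightarrow> real) \<Rightarrow> ('a \<Rightarrow> ereal) \<Rightarrow> 'a \<Rightarrow> real" where
  "objective_real f g x = real_of_ereal (objective f g x)"

definition prox :: "real \<Rightarrow> ('a::real_inner \<Rightarrow> ereal) \<Rightarrow> 'a \<Rightarrow> 'a set" where
  "prox \<gamma> g y =
     {u. is_arg_min (\<lambda>u. g u + ereal (1 / (2 * \<gamma>) * (norm (u - y))\<^sup>2)) (\<lambda>_. True) u}"

definition proper :: "('a \<Rightarrow> ereal) \<Rightarrow> bool" where
  "proper g \<longleftrightarrow> (\<forall>x. g x \<noteq> -\<infinity>) \<and> (\<exists>x. g x \<noteq> \<infinity>)"

text \<open>Properness of \<open>f\<close> is automatic, as \<open>f\<close> is real-valued.\<close>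

definition standing_assumptions ::
  "('a::euclidean_space \<Rightarrow> real) \<Rightarrow> ('a \<Rightarrow> ereal) \<Rightarrow> real \<Rightarrow> bool" where
  "standing_assumptions f g L \<longleftrightarrow>
     C2_on UNIV f \<and> lipschitz_on L UNIV (gradient f) \<and>
     proper g \<and> (\<forall>x. g x \<le> Liminf (at x) g) \<and>
     (\<forall>\<gamma>>0. \<forall>y. prox \<gamma> g y \<noteq> {}) \<and>
     (\<exists>B::real. \<forall>x. ereal B \<le> objective f g x)"

definition critical_point :: "('a::euclidean_space \<Rightarrow> real) \<Rightarrow> ('a \<Rightarrow> ereal) \<Rightarrow> 'a \<Rightarrow> bool" where
  "critical_point f g x \<longleftrightarrow> 0 \<in> (+) (gradient f x) ` limiting_subdiff g x"

definition structured_critical_point ::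
  "real \<Rightarrow> ('a::euclidean_space \<Rightarrow> real) \<Rightarrow> ('a \<Rightarrow> ereal) \<Rightarrow> 'a set \<Rightarrow> 'a \<Rightarrow> bool" where
  "structured_critical_point r f g M xb \<longleftrightarrow>
     r > 0 \<and> xb \<in> M \<and>
     prox (1 / r) g (xb - (1 / r) *\<^sub>R gradient f xb) = {xb} \<and>
     0 \<in> rel_interior ((+) (gradient f xb) ` limiting_subdiff g xb) \<and>
     prox_regular r g xb \<and>
     partly_smooth g M xb"


section \<open>The algorithm\<close>

definition armijo ::
  "('a::euclidean_space \<Rightarrow> real) \<Rightarrow> ('a \<Rightarrow> ereal) \<Rightarrow> real \<Rightarrow> 'a set \<Rightarrow> ('a \<Rightarrow> 'a \<Rightarrow> 'a) \<Rightarrow>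
     'a \<Rightarrow> 'a \<Rightarrow> real \<Rightarrow> bool" where
  "armijo f g m\<^sub>1 M R x d \<alpha> \<longleftrightarrow>
     objective f g (R x (\<alpha> *\<^sub>R d))
       \<le> objective f g x + ereal (m\<^sub>1 * \<alpha> * (riem_grad M (objective_real f g) x \<bullet> d))"

definition backtracking_step ::
  "('a::euclidean_space \<Rightarrow> real) \<Rightarrow> ('a \<Rightarrow> ereal) \<Rightarrow> real \<Rightarrow> real \<Rightarrow> 'a set \<Rightarrow> ('a \<Rightarrow> 'a \<Rightarrow> 'a) \<Rightarrow>
     'a \<Rightarrow> 'a \<Rightarrow> real \<Rightarrow> bool" where
  "backtracking_step f g m\<^sub>1 \<beta> M R x d \<alpha> \<longleftrightarrow>
     (\<exists>j::nat. \<alpha> = \<beta> ^ j \<and> armijo f g m\<^sub>1 M R x d (\<beta> ^ j) \<and>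
        (\<forall>i<j. \<not> armijo f g m\<^sub>1 M R x d (\<beta> ^ i)))"

text \<open>Indices start at \<open>1\<close>, with arbitrary initial point \<open>y 0\<close>; the values \<open>x 0\<close>, \<open>M 0\<close>, \<open>d 0\<close>, \<open>\<alpha> 0\<close>
  play no role. \<open>R N\<close> is the retraction used on the manifold \<open>N\<close>.\<close>

definition newton_prox_gradient ::
  "('a::euclidean_space \<Rightarrow> real) \<Rightarrow> ('a \<Rightarrow> ereal) \<Rightarrow> real \<Rightarrow> real \<Rightarrow> real \<Rightarrow>
     ('a set \<Rightarrow> 'a \<Rightarrow> 'a \<Rightarrow> 'a) \<Rightarrow> (nat \<Rightarrow> 'a set) \<Rightarrow>
     (nat \<Rightarrow> 'a) \<Rightarrow> (nat \<Rightarrow> 'a) \<Rightarrow> (nat \<Rightarrow> real) \<Rightarrow> (nat \<Rightarrow> 'a) \<Rightarrow> bool" where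
  "newton_prox_gradient f g \<gamma> m\<^sub>1 \<beta> R M x d \<alpha> y \<longleftrightarrow>
     (\<forall>k\<ge>1.
        x k \<in> prox \<gamma> g (y (k - 1) - \<gamma> *\<^sub>R gradient f (y (k - 1))) \<and>
        C2_submanifold (M k) \<and> x k \<in> M k \<and>
        C2_restriction_ereal_at (M k) (objective f g) (x k) \<and>
        second_order_retraction (M k) (R (M k)) \<and>
        d k \<in> tangent_space (M k) (x k) \<and>
        riem_grad (M k) (objective_real f g) (x k)
          + riem_hess (M k) (objective_real f g) (x k) (d k) = 0 \<and>
        backtracking_step f g m\<^sub>1 \<beta> (M k) (R (M k)) (x k) (d k) (\<alpha> k) \<and>
        y k = R (M k) (x k) (\<alpha> k *\<^sub>R d k))"

definition seq_limit_point :: "(nat \<Rightarrow> 'a::topological_space) \<Rightarrow> 'a \<Rightarrow> bool" where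
  "seq_limit_point x l \<longleftrightarrow> (\<exists>s. strict_mono s \<and> (x \<circ> s) \<longlonglongrightarrow> l)"

end

theory Submission
  imports Defs
begin

text \<open>The proximal gradient step decreases \<open>F\<close> by a multiple of \<open>(norm (x (Suc k) - y k))\<^sup>2\<close>, the Armijo
  step does not increase it, and the optimality condition of the proximal step provides a
  subgradient of \<open>F\<close> at \<open>x (Suc k)\<close> that vanishes along convergent subsequences.

  For the local part, \<open>x\<^sup>*\<close> is a strict global minimiser of the \<open>1 / \<gamma>\<close>-proximal model because
  \<open>r < 1 / \<gamma>\<close>; this alone gives \<open>norm (p - x\<^sup>*) \<le> C * norm (y - x\<^sup>*)\<close> for every prox-gradient point \<open>p\<close>
  of \<open>y\<close>, and partial smoothness forces \<open>p\<close> onto \<open>M\<close> for \<open>y\<close> near \<open>x\<^sup>*\<close>. The Newton step is studied in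
  a slice chart, with \<open>\<phi> = F \<circ> \<Psi>\<close> and \<open>e = w - w0\<close>. On a C2 manifold \<open>\<phi>''\<close> is merely continuous in general,
  but as the gradient vanishes at \<open>x\<^sup>*\<close>, a Lipschitz Hessian still yields \<open>\<phi>'' w = \<phi>'' w0 + O(e)\<close>.
  Hence the full Newton step is accepted and has quadratically small error.\<close>

section \<open>Proximal gradient steps\<close>

text \<open>The quantity tied to the Lipschitz assumption is the Hessian in the frame
  \<open>\<Psi>' w\<close>, which equals \<open>\<phi>'' w\<close> minus the pairing of the gradient
  with \<open>\<Psi>'' w\<close>. The latter is a Christoffel term with merely continuous
  coefficients, so a Lipschitz bound between two arbitrary nearby points does not pass to
  \<open>\<phi>''\<close>. Comparison with \<open>w0\<close> survives, because the term vanishes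
  there and is nearby at most a bounded factor times the size of the gradient. Hence the Taylor
  expansions of \<open>\<phi>\<close> are centred at \<open>w0\<close>, whereas those of
  \<open>\<Psi>\<close> and of the retraction, both C2, are uniform in a moving base point. The prox
  step loses at most a constant factor, so the squared Newton error survives it, and identification
  puts the new point on \<open>M\<close> again. One visit to a small ball therefore traps the
  iterates, the error at least halving at every step. The estimates are Euclidean;
  \<open>riem_dist\<close> enters at the end, squeezed between \<open>dist\<close> and a multiple of
  it near the limit.\<close>

lemma C2_GDERIV:
  fixes f :: "'a::euclidean_space \<Rightarrow> real"
  assumes "C2_on UNIV f"
  shows "GDERIV f x :> gradient f x"
proof -
  obtain f' :: "'a \<Rightarrow> 'a \<Rightarrow>\<^sub>L real" where f': "(f has_derivative blinfun_apply (f' x)) (at x)"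
    using assms unfolding C2_on_def by blast
  have lin: "linear (blinfun_apply (f' x))"
    using blinfun.bounded_linear_right by (rule bounded_linear.linear)
  \<comment> \<open>The adjoint applied to 1 is the Riesz representative of the derivative, the
    witness for the definite description \<open>gradient\<close>.\<close>
  define D where "D = adjoint (blinfun_apply (f' x)) 1"
  have "blinfun_apply (f' x) h = h \<bullet> D" for h
    using adjoint_works[OF lin, of h 1] unfolding D_def by simp
  then have "blinfun_apply (f' x) = (\<lambda>h. h \<bullet> D)" by (rule ext)
  then have "GDERIV f x :> D"
    unfolding gderiv_def using f' by simp
  moreover have "D' = D" if "GDERIV f x :> D'" for D'
  proof -
    have "(\<lambda>h. h \<bullet> D') = (\<lambda>h. h \<bullet> D)"
      using that \<open>GDERIV f x :> D\<close> unfolding gderiv_def by (rule has_derivative_unique)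
    then show ?thesis by (metis vector_eq_ldot)
  qed
  ultimately show ?thesis
    unfolding gradient_def by (rule theI)
qed

text \<open>Subtracting the quadratic model along the segment from \<open>y\<close> to
  \<open>x\<close> leaves \<open>q\<close>, whose derivative is nonpositive by Cauchy-Schwarz and
  the Lipschitz bound on the gradient.\<close>

lemma descent_lemma:
  fixes f :: "'a::euclidean_space \<Rightarrow> real"
  assumes "C2_on UNIV f" and L: "lipschitz_on L UNIV (gradient f)"
  shows "f x \<le> f y + gradient f y \<bullet> (x - y) + L / 2 * (norm (x - y))\<^sup>2"
proof -
  define v where "v = x - y"
  define q where "q t = f (y + t *\<^sub>R v) - t * (gradient f y \<bullet> v) - L / 2 * t\<^sup>2 * (norm v)\<^sup>2" for t
  have "q 1 \<le> q 0"
  proof (rule DERIV_nonpos_imp_nonincreasing[where f=q and a=0 and b=1])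
    fix t :: real assume t: "0 \<le> t" "t \<le> 1"
    have f: "(f has_derivative (\<lambda>h. h \<bullet> gradient f (y + t *\<^sub>R v))) (at (y + t *\<^sub>R v))"
      using C2_GDERIV[OF assms(1)] unfolding gderiv_def .
    have line: "((\<lambda>t. y + t *\<^sub>R v) has_derivative (\<lambda>h. h *\<^sub>R v)) (at t)"
      by (auto intro!: derivative_eq_intros)
    have "((\<lambda>t. f (y + t *\<^sub>R v)) has_derivative (\<lambda>h. (h *\<^sub>R v) \<bullet> gradient f (y + t *\<^sub>R v))) (at t)"
      using has_derivative_compose[OF line f] .
    then have d: "((\<lambda>t. f (y + t *\<^sub>R v)) has_real_derivative (v \<bullet> gradient f (y + t *\<^sub>R v))) (at t)"
      by (rule has_derivative_imp_has_field_derivative) simp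
    have "(q has_real_derivative
        (v \<bullet> gradient f (y + t *\<^sub>R v) - gradient f y \<bullet> v - L * t * (norm v)\<^sup>2)) (at t)"
    proof -
      have "((\<lambda>t. t * (gradient f y \<bullet> v)) has_real_derivative gradient f y \<bullet> v) (at t)"
        and "((\<lambda>t. L / 2 * t\<^sup>2 * (norm v)\<^sup>2) has_real_derivative L * t * (norm v)\<^sup>2) (at t)"
        by (auto intro!: derivative_eq_intros)
      then show ?thesis unfolding q_def by (intro DERIV_diff d)
    qed
    moreover have "v \<bullet> gradient f (y + t *\<^sub>R v) - gradient f y \<bullet> v - L * t * (norm v)\<^sup>2 \<le> 0"
    proof -
      have "v \<bullet> gradient f (y + t *\<^sub>R v) - gradient f y \<bullet> v
          = v \<bullet> (gradient f (y + t *\<^sub>R v) - gradient f y)"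
        by (simp add: inner_diff_right inner_commute)
      also have "\<dots> \<le> norm v * norm (gradient f (y + t *\<^sub>R v) - gradient f y)"
        by (rule norm_cauchy_schwarz)
      also have "\<dots> \<le> norm v * (L * (t * norm v))"
        using lipschitz_onD[OF L, of "y + t *\<^sub>R v" y] t
        by (intro mult_left_mono) (auto simp: dist_norm)
      finally show ?thesis by (simp add: power2_eq_square algebra_simps)
    qed
    ultimately show "\<exists>D. (q has_real_derivative D) (at t) \<and> D \<le> 0" by blast
  qed simp
  then show ?thesis
    by (simp add: q_def v_def)
qed

lemma prox_le:
  assumes "u \<in> prox \<gamma> g c"
  shows "g u + ereal (1 / (2 * \<gamma>) * (norm (u - c))\<^sup>2) \<le> g z + ereal (1 / (2 * \<gamma>) * (norm (z - c))\<^sup>2)"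
  using assms unfolding prox_def is_arg_min_def by (auto simp: not_less)

lemma prox_finite:
  assumes "u \<in> prox \<gamma> g c" and "proper g"
  shows "\<bar>g u\<bar> \<noteq> \<infinity>"
proof -
  obtain z where "g z \<noteq> \<infinity>" using assms(2) unfolding proper_def by blast
  with prox_le[OF assms(1), of z] have "g u \<noteq> \<infinity>"
    by (cases "g z"; cases "g u") auto
  with assms(2) show ?thesis unfolding proper_def by auto
qed

text \<open>Completing the square shows that the prox objective at a gradient step is the linearised
  model of the smooth part plus a proximal term, up to a constant independent of
  \<open>z\<close>.\<close>

lemma norm_prox_expand:
  fixes z y D :: "'a::real_inner"
  assumes "\<gamma> > 0"
  shows "1 / (2 * \<gamma>) * (norm (z - (y - \<gamma> *\<^sub>R D)))\<^sup>2
    = 1 / (2 * \<gamma>) * (norm (z - y))\<^sup>2 + D \<bullet> (z - y) + \<gamma> / 2 * (norm D)\<^sup>2"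
proof -
  have "(norm (z - (y - \<gamma> *\<^sub>R D)))\<^sup>2 = (norm ((z - y) + \<gamma> *\<^sub>R D))\<^sup>2"
    by (simp add: algebra_simps)
  also have "\<dots> = (norm (z - y))\<^sup>2 + 2 * \<gamma> * (D \<bullet> (z - y)) + \<gamma>\<^sup>2 * (norm D)\<^sup>2"
    by (simp add: power2_norm_eq_inner inner_add_left inner_add_right inner_commute
        power2_eq_square[of \<gamma>] algebra_simps)
  finally have eq: "(norm (z - (y - \<gamma> *\<^sub>R D)))\<^sup>2
      = (norm (z - y))\<^sup>2 + 2 * \<gamma> * (D \<bullet> (z - y)) + \<gamma>\<^sup>2 * (norm D)\<^sup>2" .
  show ?thesis
    unfolding eq using assms by (simp add: field_simps power2_eq_square)
qed

text \<open>The constant from the completed square cancels between the two sides. The lemma serves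
  both the prox steps of the algorithm and the prox of parameter \<open>1 / r\<close> that defines a
  structured critical point.\<close>

lemma prox_grad_le:
  fixes D :: "'a::real_inner"
  assumes u: "u \<in> prox \<gamma> g (y - \<gamma> *\<^sub>R D)" and \<gamma>: "\<gamma> > 0"
    and "g u = ereal gu" and "g z = ereal gz"
  shows "gu + D \<bullet> (u - y) + 1 / (2 * \<gamma>) * (norm (u - y))\<^sup>2
    \<le> gz + D \<bullet> (z - y) + 1 / (2 * \<gamma>) * (norm (z - y))\<^sup>2"
  using prox_le[OF u, of z] unfolding norm_prox_expand[OF \<gamma>] assms(3,4) by simp

text \<open>This is Fermat's rule with an explicit remainder: minimality gives an inequality valid
  at every \<open>z\<close>, with error \<open>e\<close> quadratic in the distance and therefore
  little-o.\<close>

lemma prox_regular_subdiff: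
  fixes g :: "'a::real_inner \<Rightarrow> ereal"
  assumes u: "u \<in> prox \<gamma> g c" and "\<gamma> > 0" and "proper g"
  shows "(1 / \<gamma>) *\<^sub>R (c - u) \<in> regular_subdiff g u"
proof -
  define e where "e z = - (1 / (2 * \<gamma>) * (norm (z - u))\<^sup>2)" for z
  have fin: "\<bar>g u\<bar> \<noteq> \<infinity>" using prox_finite[OF u \<open>proper g\<close>] .
  have "((\<lambda>z. e z / norm (z - u)) \<longlongrightarrow> 0) (at u)"
  proof -
    have "((\<lambda>z. - (1 / (2 * \<gamma>)) * norm (z - u)) \<longlongrightarrow> 0) (at u)"
      using \<open>\<gamma> > 0\<close> by (auto intro!: tendsto_eq_intros)
    then show ?thesis
      by (rule Lim_transform_eventually)
        (auto simp: e_def eventually_at power2_eq_square intro!: exI[of _ 1])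
  qed
  moreover have "\<forall>\<^sub>F z in at u. norm (z - u) \<noteq> 0"
    by (simp add: eventually_at_filter)
  ultimately have "e \<in> o[at u](\<lambda>z. norm (z - u))"
    by (rule smalloI_tendsto[where f=e and g="\<lambda>z. norm (z - u)"])
  moreover have "g z \<ge> g u + ereal (((1 / \<gamma>) *\<^sub>R (c - u)) \<bullet> (z - u) + e z)" for z
  proof (cases "g z = \<infinity>")
    case False
    then obtain gz gu where gz: "g z = ereal gz" "g u = ereal gu"
      using \<open>proper g\<close> fin unfolding proper_def by (cases "g z"; cases "g u") auto
    define k where "k = 1 / (2 * \<gamma>)"
    have k: "1 / \<gamma> = 2 * k" unfolding k_def by simp
    have eq: "(norm (z - c))\<^sup>2 = (norm (z - u))\<^sup>2 - 2 * ((c - u) \<bullet> (z - u)) + (norm (u - c))\<^sup>2"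
      by (simp add: power2_norm_eq_inner inner_diff_left inner_diff_right inner_commute algebra_simps)
    have "gu + k * (norm (u - c))\<^sup>2 \<le> gz + k * (norm (z - c))\<^sup>2"
      using prox_le[OF u, of z] gz unfolding k_def by simp
    then have "gu + ((1 / \<gamma>) * ((c - u) \<bullet> (z - u)) + e z) \<le> gz"
      unfolding e_def k k_def[symmetric] eq by (simp add: algebra_simps)
    then show ?thesis using gz by simp
  qed simp
  ultimately show ?thesis
    unfolding regular_subdiff_def using fin by (auto intro: bexI[of _ e])
qed

lemma standing_assumptions_finite:
  assumes "standing_assumptions f g L" "u \<in> prox \<gamma> g c"
  shows "g u = ereal (real_of_ereal (g u))"
  using prox_finite[OF assms(2)] assms(1) unfolding standing_assumptions_def
  by (simp add: ereal_real)

text \<open>Minimality of \<open>u\<close> is tested against the competitor \<open>y\<close> and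
  combined with the descent lemma. The resulting coefficient is positive precisely when
  \<open>\<gamma> * L < 1\<close>.\<close>

lemma prox_grad_decrease:
  fixes f :: "'a::euclidean_space \<Rightarrow> real"
  assumes st: "standing_assumptions f g L" and "\<gamma> > 0"
    and u: "u \<in> prox \<gamma> g (y - \<gamma> *\<^sub>R gradient f y)"
  shows "objective f g u + ereal ((1 / (2 * \<gamma>) - L / 2) * (norm (u - y))\<^sup>2) \<le> objective f g y"
proof (cases "g y = \<infinity>")
  case False
  then obtain gy where gy: "g y = ereal gy"
    using st unfolding standing_assumptions_def proper_def by (cases "g y") auto
  obtain gu where gu: "g u = ereal gu" using standing_assumptions_finite[OF st u] by blast
  have "f u \<le> f y + gradient f y \<bullet> (u - y) + L / 2 * (norm (u - y))\<^sup>2"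
    using st descent_lemma unfolding standing_assumptions_def by blast
  moreover have "gu + gradient f y \<bullet> (u - y) + 1 / (2 * \<gamma>) * (norm (u - y))\<^sup>2 \<le> gy"
    using prox_grad_le[OF u \<open>\<gamma> > 0\<close> gu gy] by simp
  ultimately show ?thesis
    unfolding objective_def by (simp add: gy gu left_diff_distrib)
qed (simp add: objective_def)

section \<open>Limit points of the iterates\<close>

text \<open>The \<open>Liminf\<close> is over punctured neighbourhoods; \<open>b < g a\<close>
  itself covers the terms of the sequence that hit \<open>a\<close>.\<close>

lemma ereal_lsc_seq:
  fixes g :: "'a::metric_space \<Rightarrow> ereal"
  assumes lsc: "g a \<le> Liminf (at a) g" and x: "x \<longlonglongrightarrow> a" and b: "b < g a"
  shows "\<forall>\<^sub>F k in sequentially. b < g (x k)"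
proof -
  have "\<forall>\<^sub>F z in at a. b < g z"
    using less_LiminfD[of b "at a" g] lsc b by (auto simp: order_less_le_trans)
  then have "\<forall>\<^sub>F z in nhds a. b < g z"
    using b by (auto simp: eventually_at_filter elim: eventually_mono)
  then show ?thesis using x by (rule eventually_compose_filterlim)
qed

context
  fixes f :: "'a::euclidean_space \<Rightarrow> real" and g :: "'a \<Rightarrow> ereal"
    and L \<gamma> m\<^sub>1 \<beta> :: real
    and R :: "'a set \<Rightarrow> 'a \<Rightarrow> 'a \<Rightarrow> 'a"
    and Ms :: "nat \<Rightarrow> 'a set"
    and x d y :: "nat \<Rightarrow> 'a" and \<alpha> :: "nat \<Rightarrow> real"
  assumes st: "standing_assumptions f g L"
    and \<gamma>: "\<gamma> \<in> {0<..<1 / L}"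
    and m1: "0 < m\<^sub>1" and \<beta>: "0 < \<beta>"
    and alg: "newton_prox_gradient f g \<gamma> m\<^sub>1 \<beta> R Ms x d \<alpha> y"
    and pd: "\<forall>k\<ge>1. pos_def_on (tangent_space (Ms k) (x k))
                 (riem_hess (Ms k) (objective_real f g) (x k))"
begin

lemma iterates_prox: "x (Suc k) \<in> prox \<gamma> g (y k - \<gamma> *\<^sub>R gradient f (y k))"
  using alg unfolding newton_prox_gradient_def by (metis One_nat_def diff_Suc_1 le_add1 plus_1_eq_Suc)

text \<open>The Newton equation turns the slope into minus the Hessian form at \<open>d k\<close>,
  so the Armijo inequality is a decrease. The case \<open>d k = 0\<close> is separate because
  \<open>pos_def_on\<close> excludes the zero vector.\<close>

lemma newton_decrease:
  assumes "k \<ge> 1"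
  shows "objective f g (y k) \<le> objective f g (x k)"
proof -
  define gr where "gr = riem_grad (Ms k) (objective_real f g) (x k)"
  have dk: "d k \<in> tangent_space (Ms k) (x k)"
    and "gr + riem_hess (Ms k) (objective_real f g) (x k) (d k) = 0"
    and bt: "backtracking_step f g m\<^sub>1 \<beta> (Ms k) (R (Ms k)) (x k) (d k) (\<alpha> k)"
    and yk: "y k = R (Ms k) (x k) (\<alpha> k *\<^sub>R d k)"
    using alg assms unfolding newton_prox_gradient_def gr_def by blast+
  then have "gr \<bullet> d k = - (riem_hess (Ms k) (objective_real f g) (x k) (d k) \<bullet> d k)"
    by (metis add_eq_0_iff2 inner_minus_left)
  also have "\<dots> \<le> 0"
    using pd assms dk unfolding pos_def_on_def by (cases "d k = 0") (auto intro: less_imp_le)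
  finally have "gr \<bullet> d k \<le> 0" .
  moreover obtain j where j: "\<alpha> k = \<beta> ^ j" "armijo f g m\<^sub>1 (Ms k) (R (Ms k)) (x k) (d k) (\<beta> ^ j)"
    using bt unfolding backtracking_step_def by blast
  ultimately have "m\<^sub>1 * \<alpha> k * (gr \<bullet> d k) \<le> 0"
    using m1 \<beta> by (simp add: mult_nonneg_nonpos)
  then have "objective f g (x k) + ereal (m\<^sub>1 * \<alpha> k * (gr \<bullet> d k)) \<le> objective f g (x k)"
    by (cases "objective f g (x k)") auto
  then show ?thesis
    using j(2) unfolding armijo_def yk j(1) gr_def by order
qed

text \<open>Both claims come from \<open>key\<close>: the objective values decrease to some
  \<open>l\<close>, and every limit point is critical with value exactly \<open>l\<close>.\<close>

lemma
  shows iterates_limit_points_critical: "seq_limit_point x a \<Longrightarrow> critical_point f g a"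
    and iterates_limit_points_value:
      "seq_limit_point x a \<Longrightarrow> seq_limit_point x b \<Longrightarrow> objective f g a = objective f g b"
proof -
  define c where "c = 1 / (2 * \<gamma>) - L / 2"
  have \<gamma>0: "\<gamma> > 0" using \<gamma> by simp
  have lip: "lipschitz_on L UNIV (gradient f)" and proper: "proper g"
    and lsc: "\<And>z. g z \<le> Liminf (at z) g"
    using st unfolding standing_assumptions_def by blast+
  \<comment> \<open>If \<open>L\<close> were 0, then \<open>1 / L = 0\<close> by the HOL convention
    and no \<open>\<gamma>\<close> would lie in the interval.\<close>
  have L: "L > 0"
    using \<gamma> lipschitz_on_nonneg[OF lip] by (cases "L = 0") auto
  have c: "c > 0"
    using \<gamma> L unfolding c_def by (simp add: field_simps)
  obtain B where B: "\<And>z. ereal B \<le> objective f g z"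
    using st unfolding standing_assumptions_def by blast
  \<comment> \<open>Indexing by \<open>Suc k\<close> skips \<open>x 0\<close>, which the algorithm
    leaves unconstrained, so that all these values are finite.\<close>
  define G where "G k = real_of_ereal (g (x (Suc k)))" for k
  have G: "g (x (Suc k)) = ereal (G k)" for k
    using standing_assumptions_finite[OF st iterates_prox] unfolding G_def .
  define V where "V k = f (x (Suc k)) + G k" for k
  have V: "objective f g (x (Suc k)) = ereal (V k)" for k
    unfolding objective_def V_def G by simp
  have step: "V (Suc k) + c * (norm (x (Suc (Suc k)) - y (Suc k)))\<^sup>2 \<le> V k" for k
  proof -
    have "ereal (V (Suc k)) + ereal (c * (norm (x (Suc (Suc k)) - y (Suc k)))\<^sup>2)
        \<le> objective f g (y (Suc k))"
      using prox_grad_decrease[OF st \<gamma>0 iterates_prox] unfolding V[symmetric] c_def .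
    also have "\<dots> \<le> ereal (V k)"
      using newton_decrease[of "Suc k"] unfolding V by simp
    finally show ?thesis by simp
  qed
  have "V (Suc k) \<le> V k" for k
    using step[of k] c by (smt (verit) mult_nonneg_nonneg zero_le_power2)
  then have "decseq V" by (simp add: decseq_Suc_iff)
  moreover have "B \<le> V k" for k using B[of "x (Suc k)"] unfolding V by simp
  ultimately obtain l where l: "V \<longlonglongrightarrow> l"
    using decseq_convergent[of V B] by blast
  have "(\<lambda>k. V k - V (Suc k)) \<longlonglongrightarrow> l - l"
    by (intro tendsto_diff l LIMSEQ_Suc)
  then have diff: "(\<lambda>k. V k - V (Suc k)) \<longlonglongrightarrow> 0" by simp
  have "(\<lambda>k. c * (norm (x (Suc (Suc k)) - y (Suc k)))\<^sup>2) \<longlonglongrightarrow> 0"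
  proof (rule tendsto_sandwich[OF _ _ tendsto_const diff])
    show "\<forall>\<^sub>F k in sequentially. c * (norm (x (Suc (Suc k)) - y (Suc k)))\<^sup>2 \<le> V k - V (Suc k)"
      using step by (auto simp: algebra_simps)
  qed (use c in auto)
  then have "(\<lambda>k. (norm (x (Suc (Suc k)) - y (Suc k)))\<^sup>2) \<longlonglongrightarrow> 0"
    using c by (simp add: tendsto_mult_left_iff[of c _ 0, simplified])
  then have "(\<lambda>k. sqrt ((norm (x (Suc (Suc k)) - y (Suc k)))\<^sup>2)) \<longlonglongrightarrow> sqrt 0"
    by (rule tendsto_real_sqrt)
  then have "(\<lambda>k. norm (x (Suc (Suc k)) - y (Suc k))) \<longlonglongrightarrow> 0"
    by simp
  then have xy: "(\<lambda>k. x (Suc k) - y k) \<longlonglongrightarrow> 0"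
    using LIMSEQ_imp_Suc[of "\<lambda>k. x (Suc k) - y k" 0] tendsto_norm_zero_iff by blast
  have key: "critical_point f g a \<and> objective f g a = ereal l" if lp: "seq_limit_point x a" for a
  proof -
    obtain s where s: "strict_mono s" "(x \<circ> s) \<longlonglongrightarrow> a"
      using lp unfolding seq_limit_point_def by blast
    \<comment> \<open>Dropping the first term of the subsequence makes its indices positive, so each
      selected point is the prox point of some \<open>y (q k)\<close>.\<close>
    define q where "q k = s (Suc k) - 1" for k
    have sq: "s (Suc k) = Suc (q k)" for k
      using strict_mono_imp_increasing[OF s(1), of "Suc k"] unfolding q_def by simp
    have q: "filterlim q at_top sequentially"
    proof -
      have "q k \<ge> k" for k
        using strict_mono_imp_increasing[OF s(1), of "Suc k"] sq[of k] by linarith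
      then show ?thesis by (intro filterlim_at_top_mono[OF filterlim_ident]) auto
    qed
    define u where "u k = x (Suc (q k))" for k
    define z where "z k = y (q k)" for k
    have u: "u \<longlonglongrightarrow> a"
      using LIMSEQ_Suc[OF s(2)] unfolding u_def comp_def sq .
    have "(\<lambda>k. u k - z k) \<longlonglongrightarrow> 0"
      using filterlim_compose[OF xy q] unfolding u_def z_def .
    from tendsto_diff[OF u this] have z: "z \<longlonglongrightarrow> a" by simp
    have cont: "continuous_on UNIV (gradient f)" using lip by (rule lipschitz_on_continuous_on)
    have gr: "(\<lambda>k. gradient f (z k)) \<longlonglongrightarrow> gradient f a"
      using continuous_on_tendsto_compose[OF cont z] by simp
    have contf: "isCont f a"
      using C2_GDERIV[of f] st unfolding standing_assumptions_def gderiv_def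
      by (meson has_derivative_continuous)
    have fu: "(\<lambda>k. f (u k)) \<longlonglongrightarrow> f a" using isCont_tendsto_compose[OF contf u] .
    define h where "h k = G (q k)" for k
    have gu: "g (u k) = ereal (h k)" for k unfolding u_def h_def by (rule G)
    have "(\<lambda>k. V (q k) - f (u k)) \<longlonglongrightarrow> l - f a"
      by (intro tendsto_diff fu filterlim_compose[OF l q])
    then have h: "h \<longlonglongrightarrow> l - f a" unfolding V_def h_def u_def by simp
    then have h': "(\<lambda>k. g (u k)) \<longlonglongrightarrow> ereal (l - f a)" unfolding gu by simp
    \<comment> \<open>Lower semicontinuity excludes that \<open>g\<close> jumps up at the limit
      point.\<close>
    have le: "g a \<le> ereal (l - f a)"
    proof (rule ccontr)
      assume "\<not> ?thesis"
      then obtain b where b: "ereal (l - f a) < b" "b < g a"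
        using dense[of "ereal (l - f a)" "g a"] by (auto simp: not_le)
      have "\<forall>\<^sub>F k in sequentially. b < g (u k)" using ereal_lsc_seq[OF lsc u b(2)] .
      moreover have "\<forall>\<^sub>F k in sequentially. g (u k) < b" using order_tendstoD(2)[OF h' b(1)] .
      ultimately have "\<forall>\<^sub>F k in sequentially. False" by eventually_elim order
      then show False by simp
    qed
    then obtain ga where ga: "g a = ereal ga"
      using proper unfolding proper_def by (cases "g a") auto
    \<comment> \<open>The opposite inequality fails for general semicontinuous functions; here it
      holds because each \<open>u k\<close> minimises its prox model and \<open>a\<close> is an
      admissible competitor.\<close>
    have "l - f a \<le> ga"
    proof -
      have ineq: "h k + gradient f (z k) \<bullet> (u k - z k) + 1 / (2 * \<gamma>) * (norm (u k - z k))\<^sup>2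
          \<le> ga + gradient f (z k) \<bullet> (a - z k) + 1 / (2 * \<gamma>) * (norm (a - z k))\<^sup>2" for k
        using prox_grad_le[OF _ \<gamma>0 gu ga] iterates_prox unfolding u_def z_def by blast
      have 1: "(\<lambda>k. h k + gradient f (z k) \<bullet> (u k - z k) + 1 / (2 * \<gamma>) * (norm (u k - z k))\<^sup>2)
          \<longlonglongrightarrow> (l - f a) + gradient f a \<bullet> (a - a) + 1 / (2 * \<gamma>) * (norm (a - a))\<^sup>2"
        by (intro tendsto_intros h gr u z)
      have 2: "(\<lambda>k. ga + gradient f (z k) \<bullet> (a - z k) + 1 / (2 * \<gamma>) * (norm (a - z k))\<^sup>2)
          \<longlonglongrightarrow> ga + gradient f a \<bullet> (a - a) + 1 / (2 * \<gamma>) * (norm (a - a))\<^sup>2"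
        by (intro tendsto_intros gr u z)
      from LIMSEQ_le[OF 1 2] ineq show ?thesis by auto
    qed
    with le ga have ga': "ga = l - f a" by simp
    \<comment> \<open>These are the Fermat subgradients of the prox steps. Since
      \<open>u k - z k\<close> tends to 0, they tend to \<open>- gradient f a\<close>, and
      \<open>g_lim\<close> supplies the convergence of values that a limiting subgradient
      requires.\<close>
    define v where "v k = (1 / \<gamma>) *\<^sub>R (z k - \<gamma> *\<^sub>R gradient f (z k) - u k)" for k
    have v_mem: "v k \<in> regular_subdiff g (u k)" for k
      unfolding v_def u_def z_def using prox_regular_subdiff[OF iterates_prox \<gamma>0 proper] .
    have "v \<longlonglongrightarrow> (1 / \<gamma>) *\<^sub>R (a - \<gamma> *\<^sub>R gradient f a - a)"
      unfolding v_def by (intro tendsto_intros gr u z)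
    then have v_lim: "v \<longlonglongrightarrow> - gradient f a" using \<gamma>0 by simp
    have g_lim: "(\<lambda>k. g (u k)) \<longlonglongrightarrow> g a" using h' unfolding ga ga' .
    have "- gradient f a \<in> limiting_subdiff g a"
      unfolding limiting_subdiff_def using v_mem v_lim u g_lim ga by auto
    then have "critical_point f g a"
      unfolding critical_point_def by (auto intro!: image_eqI[of _ _ "- gradient f a"])
    moreover have "objective f g a = ereal l" unfolding objective_def ga ga' by simp
    ultimately show ?thesis by blast
  qed
  show "seq_limit_point x a \<Longrightarrow> critical_point f g a"
    using key by blast
  show "seq_limit_point x a \<Longrightarrow> seq_limit_point x b \<Longrightarrow> objective f g a = objective f g b"
    using key by metis
qed

end

section \<open>Slice charts\<close>

lemma has_vector_derivative_bilinear:
  assumes "bounded_bilinear p"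
    and "(f has_vector_derivative f') (at t within X)" "(g has_vector_derivative g') (at t within X)"
  shows "((\<lambda>s. p (f s) (g s)) has_vector_derivative (p (f t) g' + p f' (g t))) (at t within X)"
  using bounded_bilinear.FDERIV[OF assms(1) assms(2,3)[unfolded has_vector_derivative_def]]
    bounded_bilinear.scaleR_left[OF assms(1)] bounded_bilinear.scaleR_right[OF assms(1)]
  unfolding has_vector_derivative_def by (simp add: scaleR_right_distrib)

lemma has_vector_derivative_compose:
  assumes "(f has_vector_derivative f') (at t within X)" "(g has_derivative g') (at (f t))"
  shows "((\<lambda>s. g (f s)) has_vector_derivative g' f') (at t within X)"
  using vector_derivative_diff_chain_within[OF assms(1) has_derivative_at_withinI[OF assms(2)]]
  by (simp add: comp_def)

text \<open>On a subspace the obtuse-angle inequality of the closest point can be tested with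
  \<open>t\<close> and with \<open>- t\<close>, which turns it into orthogonality.\<close>

lemma
  fixes T :: "'a::euclidean_space set"
  assumes T: "subspace T"
  shows closest_point_subspace_mem: "closest_point T a \<in> T"
    and closest_point_subspace_inner: "t \<in> T \<Longrightarrow> closest_point T a \<bullet> t = a \<bullet> t"
    and closest_point_subspace_id: "t \<in> T \<Longrightarrow> closest_point T t = t"
    and closest_point_subspace_norm: "norm (closest_point T a) \<le> norm a"
proof -
  have cl: "closed T" and cv: "convex T" and ne: "T \<noteq> {}"
    using T closed_subspace subspace_imp_convex subspace_0 by blast+
  show mem: "closest_point T a \<in> T" using closest_point_in_set[OF cl ne] .
  show "closest_point T t = t" if "t \<in> T" for t using closest_point_self[OF that] .
  show "closest_point T a \<bullet> t = a \<bullet> t" if "t \<in> T"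
  proof -
    have "(a - closest_point T a) \<bullet> s \<le> 0" if "s \<in> T" for s
      using closest_point_dot[OF cv cl, of "closest_point T a + s" a] subspace_add[OF T mem that] by simp
    from this[of t] this[of "- t"] show ?thesis
      using that T by (auto simp: inner_diff_left subspace_neg)
  qed
  show "norm (closest_point T a) \<le> norm a"
    using closest_point_lipschitz[OF cv cl ne, of a 0] closest_point_self[of 0 T] subspace_0[OF T]
    by (simp add: dist_norm)
qed

lemma closest_point_subspace_add:
  fixes T :: "'a::euclidean_space set"
  assumes T: "subspace T"
  shows "closest_point T (a + b) = closest_point T a + closest_point T b"
proof -
  define z where "z = closest_point T (a + b) - (closest_point T a + closest_point T b)"
  have z: "z \<in> T"
    unfolding z_def by (intro subspace_diff subspace_add T closest_point_subspace_mem)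
  then have "z \<bullet> z = 0"
    by (subst (1) z_def) (simp add: inner_diff_left inner_add_left closest_point_subspace_inner[OF T])
  then show ?thesis unfolding z_def by simp
qed

text \<open>The part \<open>z\<close> of \<open>v\<close> orthogonal to \<open>S\<close> has zero
  pairing with \<open>f\<close> near \<open>t\<close>, hence zero pairing with the
  derivative.\<close>

lemma has_vector_derivative_in_subspace:
  fixes S :: "'a::euclidean_space set"
  assumes S: "subspace S" and d: "(f has_vector_derivative v) (at t)"
    and ev: "\<forall>\<^sub>F s in nhds t. f s \<in> S"
  shows "v \<in> S"
proof -
  define z where "z = v - closest_point S v"
  have orth: "z \<bullet> s = 0" if "s \<in> S" for s
    unfolding z_def using closest_point_subspace_inner[OF S that] by (simp add: inner_diff_left)
  have "((\<lambda>s. z \<bullet> f s) has_vector_derivative z \<bullet> v) (at t)"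
    by (rule bounded_linear.has_vector_derivative[OF bounded_linear_inner_right d])
  moreover have "((\<lambda>s. z \<bullet> f s) has_vector_derivative 0) (at t) \<longleftrightarrow>
      ((\<lambda>s. 0) has_vector_derivative (0::real)) (at t)"
    using ev eventually_nhds_x_imp_x[OF ev]
    by (intro has_vector_derivative_cong_ev) (auto elim!: eventually_mono simp: orth)
  then have "((\<lambda>s. z \<bullet> f s) has_vector_derivative 0) (at t)" by simp
  ultimately have "z \<bullet> v = 0" by (rule vector_derivative_unique_at)
  then have "z \<bullet> z = 0"
    using orth[OF closest_point_subspace_mem[OF S]] by (subst (2) z_def) (simp add: inner_diff_right)
  then show ?thesis
    using closest_point_subspace_mem[OF S, of v] unfolding z_def by simp
qed

text \<open>The maps \<open>\<Psi>' w\<close> act as a moving frame that is itself differentiated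
  along curves, which is why \<open>\<Psi>''\<close> is a parameter; \<open>\<Phi>'\<close> reads
  off coordinates and, by continuity, bounds them.\<close>

locale slice_chart =
  fixes M S U W :: "'a::euclidean_space set" and \<Phi> \<Psi> :: "'a \<Rightarrow> 'a"
    and \<Phi>' \<Psi>' :: "'a \<Rightarrow> 'a \<Rightarrow>\<^sub>L 'a" and \<Psi>'' :: "'a \<Rightarrow> 'a \<Rightarrow>\<^sub>L ('a \<Rightarrow>\<^sub>L 'a)"
  assumes open_U: "open U" and open_W: "open W"
    and deriv_\<Phi>: "x \<in> U \<Longrightarrow> (\<Phi> has_derivative \<Phi>' x) (at x)"
    and deriv_\<Psi>: "w \<in> W \<Longrightarrow> (\<Psi> has_derivative \<Psi>' w) (at w)"
    and deriv2_\<Psi>: "w \<in> W \<Longrightarrow> (\<Psi>' has_derivative \<Psi>'' w) (at w)"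
    and cont_\<Phi>': "continuous_on U \<Phi>'"
    and cont_\<Psi>'': "continuous_on W \<Psi>''"
    and homeo: "homeomorphism U W \<Phi> \<Psi>"
    and subspace_S: "subspace S"
    and slice: "\<Phi> ` (M \<inter> U) = S \<inter> W"
begin

lemma \<Psi>\<Phi> [simp]: "x \<in> U \<Longrightarrow> \<Psi> (\<Phi> x) = x"
  and \<Phi>\<Psi> [simp]: "w \<in> W \<Longrightarrow> \<Phi> (\<Psi> w) = w"
  and \<Phi>_mem: "x \<in> U \<Longrightarrow> \<Phi> x \<in> W"
  and \<Psi>_mem: "w \<in> W \<Longrightarrow> \<Psi> w \<in> U"
  using homeo unfolding homeomorphism_def by auto

lemma \<Phi>_slice: "x \<in> M \<Longrightarrow> x \<in> U \<Longrightarrow> \<Phi> x \<in> S"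
  using slice by blast

lemma \<Psi>_slice: "w \<in> S \<Longrightarrow> w \<in> W \<Longrightarrow> \<Psi> w \<in> M"
proof -
  assume "w \<in> S" "w \<in> W"
  then have "w \<in> \<Phi> ` (M \<inter> U)" unfolding slice by blast
  then show "\<Psi> w \<in> M" by auto
qed

lemma \<Psi>'\<Phi>': assumes "x \<in> U" shows "\<Psi>' (\<Phi> x) (\<Phi>' x v) = v"
proof -
  have "((\<lambda>x. \<Psi> (\<Phi> x)) has_derivative (\<lambda>v. \<Psi>' (\<Phi> x) (\<Phi>' x v))) (at x)"
    using has_derivative_compose[OF deriv_\<Phi>[OF assms] deriv_\<Psi>[OF \<Phi>_mem[OF assms]]] .
  then have "((\<lambda>x. x) has_derivative (\<lambda>v. \<Psi>' (\<Phi> x) (\<Phi>' x v))) (at x)"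
    by (rule has_derivative_transform_within_open[OF _ open_U assms]) simp
  from has_derivative_unique[OF this has_derivative_ident] show ?thesis by meson
qed

lemma \<Phi>'\<Psi>': assumes "w \<in> W" shows "\<Phi>' (\<Psi> w) (\<Psi>' w v) = v"
proof -
  have "((\<lambda>w. \<Phi> (\<Psi> w)) has_derivative (\<lambda>v. \<Phi>' (\<Psi> w) (\<Psi>' w v))) (at w)"
    using has_derivative_compose[OF deriv_\<Psi>[OF assms] deriv_\<Phi>[OF \<Psi>_mem[OF assms]]] .
  then have "((\<lambda>x. x) has_derivative (\<lambda>v. \<Phi>' (\<Psi> w) (\<Psi>' w v))) (at w)"
    by (rule has_derivative_transform_within_open[OF _ open_W assms]) simp
  from has_derivative_unique[OF this has_derivative_ident] show ?thesis by meson
qed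

lemma cont_\<Psi>': "continuous_on W \<Psi>'"
  using deriv2_\<Psi> by (meson continuous_at_imp_continuous_on has_derivative_continuous)

lemma cont_\<Phi>: "continuous_on U \<Phi>" and cont_\<Psi>: "continuous_on W \<Psi>"
  using homeo unfolding homeomorphism_def by auto

text \<open>Near 0 the curve stays in the chart domain, so its chart image runs in the linear space
  \<open>S\<close> and its velocity cannot leave \<open>S\<close>.\<close>

lemma curve_in_chart:
  assumes c: "curve_through M x v c" and x: "x \<in> U"
  shows "\<forall>\<^sub>F t in nhds 0. c t \<in> M \<inter> U"
    and "((\<lambda>t. \<Phi> (c t)) has_vector_derivative \<Phi>' x v) (at 0)"
    and "\<Phi>' x v \<in> S"
proof -
  obtain \<epsilon> where c0: "c 0 = x" and cd: "(c has_vector_derivative v) (at 0)"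
    and \<epsilon>: "\<epsilon> > 0" "c ` {-\<epsilon><..<\<epsilon>} \<subseteq> M"
    using c unfolding curve_through_def by blast
  have "\<forall>\<^sub>F t in nhds 0. t \<in> {-\<epsilon><..<\<epsilon>}"
    using \<epsilon>(1) by (intro eventually_nhds_in_open) auto
  moreover have "(c \<longlongrightarrow> x) (nhds 0)"
    using has_vector_derivative_continuous[OF cd] c0
    by (metis isCont_def tendsto_at_iff_tendsto_nhds)
  then have "\<forall>\<^sub>F t in nhds 0. c t \<in> U"
    using open_U x by (rule topological_tendstoD)
  ultimately show ev: "\<forall>\<^sub>F t in nhds 0. c t \<in> M \<inter> U"
    by eventually_elim (use \<epsilon>(2) in auto)
  show d: "((\<lambda>t. \<Phi> (c t)) has_vector_derivative \<Phi>' x v) (at 0)"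
    using has_vector_derivative_compose[OF cd] deriv_\<Phi>[OF x] c0 by simp
  have "\<forall>\<^sub>F t in nhds 0. \<Phi> (c t) \<in> S"
    using ev by eventually_elim (auto intro: \<Phi>_slice)
  with subspace_S d show "\<Phi>' x v \<in> S" by (rule has_vector_derivative_in_subspace)
qed

text \<open>Images of straight lines in \<open>S\<close> are the test curves of the development:
  they realise every frame vector as a velocity.\<close>

lemma curve_chart_line:
  assumes "w \<in> S" "w \<in> W" "a \<in> S"
  shows "curve_through M (\<Psi> w) (\<Psi>' w a) (\<lambda>t. \<Psi> (w + t *\<^sub>R a))"
proof -
  have line: "((\<lambda>t. w + t *\<^sub>R a) has_vector_derivative a) (at t)" for t
    by (auto intro!: derivative_eq_intros)
  have d: "((\<lambda>t. \<Psi> (w + t *\<^sub>R a)) has_vector_derivative \<Psi>' (w + t *\<^sub>R a) a) (at t)"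
    if "w + t *\<^sub>R a \<in> W" for t
    using has_vector_derivative_compose[OF line deriv_\<Psi>[OF that]] .
  have "open ((\<lambda>t. w + t *\<^sub>R a) -` W)"
    by (intro continuous_open_vimage open_W) (auto intro!: continuous_intros)
  then obtain \<epsilon> where \<epsilon>: "\<epsilon> > 0" "ball 0 \<epsilon> \<subseteq> (\<lambda>t. w + t *\<^sub>R a) -` W"
    using assms(2) open_contains_ball_eq[of "(\<lambda>t. w + t *\<^sub>R a) -` W" 0] by auto
  have in_W: "w + t *\<^sub>R a \<in> W" if "t \<in> {-\<epsilon><..<\<epsilon>}" for t
    using \<epsilon>(2) that by (auto simp: subset_eq)
  have "continuous_on {-\<epsilon><..<\<epsilon>} (\<lambda>t. \<Psi>' (w + t *\<^sub>R a) a)"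
    by (intro continuous_intros continuous_on_compose2[OF cont_\<Psi>']) (use in_W in auto)
  then have "(\<lambda>t. \<Psi> (w + t *\<^sub>R a)) C1_differentiable_on {-\<epsilon><..<\<epsilon>}"
    unfolding C1_differentiable_on_def using d[OF in_W]
    by (intro exI[of _ "\<lambda>t. \<Psi>' (w + t *\<^sub>R a) a"] conjI ballI)
  moreover have "(\<lambda>t. \<Psi> (w + t *\<^sub>R a)) ` {-\<epsilon><..<\<epsilon>} \<subseteq> M"
    using assms by (intro image_subsetI \<Psi>_slice in_W subspace_add subspace_scale subspace_S)
  moreover have "((\<lambda>t. \<Psi> (w + t *\<^sub>R a)) has_vector_derivative \<Psi>' w a) (at 0)"
    using d[of 0] assms(2) by simp
  moreover have "\<Psi> (w + 0 *\<^sub>R a) = \<Psi> w" by simp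
  ultimately show ?thesis
    using \<epsilon>(1) unfolding curve_through_def by blast
qed

lemma tangent_space_eq:
  assumes w: "w \<in> S" "w \<in> W"
  shows "tangent_space M (\<Psi> w) = \<Psi>' w ` S"
proof
  show "tangent_space M (\<Psi> w) \<subseteq> \<Psi>' w ` S"
  proof
    fix v assume "v \<in> tangent_space M (\<Psi> w)"
    then obtain c where "curve_through M (\<Psi> w) v c" unfolding tangent_space_def by blast
    from curve_in_chart(3)[OF this \<Psi>_mem[OF w(2)]] have "\<Phi>' (\<Psi> w) v \<in> S" .
    moreover have "v = \<Psi>' w (\<Phi>' (\<Psi> w) v)"
      using \<Psi>'\<Phi>'[OF \<Psi>_mem[OF w(2)], of v] w(2) by simp
    ultimately show "v \<in> \<Psi>' w ` S" by blast
  qed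
  show "\<Psi>' w ` S \<subseteq> tangent_space M (\<Psi> w)"
    unfolding tangent_space_def using curve_chart_line[OF w] by blast
qed

lemma subspace_tangent:
  assumes w: "w \<in> S" "w \<in> W"
  shows "subspace (tangent_space M (\<Psi> w))"
  unfolding tangent_space_eq[OF w]
  by (intro linear_subspace_image subspace_S bounded_linear.linear blinfun.bounded_linear_right)

lemma tangent_iff:
  assumes w: "w \<in> S" "w \<in> W"
  shows "v \<in> tangent_space M (\<Psi> w) \<longleftrightarrow> \<Phi>' (\<Psi> w) v \<in> S"
  unfolding tangent_space_eq[OF w]
  using \<Phi>'\<Psi>'[OF w(2)] \<Psi>'\<Phi>'[OF \<Psi>_mem[OF w(2)]] w(2) by (metis \<Phi>\<Psi> image_iff)

text \<open>A Riesz theorem for forms given in coordinates: \<open>l\<close> is pulled back to the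
  ambient space by \<open>\<Phi>'\<close>, represented there by an adjoint, and the representative
  is projected to the tangent space.\<close>

lemma tangent_representation:
  assumes w: "w \<in> S" "w \<in> W" and l: "linear l"
  shows "\<exists>z\<in>tangent_space M (\<Psi> w). \<forall>b\<in>S. z \<bullet> \<Psi>' w b = l b"
proof -
  define m where "m = l \<circ> \<Phi>' (\<Psi> w)"
  have m: "linear m"
    unfolding m_def
    by (intro linear_compose l bounded_linear.linear blinfun.bounded_linear_right)
  define z where "z = closest_point (tangent_space M (\<Psi> w)) (adjoint m 1)"
  have "z \<bullet> \<Psi>' w b = l b" if b: "b \<in> S" for b
  proof -
    have "\<Psi>' w b \<in> tangent_space M (\<Psi> w)" using b tangent_space_eq[OF w] by blast
    then have "z \<bullet> \<Psi>' w b = adjoint m 1 \<bullet> \<Psi>' w b"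
      unfolding z_def by (rule closest_point_subspace_inner[OF subspace_tangent[OF w]])
    also have "\<dots> = m (\<Psi>' w b)" using adjoint_works[OF m, of "\<Psi>' w b" 1] by (simp add: inner_commute)
    also have "\<dots> = l b" unfolding m_def using \<Phi>'\<Psi>'[OF w(2)] by simp
    finally show ?thesis .
  qed
  then show ?thesis
    using closest_point_subspace_mem[OF subspace_tangent[OF w]] unfolding z_def by blast
qed

lemma tangent_eqI:
  assumes w: "w \<in> S" "w \<in> W"
    and "y \<in> tangent_space M (\<Psi> w)" "z \<in> tangent_space M (\<Psi> w)"
    and eq: "\<And>b. b \<in> S \<Longrightarrow> y \<bullet> \<Psi>' w b = z \<bullet> \<Psi>' w b"
  shows "y = z"
proof -
  obtain b where b: "b \<in> S" "y - z = \<Psi>' w b"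
    using subspace_diff[OF subspace_tangent[OF w] assms(3,4)] tangent_space_eq[OF w] by blast
  have "(y - z) \<bullet> (y - z) = 0"
    using eq[OF b(1)] by (subst (2) b(2)) (simp add: inner_diff_left)
  then show ?thesis by simp
qed

end

section \<open>Riemannian gradient and Hessian in a slice chart\<close>

text \<open>\<open>\<phi>\<close> is an ambient function that agrees with \<open>h\<close> read in
  the chart on the slice alone. Its derivatives transverse to \<open>S\<close> say nothing about
  \<open>h\<close>, so later statements test it on vectors of \<open>S\<close>.\<close>

locale slice_chart_function = slice_chart M S U W \<Phi> \<Psi> \<Phi>' \<Psi>' \<Psi>''
  for M S U W :: "'a::euclidean_space set" and \<Phi> \<Psi> \<Phi>' \<Psi>' \<Psi>'' +
  fixes h \<phi> :: "'a \<Rightarrow> real" and \<phi>' :: "'a \<Rightarrow> 'a \<Rightarrow>\<^sub>L real"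
    and \<phi>'' :: "'a \<Rightarrow> 'a \<Rightarrow>\<^sub>L ('a \<Rightarrow>\<^sub>L real)"
  assumes deriv_\<phi>: "w \<in> W \<Longrightarrow> (\<phi> has_derivative \<phi>' w) (at w)"
    and deriv2_\<phi>: "w \<in> W \<Longrightarrow> (\<phi>' has_derivative \<phi>'' w) (at w)"
    and h_\<phi>: "w \<in> S \<Longrightarrow> w \<in> W \<Longrightarrow> h (\<Psi> w) = \<phi> w"
begin

lemma h_eq: "x \<in> M \<Longrightarrow> x \<in> U \<Longrightarrow> h x = \<phi> (\<Phi> x)"
  using h_\<phi>[OF \<Phi>_slice \<Phi>_mem, of x] by simp

lemma deriv_h_curve:
  assumes w: "w \<in> S" "w \<in> W" and c: "curve_through M (\<Psi> w) v c"
  shows "((\<lambda>t. h (c t)) has_real_derivative \<phi>' w (\<Phi>' (\<Psi> w) v)) (at 0)"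
proof -
  note cc = curve_in_chart[OF c \<Psi>_mem[OF w(2)]]
  have c0: "c 0 = \<Psi> w" using c unfolding curve_through_def by blast
  have "((\<lambda>t. \<phi> (\<Phi> (c t))) has_vector_derivative \<phi>' w (\<Phi>' (\<Psi> w) v)) (at 0)"
    using has_vector_derivative_compose[OF cc(2), of \<phi> "\<phi>' w"] deriv_\<phi>[OF w(2)] c0 w(2) by simp
  moreover have "\<forall>\<^sub>F t in nhds 0. h (c t) = \<phi> (\<Phi> (c t))"
    using cc(1) by eventually_elim (auto intro: h_eq)
  ultimately have "((\<lambda>t. h (c t)) has_vector_derivative \<phi>' w (\<Phi>' (\<Psi> w) v)) (at 0)"
    using eventually_nhds_x_imp_x
    by (subst has_vector_derivative_cong_ev[where g="\<lambda>t. \<phi> (\<Phi> (c t))"]) (auto elim: eventually_mono)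
  then show ?thesis by (simp add: has_real_derivative_iff_has_vector_derivative)
qed

text \<open>This resolves the definite description of the gradient: existence by Riesz
  representation of \<open>\<phi>' w\<close> in the frame, uniqueness by testing with chart
  lines.\<close>

lemma
  assumes w: "w \<in> S" "w \<in> W"
  shows riem_grad_tangent: "riem_grad M h (\<Psi> w) \<in> tangent_space M (\<Psi> w)"
    and riem_grad_inner: "b \<in> S \<Longrightarrow> riem_grad M h (\<Psi> w) \<bullet> \<Psi>' w b = \<phi>' w b"
proof -
  let ?T = "tangent_space M (\<Psi> w)"
  obtain z where z: "z \<in> ?T" "\<And>b. b \<in> S \<Longrightarrow> z \<bullet> \<Psi>' w b = \<phi>' w b"
    using tangent_representation[OF w, of "\<phi>' w"]
    by (auto intro: bounded_linear.linear blinfun.bounded_linear_right)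
  have "riem_grad M h (\<Psi> w) = z"
    unfolding riem_grad_def
  proof (rule the_equality)
    show "z \<in> ?T \<and> (\<forall>v c. curve_through M (\<Psi> w) v c \<longrightarrow>
        ((\<lambda>t. h (c t)) has_real_derivative z \<bullet> v) (at 0))"
    proof (intro conjI allI impI z(1))
      fix v c assume c: "curve_through M (\<Psi> w) v c"
      have "z \<bullet> v = z \<bullet> \<Psi>' w (\<Phi>' (\<Psi> w) v)"
        using \<Psi>'\<Phi>'[OF \<Psi>_mem[OF w(2)]] w(2) by simp
      also have "\<dots> = \<phi>' w (\<Phi>' (\<Psi> w) v)"
        using z(2)[OF curve_in_chart(3)[OF c \<Psi>_mem[OF w(2)]]] .
      finally show "((\<lambda>t. h (c t)) has_real_derivative z \<bullet> v) (at 0)"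
        using deriv_h_curve[OF w c] by simp
    qed
    fix y assume y: "y \<in> ?T \<and> (\<forall>v c. curve_through M (\<Psi> w) v c \<longrightarrow>
        ((\<lambda>t. h (c t)) has_real_derivative y \<bullet> v) (at 0))"
    show "y = z"
    proof (rule tangent_eqI[OF w])
      fix b assume b: "b \<in> S"
      note line = curve_chart_line[OF w b]
      have "((\<lambda>t. h (\<Psi> (w + t *\<^sub>R b))) has_real_derivative y \<bullet> \<Psi>' w b) (at 0)"
        using y line by blast
      moreover have "((\<lambda>t. h (\<Psi> (w + t *\<^sub>R b))) has_real_derivative \<phi>' w b) (at 0)"
        using deriv_h_curve[OF w line] \<Phi>'\<Psi>'[OF w(2)] by simp
      ultimately show "y \<bullet> \<Psi>' w b = z \<bullet> \<Psi>' w b"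
        using z(2)[OF b] DERIV_unique by metis
    qed (use y z(1) in auto)
  qed
  then show "riem_grad M h (\<Psi> w) \<in> ?T" "b \<in> S \<Longrightarrow> riem_grad M h (\<Psi> w) \<bullet> \<Psi>' w b = \<phi>' w b"
    using z by auto
qed

text \<open>The coordinates \<open>b t\<close> of the gradient in the moving frame \<open>\<Psi>' (\<omega> t)\<close> solve a linear system
  with differentiable coefficients. Testing it with \<open>D = b t - b 0 - t *\<^sub>R u\<close>, where \<open>u\<close> solves the
  differentiated system, gives \<open>(norm (\<Psi>' (\<omega> t) D))\<^sup>2 = l t D\<close> with \<open>l\<close> vanishing to first order
  on \<open>S\<close>.\<close>

lemma riem_grad_curve_differentiable:
  assumes w: "w \<in> S" "w \<in> W" and c: "curve_through M (\<Psi> w) v c"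
  shows "\<exists>u. ((\<lambda>t. riem_grad M h (c t)) has_vector_derivative u) (at 0)"
proof -
  note cc = curve_in_chart[OF c \<Psi>_mem[OF w(2)]]
  have c0: "c 0 = \<Psi> w" and cd: "(c has_vector_derivative v) (at 0)"
    using c unfolding curve_through_def by blast+
  define a where "a = \<Phi>' (\<Psi> w) v"
  define \<omega> where "\<omega> t = \<Phi> (c t)" for t
  define A where "A t = \<Psi>' (\<omega> t)" for t
  define b where "b t = \<Phi>' (c t) (riem_grad M h (c t))" for t
  have \<omega>0: "\<omega> 0 = w" unfolding \<omega>_def c0 using w by simp
  have \<omega>': "(\<omega> has_vector_derivative a) (at 0)"
    using cc(2) unfolding \<omega>_def a_def by simp
  define A1 where "A1 = \<Psi>'' w a"
  have A': "(A has_vector_derivative A1) (at 0)"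
    unfolding A_def A1_def
    using has_vector_derivative_compose[OF \<omega>', of \<Psi>' "\<Psi>'' w"] deriv2_\<Psi>[OF w(2)] \<omega>0 by simp
  define p where "p t = \<phi>' (\<omega> t)" for t
  have p': "(p has_vector_derivative \<phi>'' w a) (at 0)"
    unfolding p_def
    using has_vector_derivative_compose[OF \<omega>', of \<phi>' "\<phi>'' w"] deriv2_\<phi>[OF w(2)] \<omega>0 by simp
  have near: "\<forall>\<^sub>F t in nhds 0. \<omega> t \<in> S \<and> \<omega> t \<in> W \<and> c t = \<Psi> (\<omega> t) \<and> c t \<in> U"
    using cc(1) unfolding \<omega>_def by eventually_elim (auto intro: \<Phi>_slice \<Phi>_mem)
  have b: "b t \<in> S" "riem_grad M h (c t) = A t (b t)" "\<And>s. s \<in> S \<Longrightarrow> A t (b t) \<bullet> A t s = p t s"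
    if "\<omega> t \<in> S \<and> \<omega> t \<in> W \<and> c t = \<Psi> (\<omega> t) \<and> c t \<in> U" for t
  proof -
    have t: "\<omega> t \<in> S" "\<omega> t \<in> W" "c t = \<Psi> (\<omega> t)" "c t \<in> U" using that by auto
    show "b t \<in> S"
      unfolding b_def t(3) using riem_grad_tangent[OF t(1,2)] tangent_iff[OF t(1,2)] by blast
    show eq: "riem_grad M h (c t) = A t (b t)"
      unfolding b_def A_def \<omega>_def using \<Psi>'\<Phi>'[OF t(4)] by simp
    show "A t (b t) \<bullet> A t s = p t s" if "s \<in> S" for s
      using riem_grad_inner[OF t(1,2) that] eq unfolding A_def p_def t(3) by simp
  qed
  note b0 = b[OF eventually_nhds_x_imp_x[OF near]]
  have A0: "A 0 = \<Psi>' w" unfolding A_def \<omega>0 ..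
  have lin: "linear (\<lambda>s. \<phi>'' w a s - (A1 (b 0) \<bullet> \<Psi>' w s + \<Psi>' w (b 0) \<bullet> A1 s))"
    by (intro bounded_linear.linear bounded_linear_intros)
  obtain z where z: "z \<in> tangent_space M (\<Psi> w)"
    "\<And>s. s \<in> S \<Longrightarrow> z \<bullet> \<Psi>' w s = \<phi>'' w a s - (A1 (b 0) \<bullet> \<Psi>' w s + \<Psi>' w (b 0) \<bullet> A1 s)"
    using tangent_representation[OF w lin] by blast
  obtain u where u: "u \<in> S" "z = \<Psi>' w u" using z(1) tangent_space_eq[OF w] by blast
  \<comment> \<open>\<open>l t\<close> is the residual of the linear system when \<open>b t\<close>
    is replaced by \<open>b 0 + t *\<^sub>R u\<close>. Its derivative at 0 is \<open>l1\<close>, in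
    which the summand with factor 0 is the part of the product rule multiplied by
    \<open>t\<close>.\<close>
  define l where "l t = p t - (blinfun_inner_left (A t (b 0)) o\<^sub>L A t)
      - t *\<^sub>R (blinfun_inner_left (A t u) o\<^sub>L A t)" for t
  define l1 where "l1 = \<phi>'' w a - ((blinfun_inner_left (A 0 (b 0)) o\<^sub>L A1) + (blinfun_inner_left (A1 (b 0)) o\<^sub>L A 0))
      - (0 *\<^sub>R ((blinfun_inner_left (A 0 u) o\<^sub>L A1) + (blinfun_inner_left (A1 u) o\<^sub>L A 0))
         + 1 *\<^sub>R (blinfun_inner_left (A 0 u) o\<^sub>L A 0))"
  have ip: "((\<lambda>t. blinfun_inner_left (A t y) o\<^sub>L A t) has_vector_derivative
      ((blinfun_inner_left (A 0 y) o\<^sub>L A1) + (blinfun_inner_left (A1 y) o\<^sub>L A 0))) (at 0)" for y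
  proof (rule has_vector_derivative_bilinear[OF bounded_bilinear_blinfun_compose _ A'])
    have "((\<lambda>t. A t y) has_vector_derivative A1 y) (at 0)"
      by (rule bounded_linear.has_vector_derivative[OF blinfun.bounded_linear_left A'])
    then show "((\<lambda>t. blinfun_inner_left (A t y)) has_vector_derivative blinfun_inner_left (A1 y)) (at 0)"
      by (rule bounded_linear.has_vector_derivative[OF bounded_linear_blinfun_inner_left])
  qed
  have l': "(l has_vector_derivative l1) (at 0)"
    unfolding l_def l1_def
    by (intro has_vector_derivative_diff p' ip
        has_vector_derivative_bilinear[OF bounded_bilinear_scaleR] has_vector_derivative_id)
  have l1: "l1 s = 0" if "s \<in> S" for s
    using z(2)[OF that] unfolding l1_def u(2) A0
    by (simp add: blinfun.bilinear_simps inner_commute)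
  have l0: "l 0 s = 0" if "s \<in> S" for s
    using b0(3)[OF that] unfolding l_def by (simp add: blinfun.bilinear_simps inner_commute)
  obtain K where K: "K > 0" "\<forall>\<^sub>F t in nhds 0. norm (\<Phi>' (c t)) \<le> K"
  proof -
    have "isCont (\<lambda>t. \<Phi>' (c t)) 0"
    proof (rule isCont_o2[where f=c and g=\<Phi>'])
      show "isCont c 0" using has_vector_derivative_continuous[OF cd] .
      show "isCont \<Phi>' (c 0)"
        using cont_\<Phi>' open_U \<Psi>_mem[OF w(2)] c0 by (simp add: continuous_on_eq_continuous_at)
    qed
    then have "((\<lambda>t. norm (\<Phi>' (c t))) \<longlongrightarrow> norm (\<Phi>' (c 0))) (nhds 0)"
      by (intro tendsto_norm) (simp add: isCont_def tendsto_at_iff_tendsto_nhds[of "\<lambda>t. \<Phi>' (c t)"])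
    then have "\<forall>\<^sub>F t in nhds 0. norm (\<Phi>' (c t)) < norm (\<Phi>' (c 0)) + 1"
      by (rule order_tendstoD) simp
    then have "\<forall>\<^sub>F t in nhds 0. norm (\<Phi>' (c t)) \<le> norm (\<Phi>' (c 0)) + 1"
      by eventually_elim simp
    then show thesis using that[of "norm (\<Phi>' (c 0)) + 1"] by (simp add: add_nonneg_pos)
  qed
  have bound: "\<forall>\<^sub>F t in nhds 0. norm (b t - b 0 - t *\<^sub>R u) \<le> K\<^sup>2 * norm (l t - l 0 - t *\<^sub>R l1)"
    using near K(2)
  proof eventually_elim
    case (elim t)
    define D where "D = b t - b 0 - t *\<^sub>R u"
    have D: "D \<in> S"
      unfolding D_def by (intro subspace_diff subspace_scale subspace_S b(1)[OF elim(1)] b0(1) u(1))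
    have "(norm (A t D))\<^sup>2 = A t D \<bullet> A t D" by (rule power2_norm_eq_inner)
    also have "\<dots> = A t (b t) \<bullet> A t D - A t (b 0) \<bullet> A t D - t * (A t u \<bullet> A t D)"
      by (subst (1) D_def) (simp add: blinfun.bilinear_simps inner_diff_left)
    also have "\<dots> = l t D"
      unfolding b(3)[OF elim(1) D] l_def by (simp add: blinfun.bilinear_simps inner_commute)
    also have "\<dots> = (l t - l 0 - t *\<^sub>R l1) D"
      using l0[OF D] l1[OF D] by (simp add: blinfun.bilinear_simps)
    also have "\<dots> \<le> norm (l t - l 0 - t *\<^sub>R l1) * norm D"
      using norm_blinfun[of "l t - l 0 - t *\<^sub>R l1" D] by simp
    finally have 1: "(norm (A t D))\<^sup>2 \<le> norm (l t - l 0 - t *\<^sub>R l1) * norm D" .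
    \<comment> \<open>\<open>\<Phi>' (c t)\<close> inverts the frame, which turns the bound on
      \<open>A t D\<close> into one on \<open>D\<close>; a factor \<open>norm D\<close> then
      cancels.\<close>
    have "D = \<Phi>' (c t) (A t D)"
      using \<Phi>'\<Psi>'[of "\<omega> t" D] elim(1) unfolding A_def by simp
    then have "norm D \<le> norm (\<Phi>' (c t)) * norm (A t D)" using norm_blinfun by metis
    also have "\<dots> \<le> K * norm (A t D)" using elim(2) by (intro mult_right_mono) auto
    finally have "(norm D)\<^sup>2 \<le> K\<^sup>2 * (norm (A t D))\<^sup>2"
      using power_mono[of "norm D" "K * norm (A t D)" 2] by (simp add: power_mult_distrib)
    also have "\<dots> \<le> K\<^sup>2 * (norm (l t - l 0 - t *\<^sub>R l1) * norm D)"
      using 1 by (intro mult_left_mono) auto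
    finally have "norm D * norm D \<le> (K\<^sup>2 * norm (l t - l 0 - t *\<^sub>R l1)) * norm D"
      by (simp add: power2_eq_square)
    then have "norm D \<le> K\<^sup>2 * norm (l t - l 0 - t *\<^sub>R l1)"
      by (cases "D = 0") auto
    then show ?case unfolding D_def .
  qed
  have "(b has_vector_derivative u) (at 0)"
    unfolding has_vector_derivative_def has_derivative_iff_norm
  proof (intro conjI bounded_linear_scaleR_left)
    have "((\<lambda>t. norm ((l t - l 0) - (t - 0) *\<^sub>R l1) / norm (t - 0)) \<longlongrightarrow> 0) (at 0)"
      using l' unfolding has_vector_derivative_def has_derivative_iff_norm by blast
    then have lim: "((\<lambda>t. K\<^sup>2 * (norm ((l t - l 0) - (t - 0) *\<^sub>R l1) / norm (t - 0))) \<longlongrightarrow> 0) (at 0)"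
      by (rule tendsto_mult_right_zero)
    show "((\<lambda>t. norm ((b t - b 0) - (t - 0) *\<^sub>R u) / norm (t - 0)) \<longlongrightarrow> 0) (at 0)"
    proof (rule tendsto_sandwich[OF _ _ tendsto_const lim])
      show "\<forall>\<^sub>F t in at 0. norm ((b t - b 0) - (t - 0) *\<^sub>R u) / norm (t - 0)
          \<le> K\<^sup>2 * (norm ((l t - l 0) - (t - 0) *\<^sub>R l1) / norm (t - 0))"
        unfolding eventually_at_filter using bound
        by eventually_elim (auto simp: divide_right_mono)
    qed simp
  qed
  then have "((\<lambda>t. A t (b t)) has_vector_derivative (A 0 u + A1 (b 0))) (at 0)"
    by (rule has_vector_derivative_bilinear[OF bounded_bilinear_blinfun_apply A'])
  moreover have "\<forall>\<^sub>F t in nhds 0. riem_grad M h (c t) = A t (b t)"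
    using near by eventually_elim (rule b(2))
  ultimately have "((\<lambda>t. riem_grad M h (c t)) has_vector_derivative (A 0 u + A1 (b 0))) (at 0)"
    using b0(2)
    by (subst has_vector_derivative_cong_ev[where g="\<lambda>t. A t (b t)"]) (auto elim: eventually_mono)
  then show ?thesis by blast
qed

text \<open>For fixed \<open>b\<close>, the identity pairing the gradient with the frame vector of
  \<open>b\<close> is differentiated along the curve. The derivative of the frame produces the
  second term on the right.\<close>

lemma riem_grad_curve_inner:
  assumes w: "w \<in> S" "w \<in> W" and c: "curve_through M (\<Psi> w) v c" and b: "b \<in> S"
    and u: "((\<lambda>t. riem_grad M h (c t)) has_vector_derivative u) (at 0)"
  shows "u \<bullet> \<Psi>' w b = \<phi>'' w (\<Phi>' (\<Psi> w) v) b - riem_grad M h (\<Psi> w) \<bullet> \<Psi>'' w (\<Phi>' (\<Psi> w) v) b"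
proof -
  note cc = curve_in_chart[OF c \<Psi>_mem[OF w(2)]]
  have c0: "c 0 = \<Psi> w" using c unfolding curve_through_def by blast
  define a where "a = \<Phi>' (\<Psi> w) v"
  define \<omega> where "\<omega> t = \<Phi> (c t)" for t
  have \<omega>0: "\<omega> 0 = w" unfolding \<omega>_def c0 using w by simp
  have \<omega>': "(\<omega> has_vector_derivative a) (at 0)" using cc(2) unfolding \<omega>_def a_def by simp
  have "((\<lambda>t. \<Psi>' (\<omega> t)) has_vector_derivative \<Psi>'' w a) (at 0)"
    using has_vector_derivative_compose[OF \<omega>', of \<Psi>' "\<Psi>'' w"] deriv2_\<Psi>[OF w(2)] \<omega>0 by simp
  then have "((\<lambda>t. \<Psi>' (\<omega> t) b) has_vector_derivative \<Psi>'' w a b) (at 0)"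
    by (rule bounded_linear.has_vector_derivative[OF blinfun.bounded_linear_left])
  then have 1: "((\<lambda>t. riem_grad M h (c t) \<bullet> \<Psi>' (\<omega> t) b) has_vector_derivative
      (riem_grad M h (c 0) \<bullet> \<Psi>'' w a b + u \<bullet> \<Psi>' (\<omega> 0) b)) (at 0)"
    by (rule has_vector_derivative_bilinear[OF bounded_bilinear_inner u])
  have "((\<lambda>t. \<phi>' (\<omega> t)) has_vector_derivative \<phi>'' w a) (at 0)"
    using has_vector_derivative_compose[OF \<omega>', of \<phi>' "\<phi>'' w"] deriv2_\<phi>[OF w(2)] \<omega>0 by simp
  then have 2: "((\<lambda>t. \<phi>' (\<omega> t) b) has_vector_derivative \<phi>'' w a b) (at 0)"
    by (rule bounded_linear.has_vector_derivative[OF blinfun.bounded_linear_left])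
  have "\<forall>\<^sub>F t in nhds 0. riem_grad M h (c t) \<bullet> \<Psi>' (\<omega> t) b = \<phi>' (\<omega> t) b"
    using cc(1)
  proof eventually_elim
    case (elim t)
    then have "\<omega> t \<in> S" "\<omega> t \<in> W" "c t = \<Psi> (\<omega> t)"
      unfolding \<omega>_def by (auto intro: \<Phi>_slice \<Phi>_mem)
    then show ?case using riem_grad_inner[OF _ _ b] by simp
  qed
  then have ev: "\<forall>\<^sub>F t in nhds 0. t \<in> UNIV \<longrightarrow> riem_grad M h (c t) \<bullet> \<Psi>' (\<omega> t) b = \<phi>' (\<omega> t) b"
    by simp
  from eventually_nhds_x_imp_x[OF this]
  have "riem_grad M h (c 0) \<bullet> \<Psi>' (\<omega> 0) b = \<phi>' (\<omega> 0) b" by simp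
  from 1[unfolded has_vector_derivative_cong_ev[OF ev this]] 2
  have "riem_grad M h (c 0) \<bullet> \<Psi>'' w a b + u \<bullet> \<Psi>' (\<omega> 0) b = \<phi>'' w a b"
    by (rule vector_derivative_unique_at)
  then show ?thesis unfolding c0 \<omega>0 a_def by simp
qed

text \<open>Pairings with the frame determine a tangent vector, and those of the projected
  derivative depend on the curve through its velocity alone, so the definite description is well
  posed. The subtracted term is the Christoffel correction.\<close>

lemma
  assumes w: "w \<in> S" "w \<in> W" and v: "v \<in> tangent_space M (\<Psi> w)"
  shows riem_hess_tangent: "riem_hess M h (\<Psi> w) v \<in> tangent_space M (\<Psi> w)"
    and riem_hess_inner: "b \<in> S \<Longrightarrow> riem_hess M h (\<Psi> w) v \<bullet> \<Psi>' w b
      = \<phi>'' w (\<Phi>' (\<Psi> w) v) b - riem_grad M h (\<Psi> w) \<bullet> \<Psi>'' w (\<Phi>' (\<Psi> w) v) b"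
proof -
  let ?T = "tangent_space M (\<Psi> w)"
  let ?H = "\<lambda>b. \<phi>'' w (\<Phi>' (\<Psi> w) v) b - riem_grad M h (\<Psi> w) \<bullet> \<Psi>'' w (\<Phi>' (\<Psi> w) v) b"
  have T: "subspace ?T" using subspace_tangent[OF w] .
  obtain c where c: "curve_through M (\<Psi> w) v c" using v unfolding tangent_space_def by blast
  obtain u where u: "((\<lambda>t. riem_grad M h (c t)) has_vector_derivative u) (at 0)"
    using riem_grad_curve_differentiable[OF w c] by blast
  have proj: "tangent_proj M (\<Psi> w) u' \<in> ?T"
      "b \<in> S \<Longrightarrow> tangent_proj M (\<Psi> w) u' \<bullet> \<Psi>' w b = ?H b"
    if "curve_through M (\<Psi> w) v c'"
      "((\<lambda>t. riem_grad M h (c' t)) has_vector_derivative u') (at 0)" for c' u' b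
  proof -
    show "tangent_proj M (\<Psi> w) u' \<in> ?T"
      unfolding tangent_proj_def by (rule closest_point_subspace_mem[OF T])
    assume b: "b \<in> S"
    then have "\<Psi>' w b \<in> ?T" using tangent_space_eq[OF w] by blast
    then show "tangent_proj M (\<Psi> w) u' \<bullet> \<Psi>' w b = ?H b"
      unfolding tangent_proj_def
      using closest_point_subspace_inner[OF T] riem_grad_curve_inner[OF w that(1) b that(2)] by simp
  qed
  have "riem_hess M h (\<Psi> w) v = tangent_proj M (\<Psi> w) u"
    unfolding riem_hess_def
  proof (rule the_equality)
    show "\<forall>c. curve_through M (\<Psi> w) v c \<longrightarrow>
        (\<exists>u'. ((\<lambda>t. riem_grad M h (c t)) has_vector_derivative u') (at 0) \<and>
          tangent_proj M (\<Psi> w) u = tangent_proj M (\<Psi> w) u')"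
    proof (intro allI impI)
      fix c' assume c': "curve_through M (\<Psi> w) v c'"
      obtain u' where u': "((\<lambda>t. riem_grad M h (c' t)) has_vector_derivative u') (at 0)"
        using riem_grad_curve_differentiable[OF w c'] by blast
      have "tangent_proj M (\<Psi> w) u = tangent_proj M (\<Psi> w) u'"
        by (rule tangent_eqI[OF w proj(1)[OF c u] proj(1)[OF c' u']])
          (simp add: proj(2)[OF c u] proj(2)[OF c' u'])
      with u' show "\<exists>u'. ((\<lambda>t. riem_grad M h (c' t)) has_vector_derivative u') (at 0) \<and>
          tangent_proj M (\<Psi> w) u = tangent_proj M (\<Psi> w) u'" by blast
    qed
    fix y assume "\<forall>c. curve_through M (\<Psi> w) v c \<longrightarrow>
        (\<exists>u'. ((\<lambda>t. riem_grad M h (c t)) has_vector_derivative u') (at 0) \<and>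
          y = tangent_proj M (\<Psi> w) u')"
    then show "y = tangent_proj M (\<Psi> w) u"
      using c u vector_derivative_unique_at by blast
  qed
  then show "riem_hess M h (\<Psi> w) v \<in> ?T" "b \<in> S \<Longrightarrow> riem_hess M h (\<Psi> w) v \<bullet> \<Psi>' w b = ?H b"
    using proj[OF c u] by auto
qed

end

section \<open>Expansions at a critical point\<close>

lemma has_derivative_bound_near:
  fixes f :: "'a::real_normed_vector \<Rightarrow> 'b::real_normed_vector"
  assumes "(f has_derivative f') (at x0)"
  shows "\<exists>C\<ge>0. \<forall>\<^sub>F x in nhds x0. norm (f x - f x0) \<le> C * norm (x - x0)"
proof -
  have bl: "bounded_linear f'" using assms by (rule has_derivative_bounded_linear)
  have "\<forall>\<^sub>F x in at x0. norm (f x - f x0 - f' (x - x0)) \<le> 1 * norm (x - x0)"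
    using assms unfolding has_derivative_within_alt2 by (meson zero_less_one)
  then have "\<forall>\<^sub>F x in nhds x0. x \<noteq> x0 \<longrightarrow> norm (f x - f x0 - f' (x - x0)) \<le> norm (x - x0)"
    by (simp add: eventually_at_filter)
  then have "\<forall>\<^sub>F x in nhds x0. norm (f x - f x0) \<le> (1 + onorm f') * norm (x - x0)"
  proof eventually_elim
    case (elim x)
    have "norm (f x - f x0) \<le> norm (f x - f x0 - f' (x - x0)) + norm (f' (x - x0))"
      by (metis diff_add_cancel norm_triangle_ineq)
    then show ?case
      using elim onorm[OF bl, of "x - x0"] by (cases "x = x0") (auto simp: algebra_simps)
  qed
  then show ?thesis using onorm_pos_le[OF bl] by (intro exI[of _ "1 + onorm f'"]) auto
qed

lemma norm_blinfun2:
  fixes B :: "'a::real_normed_vector \<Rightarrow>\<^sub>L ('b::real_normed_vector \<Rightarrow>\<^sub>L 'c::real_normed_vector)"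
  shows "norm (B u v) \<le> norm B * norm u * norm v"
  using norm_blinfun[of "B u" v] mult_right_mono[OF norm_blinfun[of B u] norm_ge_zero[of v]] by linarith

lemma tendsto_nhds_norm_bounded:
  fixes f :: "'a::t2_space \<Rightarrow> 'b::real_normed_vector"
  assumes "isCont f x0"
  shows "\<exists>C>0. \<forall>\<^sub>F x in nhds x0. norm (f x) \<le> C"
proof -
  have "((\<lambda>x. norm (f x)) \<longlongrightarrow> norm (f x0)) (nhds x0)"
    using assms by (intro tendsto_norm) (simp add: isCont_def tendsto_at_iff_tendsto_nhds[of f])
  then have "\<forall>\<^sub>F x in nhds x0. norm (f x) < norm (f x0) + 1"
    by (rule order_tendstoD) simp
  then have "\<forall>\<^sub>F x in nhds x0. norm (f x) \<le> norm (f x0) + 1" by eventually_elim simp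
  then show ?thesis by (intro exI[of _ "norm (f x0) + 1"]) (simp add: add_nonneg_pos)
qed

text \<open>The base point \<open>x\<close> varies over the ball together with \<open>y\<close>: the
  retraction and the inverse chart are expanded at the current iterate, not at the limit.\<close>

lemma C2_taylor:
  fixes f :: "'a::real_normed_vector \<Rightarrow> 'b::real_normed_vector"
  assumes U: "open U" "x0 \<in> U"
    and f': "\<And>x. x \<in> U \<Longrightarrow> (f has_derivative blinfun_apply (f' x)) (at x)"
    and f'': "\<And>x. x \<in> U \<Longrightarrow> (f' has_derivative blinfun_apply (f'' x)) (at x)"
    and cont: "continuous_on U f''"
  shows "\<exists>\<delta>>0. \<exists>C\<ge>0. ball x0 \<delta> \<subseteq> U \<and>
    (\<forall>x\<in>ball x0 \<delta>. \<forall>y\<in>ball x0 \<delta>. norm (f y - f x - f' x (y - x)) \<le> C * (norm (y - x))\<^sup>2)"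
proof -
  have "isCont f'' x0" using cont U by (simp add: continuous_on_eq_continuous_at)
  then obtain C where C: "C > 0" "\<forall>\<^sub>F x in nhds x0. norm (f'' x) \<le> C"
    using tendsto_nhds_norm_bounded by blast
  have "\<forall>\<^sub>F x in nhds x0. norm (f'' x) \<le> C \<and> x \<in> U"
    using C(2) eventually_nhds_in_open[OF U] by (rule eventually_conj)
  then obtain \<delta> where \<delta>: "\<delta> > 0" "\<And>x. x \<in> ball x0 \<delta> \<Longrightarrow> norm (f'' x) \<le> C \<and> x \<in> U"
    unfolding eventually_nhds_metric by (auto simp: dist_commute)
  have lip: "norm (f' y - f' x) \<le> C * norm (y - x)" if "x \<in> ball x0 \<delta>" "y \<in> ball x0 \<delta>" for x y
  proof (rule differentiable_bound[OF convex_ball _ _ that(2,1)])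
    fix z assume z: "z \<in> ball x0 \<delta>"
    show "(f' has_derivative blinfun_apply (f'' z)) (at z within ball x0 \<delta>)"
      using f'' \<delta>(2)[OF z] by (blast intro: has_derivative_at_withinI)
    show "onorm (blinfun_apply (f'' z)) \<le> C" using \<delta>(2)[OF z] by (simp add: norm_blinfun.rep_eq)
  qed
  have "norm (f y - f x - f' x (y - x)) \<le> C * (norm (y - x))\<^sup>2"
    if xy: "x \<in> ball x0 \<delta>" "y \<in> ball x0 \<delta>" for x y
  proof -
    have seg: "closed_segment x y \<subseteq> ball x0 \<delta>"
      using xy by (intro closed_segment_subset) auto
    have "norm (f y - f x - f' x (y - x)) \<le> norm (y - x) * (C * norm (y - x))"
    proof (rule differentiable_bound_linearization[where S="closed_segment x y"])
      show "x + t *\<^sub>R (y - x) \<in> closed_segment x y" if "t \<in> {0..1}" for t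
        using that unfolding in_segment by (intro exI[of _ t]) (auto simp: algebra_simps)
      show "(f has_derivative blinfun_apply (f' z)) (at z within closed_segment x y)"
        if "z \<in> closed_segment x y" for z
        using f' \<delta>(2) that seg by (blast intro: has_derivative_at_withinI)
      show "onorm (blinfun_apply (f' z) - blinfun_apply (f' x)) \<le> C * norm (y - x)" if "z \<in> closed_segment x y" for z
      proof -
        have "onorm (blinfun_apply (f' z) - blinfun_apply (f' x)) = norm (f' z - f' x)"
          by (simp add: norm_blinfun.rep_eq minus_blinfun.rep_eq fun_diff_def)
        also have "\<dots> \<le> C * norm (z - x)" using lip xy that seg by blast
        also have "\<dots> \<le> C * norm (y - x)"
          using segment_bound(1)[OF that] C(1) by (intro mult_left_mono) auto
        finally show ?thesis .
      qed
    qed simp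
    then show ?thesis by (simp add: power2_eq_square algebra_simps)
  qed
  moreover have "ball x0 \<delta> \<subseteq> U" using \<delta>(2) by blast
  ultimately show ?thesis using \<delta>(1) C(1) less_imp_le by blast
qed

lemma DERIV_bound_unit_interval:
  fixes r :: "real \<Rightarrow> real"
  assumes "\<And>t. 0 \<le> t \<Longrightarrow> t \<le> 1 \<Longrightarrow> (r has_real_derivative r' t) (at t)"
    and "\<And>t. 0 \<le> t \<Longrightarrow> t \<le> 1 \<Longrightarrow> \<bar>r' t\<bar> \<le> B"
  shows "\<bar>r 1 - r 0\<bar> \<le> B"
proof -
  obtain t where "0 < t" "t < 1" "r 1 - r 0 = (1 - 0) * r' t"
    using MVT2[of 0 1 r r'] assms(1) by auto
  then show ?thesis using assms(2)[of t] by simp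
qed

context slice_chart
begin

lemma eventually_in_W: "w0 \<in> W \<Longrightarrow> \<forall>\<^sub>F w in nhds w0. w \<in> W"
  using eventually_nhds_in_open[OF open_W] .

lemma isCont_\<Psi>: "w \<in> W \<Longrightarrow> isCont \<Psi> w"
  and isCont_\<Psi>': "w \<in> W \<Longrightarrow> isCont \<Psi>' w"
  and isCont_\<Psi>'': "w \<in> W \<Longrightarrow> isCont \<Psi>'' w"
  and isCont_\<Phi>: "x \<in> U \<Longrightarrow> isCont \<Phi> x"
  and isCont_\<Phi>': "x \<in> U \<Longrightarrow> isCont \<Phi>' x"
  using cont_\<Psi> cont_\<Psi>' cont_\<Psi>'' cont_\<Phi> cont_\<Phi>' open_U open_W
  by (auto simp: continuous_on_eq_continuous_at)

lemma \<Phi>'_bounded: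
  assumes "w0 \<in> W"
  shows "\<exists>C>0. \<forall>\<^sub>F w in nhds w0. norm (\<Phi>' (\<Psi> w)) \<le> C"
  using assms by (intro tendsto_nhds_norm_bounded isCont_o2[where f=\<Psi> and g=\<Phi>'] isCont_\<Psi> isCont_\<Phi>' \<Psi>_mem)

end

section \<open>The Hessian in chart coordinates and Taylor expansions at a critical point\<close>

context slice_chart_function
begin

abbreviation G where "G w \<equiv> riem_grad M h (\<Psi> w)"

text \<open>Precomposition with the tangent projection, as in \<open>hess_locally_lipschitz\<close>,
  lets Hessians at different points act on the same vector.\<close>

abbreviation hess_ext where "hess_ext x v \<equiv> riem_hess M h x (tangent_proj M x v)"

lemma tangent_proj_mem: "w \<in> S \<Longrightarrow> w \<in> W \<Longrightarrow> tangent_proj M (\<Psi> w) v \<in> tangent_space M (\<Psi> w)"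
  unfolding tangent_proj_def by (intro closest_point_subspace_mem subspace_tangent)

lemma tangent_frame: "w \<in> S \<Longrightarrow> w \<in> W \<Longrightarrow> a \<in> S \<Longrightarrow> \<Psi>' w a \<in> tangent_space M (\<Psi> w)"
  using tangent_space_eq by blast

lemma tangent_coords:
  assumes "w \<in> S" "w \<in> W" "v \<in> tangent_space M (\<Psi> w)"
  shows "\<Phi>' (\<Psi> w) v \<in> S" "\<Psi>' w (\<Phi>' (\<Psi> w) v) = v"
  using assms tangent_iff[OF assms(1,2)] \<Psi>'\<Phi>'[OF \<Psi>_mem[OF assms(2)]] by auto

lemma hess_ext_inner:
  assumes w: "w \<in> S" "w \<in> W" and a: "a \<in> S" and b: "b \<in> S"
  shows "hess_ext (\<Psi> w) (\<Psi>' w a) \<bullet> \<Psi>' w b = \<phi>'' w a b - G w \<bullet> \<Psi>'' w a b"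
proof -
  have "tangent_proj M (\<Psi> w) (\<Psi>' w a) = \<Psi>' w a"
    unfolding tangent_proj_def
    by (rule closest_point_subspace_id[OF subspace_tangent[OF w] tangent_frame[OF w a]])
  then show ?thesis
    using riem_hess_inner[OF w tangent_frame[OF w a] b] \<Phi>'\<Psi>'[OF w(2)] by simp
qed

text \<open>Linearity is invisible in the definite description of the Hessian; it is recovered from
  the pairings with the frame, which are linear in the coordinates.\<close>

lemma hess_ext_diff:
  assumes w: "w \<in> S" "w \<in> W"
  shows "hess_ext (\<Psi> w) (u - v) = hess_ext (\<Psi> w) u - hess_ext (\<Psi> w) v"
proof -
  note T = subspace_tangent[OF w]
  let ?P = "tangent_proj M (\<Psi> w)"
  have P: "?P u = ?P (u - v) + ?P v"
    unfolding tangent_proj_def closest_point_subspace_add[OF T, symmetric] by simp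
  have "hess_ext (\<Psi> w) u = hess_ext (\<Psi> w) (u - v) + hess_ext (\<Psi> w) v"
  proof (rule tangent_eqI[OF w])
    show "hess_ext (\<Psi> w) u \<bullet> \<Psi>' w b = (hess_ext (\<Psi> w) (u - v) + hess_ext (\<Psi> w) v) \<bullet> \<Psi>' w b"
      if "b \<in> S" for b
      unfolding inner_add_left riem_hess_inner[OF w tangent_proj_mem[OF w] that]
      unfolding P by (simp add: blinfun.bilinear_simps inner_add_right)
  qed (intro riem_hess_tangent tangent_proj_mem subspace_add T w)+
  then show ?thesis by simp
qed

text \<open>The Hessian value \<open>z\<close> is paired with itself through its own coordinates
  \<open>b\<close>. Passing to the coordinates \<open>a\<close> and \<open>b\<close> costs a factor
  \<open>k\<close> each, hence \<open>k * k\<close> in \<open>K\<close>.\<close>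

lemma hess_ext_bounded:
  assumes w: "w \<in> S" "w \<in> W"
  shows "\<exists>K\<ge>0. \<forall>v. norm (hess_ext (\<Psi> w) v) \<le> K * norm v"
proof -
  let ?P = "tangent_proj M (\<Psi> w)"
  define k where "k = norm (\<Phi>' (\<Psi> w))"
  define K where "K = (norm (\<phi>'' w) + norm (G w) * norm (\<Psi>'' w)) * k * k"
  have "norm (hess_ext (\<Psi> w) v) \<le> K * norm v" for v
  proof -
    define z where "z = hess_ext (\<Psi> w) v"
    define a where "a = \<Phi>' (\<Psi> w) (?P v)"
    define b where "b = \<Phi>' (\<Psi> w) z"
    have zT: "z \<in> tangent_space M (\<Psi> w)"
      unfolding z_def by (intro riem_hess_tangent tangent_proj_mem w)
    note b = tangent_coords[OF w zT, folded b_def]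
    have "norm a \<le> k * norm (?P v)" unfolding a_def k_def by (rule norm_blinfun)
    also have "\<dots> \<le> k * norm v"
      unfolding tangent_proj_def k_def
      by (intro mult_left_mono closest_point_subspace_norm subspace_tangent w) auto
    finally have a: "norm a \<le> k * norm v" .
    have bz: "norm b \<le> k * norm z" unfolding b_def k_def by (rule norm_blinfun)
    have "(norm z)\<^sup>2 = z \<bullet> \<Psi>' w b" unfolding b(2) by (rule power2_norm_eq_inner)
    also have "\<dots> = \<phi>'' w a b - G w \<bullet> \<Psi>'' w a b"
      unfolding z_def a_def by (rule riem_hess_inner[OF w tangent_proj_mem[OF w] b(1)])
    also have "\<dots> \<le> norm (\<phi>'' w a b) + norm (G w) * norm (\<Psi>'' w a b)"
      using Cauchy_Schwarz_ineq2[of "G w" "\<Psi>'' w a b"] by (smt (verit) real_norm_def)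
    also have "\<dots> \<le> norm (\<phi>'' w) * norm a * norm b + norm (G w) * (norm (\<Psi>'' w) * norm a * norm b)"
    proof (intro add_mono mult_left_mono)
      show "norm (\<phi>'' w a b) \<le> norm (\<phi>'' w) * norm a * norm b"
        by (rule norm_blinfun2)
      show "norm (\<Psi>'' w a b) \<le> norm (\<Psi>'' w) * norm a * norm b"
        by (rule norm_blinfun2)
    qed simp
    also have "\<dots> = (norm (\<phi>'' w) + norm (G w) * norm (\<Psi>'' w)) * (norm a * norm b)"
      by (simp add: algebra_simps)
    also have "\<dots> \<le> (norm (\<phi>'' w) + norm (G w) * norm (\<Psi>'' w)) * ((k * norm v) * (k * norm z))"
      by (intro mult_left_mono mult_mono a bz) (auto simp: k_def)
    finally have "norm z * norm z \<le> (K * norm v) * norm z"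
      unfolding K_def by (simp add: power2_eq_square algebra_simps)
    then show ?thesis unfolding z_def[symmetric]
      by (cases "z = 0") (auto simp: K_def k_def)
  qed
  moreover have "K \<ge> 0" unfolding K_def k_def by simp
  ultimately show ?thesis by blast
qed

context
  fixes w0 :: 'a
  assumes w0: "w0 \<in> S" "w0 \<in> W" and crit: "G w0 = 0"
begin

lemma \<phi>'_w0: "b \<in> S \<Longrightarrow> \<phi>' w0 b = 0"
  using riem_grad_inner[OF w0, of b] crit by simp

text \<open>The squared norm of the gradient equals \<open>\<phi>' w - \<phi>' w0\<close> applied to
  its coordinates, since \<open>\<phi>' w0\<close> vanishes on \<open>S\<close>; differentiability
  of \<open>\<phi>'\<close> at \<open>w0\<close> gives the rate.\<close>

lemma riem_grad_linear_bound:
  "\<exists>C\<ge>0. \<forall>\<^sub>F w in nhds w0. w \<in> S \<longrightarrow> norm (G w) \<le> C * norm (w - w0)"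
proof -
  obtain C where C: "C \<ge> 0" "\<forall>\<^sub>F w in nhds w0. norm (\<phi>' w - \<phi>' w0) \<le> C * norm (w - w0)"
    using has_derivative_bound_near[OF deriv2_\<phi>[OF w0(2)]] by blast
  obtain K where K: "K > 0" "\<forall>\<^sub>F w in nhds w0. norm (\<Phi>' (\<Psi> w)) \<le> K"
    using \<Phi>'_bounded[OF w0(2)] by blast
  have "\<forall>\<^sub>F w in nhds w0. w \<in> S \<longrightarrow> norm (G w) \<le> (C * K) * norm (w - w0)"
    using C(2) K(2) eventually_in_W[OF w0(2)]
  proof eventually_elim
    case (elim w)
    show ?case
    proof
      assume "w \<in> S"
      note w = this elim(3)
      define b where "b = \<Phi>' (\<Psi> w) (G w)"
      note b = tangent_coords[OF w riem_grad_tangent[OF w], folded b_def]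
      have "norm b \<le> norm (\<Phi>' (\<Psi> w)) * norm (G w)" unfolding b_def by (rule norm_blinfun)
      also have "\<dots> \<le> K * norm (G w)" using elim(2) by (intro mult_right_mono) auto
      finally have bK: "norm b \<le> K * norm (G w)" .
      have "(norm (G w))\<^sup>2 = G w \<bullet> \<Psi>' w b" unfolding b(2) by (rule power2_norm_eq_inner)
      also have "\<dots> = (\<phi>' w - \<phi>' w0) b"
        using riem_grad_inner[OF w b(1)] \<phi>'_w0[OF b(1)] by (simp add: blinfun.bilinear_simps)
      also have "\<dots> \<le> norm (\<phi>' w - \<phi>' w0) * norm b"
        using norm_blinfun[of "\<phi>' w - \<phi>' w0" b] by simp
      also have "\<dots> \<le> (C * norm (w - w0)) * (K * norm (G w))"
        using elim(1) bK C(1) by (intro mult_mono) auto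
      finally have "norm (G w) * norm (G w) \<le> (C * K * norm (w - w0)) * norm (G w)"
        by (simp add: power2_eq_square algebra_simps)
      then show "norm (G w) \<le> C * K * norm (w - w0)"
        using C(1) K(1) by (cases "G w = 0") auto
    qed
  qed
  then show ?thesis using C(1) K(1) by (intro exI[of _ "C * K"]) auto
qed

context
  assumes lip: "hess_locally_lipschitz M h (\<Psi> w0)"
begin

text \<open>The Lipschitz bound concerns ambient endomorphisms, while the coordinate form also
  depends on the moving frame. At \<open>w0\<close> the Christoffel term vanishes, so the form there
  is \<open>\<phi>'' w0\<close>.\<close>

lemma hess_form_bound:
  "\<exists>C\<ge>0. \<forall>\<^sub>F w in nhds w0. w \<in> S \<longrightarrow> (\<forall>a\<in>S. \<forall>b\<in>S.
     \<bar>(\<phi>'' w a b - G w \<bullet> \<Psi>'' w a b) - \<phi>'' w0 a b\<bar> \<le> C * norm (w - w0) * norm a * norm b)"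
proof -
  obtain V D where V: "open V" "\<Psi> w0 \<in> V"
    and D: "\<And>y z v. y \<in> M \<inter> V \<Longrightarrow> z \<in> M \<inter> V \<Longrightarrow>
      norm (hess_ext y v - hess_ext z v) \<le> D * dist y z * norm v"
    using lip unfolding hess_locally_lipschitz_def by blast
  obtain K where K: "K \<ge> 0" "\<And>v. norm (hess_ext (\<Psi> w0) v) \<le> K * norm v"
    using hess_ext_bounded[OF w0] by blast
  obtain A where A: "A > 0" "\<forall>\<^sub>F w in nhds w0. norm (\<Psi>' w) \<le> A"
    using tendsto_nhds_norm_bounded[OF isCont_\<Psi>'[OF w0(2)]] by blast
  obtain B where B: "B \<ge> 0" "\<forall>\<^sub>F w in nhds w0. norm (\<Psi>' w - \<Psi>' w0) \<le> B * norm (w - w0)"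
    using has_derivative_bound_near[OF deriv2_\<Psi>[OF w0(2)]] by blast
  obtain E where E: "E \<ge> 0" "\<forall>\<^sub>F w in nhds w0. norm (\<Psi> w - \<Psi> w0) \<le> E * norm (w - w0)"
    using has_derivative_bound_near[OF deriv_\<Psi>[OF w0(2)]] by blast
  have inV: "\<forall>\<^sub>F w in nhds w0. \<Psi> w \<in> V"
    using isCont_\<Psi>[OF w0(2)] V
    by (metis isCont_def tendsto_at_iff_tendsto_nhds topological_tendstoD)
  \<comment> \<open>The three summands are the cost of moving the base point of the Hessian, of
    changing the frame in its first argument, and of changing it in its second.\<close>
  define C where "C = \<bar>D\<bar> * E * A * A + K * B * A + K * A * B"
  have "\<forall>\<^sub>F w in nhds w0. w \<in> S \<longrightarrow> (\<forall>a\<in>S. \<forall>b\<in>S.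
     \<bar>(\<phi>'' w a b - G w \<bullet> \<Psi>'' w a b) - \<phi>'' w0 a b\<bar> \<le> C * norm (w - w0) * norm a * norm b)"
    using A(2) B(2) E(2) inV eventually_in_W[OF w0(2)]
  proof eventually_elim
    case (elim w)
    show ?case
    proof (intro impI ballI)
      fix a b assume "w \<in> S" and ab: "a \<in> S" "b \<in> S"
      note w = \<open>w \<in> S\<close> elim(5)
      define n where "n = norm (w - w0)"
      have A0: "norm (\<Psi>' w0) \<le> A" using eventually_nhds_x_imp_x[OF A(2)] .
      have bound: "norm (\<Psi>' w c) \<le> A * norm c" "norm (\<Psi>' w0 c) \<le> A * norm c"
          "norm ((\<Psi>' w - \<Psi>' w0) c) \<le> (B * n) * norm c" for c
        using norm_blinfun[of "\<Psi>' w" c] norm_blinfun[of "\<Psi>' w0" c] norm_blinfun[of "\<Psi>' w - \<Psi>' w0" c]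
          elim(1,2) A0 unfolding n_def by (meson mult_right_mono norm_ge_zero order_trans)+
      let ?x = "\<Psi> w" and ?z = "\<Psi> w0"
      have 1: "\<bar>(hess_ext ?x (\<Psi>' w a) - hess_ext ?z (\<Psi>' w a)) \<bullet> \<Psi>' w b\<bar>
          \<le> (\<bar>D\<bar> * (E * n) * (A * norm a)) * (A * norm b)"
      proof -
        have "norm (hess_ext ?x (\<Psi>' w a) - hess_ext ?z (\<Psi>' w a)) \<le> D * dist ?x ?z * norm (\<Psi>' w a)"
          using D elim(4) V(2) \<Psi>_slice[OF w] \<Psi>_slice[OF w0] by simp
        also have "\<dots> \<le> \<bar>D\<bar> * (E * n) * (A * norm a)"
          using elim(3) bound(1) E(1) unfolding n_def dist_norm
          by (intro mult_mono) auto
        finally show ?thesis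
          using Cauchy_Schwarz_ineq2 bound(1)[of b]
          by (smt (verit, ccfv_SIG) mult_mono norm_ge_zero)
      qed
      have 2: "\<bar>hess_ext ?z ((\<Psi>' w - \<Psi>' w0) a) \<bullet> \<Psi>' w b\<bar> \<le> (K * (B * n * norm a)) * (A * norm b)"
      proof -
        have "norm (hess_ext ?z ((\<Psi>' w - \<Psi>' w0) a)) \<le> K * (B * n * norm a)"
          using K(2) bound(3) K(1) by (meson mult_left_mono order_trans)
        then show ?thesis
          using Cauchy_Schwarz_ineq2 bound(1)[of b]
          by (smt (verit, ccfv_SIG) mult_mono norm_ge_zero)
      qed
      have 3: "\<bar>hess_ext ?z (\<Psi>' w0 a) \<bullet> (\<Psi>' w - \<Psi>' w0) b\<bar> \<le> (K * (A * norm a)) * (B * n * norm b)"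
      proof -
        have "norm (hess_ext ?z (\<Psi>' w0 a)) \<le> K * (A * norm a)"
          using K(2) bound(2) K(1) by (meson mult_left_mono order_trans)
        then show ?thesis
          using Cauchy_Schwarz_ineq2 bound(3)[of b]
          by (smt (verit, ccfv_SIG) mult_mono norm_ge_zero)
      qed
      have "(\<phi>'' w a b - G w \<bullet> \<Psi>'' w a b) - \<phi>'' w0 a b
          = hess_ext ?x (\<Psi>' w a) \<bullet> \<Psi>' w b - hess_ext ?z (\<Psi>' w0 a) \<bullet> \<Psi>' w0 b"
        unfolding hess_ext_inner[OF w ab] hess_ext_inner[OF w0 ab] crit by simp
      also have "\<dots> = (hess_ext ?x (\<Psi>' w a) - hess_ext ?z (\<Psi>' w a)) \<bullet> \<Psi>' w b
          + hess_ext ?z ((\<Psi>' w - \<Psi>' w0) a) \<bullet> \<Psi>' w b + hess_ext ?z (\<Psi>' w0 a) \<bullet> (\<Psi>' w - \<Psi>' w0) b"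
        unfolding blinfun.diff_left hess_ext_diff[OF w0] inner_diff_left inner_diff_right by simp
      finally have "\<bar>(\<phi>'' w a b - G w \<bullet> \<Psi>'' w a b) - \<phi>'' w0 a b\<bar>
          \<le> (\<bar>D\<bar> * (E * n) * (A * norm a)) * (A * norm b) + (K * (B * n * norm a)) * (A * norm b)
            + (K * (A * norm a)) * (B * n * norm b)"
        using 1 2 3 by linarith
      also have "\<dots> = C * n * norm a * norm b" unfolding C_def by (simp add: algebra_simps)
      finally show "\<bar>(\<phi>'' w a b - G w \<bullet> \<Psi>'' w a b) - \<phi>'' w0 a b\<bar> \<le> C * norm (w - w0) * norm a * norm b"
        unfolding n_def .
    qed
  qed
  moreover have "C \<ge> 0" unfolding C_def using A(1) B(1) E(1) K(1) by simp
  ultimately show ?thesis by blast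
qed

text \<open>The Christoffel term is moved to the error side: \<open>\<Psi>''\<close> is bounded near
  \<open>w0\<close> and the gradient is of first order there, so the product is of first order as
  well.\<close>

lemma \<phi>''_bound:
  "\<exists>C\<ge>0. \<forall>\<^sub>F w in nhds w0. w \<in> S \<longrightarrow> (\<forall>a\<in>S. \<forall>b\<in>S.
     \<bar>\<phi>'' w a b - \<phi>'' w0 a b\<bar> \<le> C * norm (w - w0) * norm a * norm b)"
proof -
  obtain C1 where C1: "C1 \<ge> 0" "\<forall>\<^sub>F w in nhds w0. w \<in> S \<longrightarrow> (\<forall>a\<in>S. \<forall>b\<in>S.
     \<bar>(\<phi>'' w a b - G w \<bullet> \<Psi>'' w a b) - \<phi>'' w0 a b\<bar> \<le> C1 * norm (w - w0) * norm a * norm b)"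
    using hess_form_bound by blast
  obtain C2 where C2: "C2 \<ge> 0" "\<forall>\<^sub>F w in nhds w0. w \<in> S \<longrightarrow> norm (G w) \<le> C2 * norm (w - w0)"
    using riem_grad_linear_bound by blast
  obtain C3 where C3: "C3 > 0" "\<forall>\<^sub>F w in nhds w0. norm (\<Psi>'' w) \<le> C3"
    using tendsto_nhds_norm_bounded[OF isCont_\<Psi>''[OF w0(2)]] by blast
  have "\<forall>\<^sub>F w in nhds w0. w \<in> S \<longrightarrow> (\<forall>a\<in>S. \<forall>b\<in>S.
     \<bar>\<phi>'' w a b - \<phi>'' w0 a b\<bar> \<le> (C1 + C2 * C3) * norm (w - w0) * norm a * norm b)"
    using C1(2) C2(2) C3(2)
  proof eventually_elim
    case (elim w)
    show ?case
    proof (intro impI ballI)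
      fix a b assume w: "w \<in> S" and ab: "a \<in> S" "b \<in> S"
      have "norm (\<Psi>'' w a b) \<le> norm (\<Psi>'' w) * norm a * norm b"
        by (rule norm_blinfun2)
      also have "\<dots> \<le> C3 * norm a * norm b" using elim(3) by (intro mult_right_mono) auto
      finally have p: "norm (\<Psi>'' w a b) \<le> C3 * norm a * norm b" .
      have "\<bar>G w \<bullet> \<Psi>'' w a b\<bar> \<le> norm (G w) * norm (\<Psi>'' w a b)" by (rule Cauchy_Schwarz_ineq2)
      also have "\<dots> \<le> (C2 * norm (w - w0)) * (C3 * norm a * norm b)"
        using elim(2) w p C2(1) by (intro mult_mono) auto
      finally have "\<bar>G w \<bullet> \<Psi>'' w a b\<bar> \<le> C2 * C3 * norm (w - w0) * norm a * norm b"
        by (simp add: algebra_simps)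
      moreover have "\<bar>(\<phi>'' w a b - G w \<bullet> \<Psi>'' w a b) - \<phi>'' w0 a b\<bar> \<le> C1 * norm (w - w0) * norm a * norm b"
        using elim(1) w ab by blast
      moreover have "(C1 + C2 * C3) * norm (w - w0) * norm a * norm b
          = C1 * norm (w - w0) * norm a * norm b + C2 * C3 * norm (w - w0) * norm a * norm b"
        by (simp add: algebra_simps)
      ultimately show "\<bar>\<phi>'' w a b - \<phi>'' w0 a b\<bar> \<le> (C1 + C2 * C3) * norm (w - w0) * norm a * norm b"
        by linarith
    qed
  qed
  then show ?thesis using C1(1) C2(1) C3(1) by (intro exI[of _ "C1 + C2 * C3"]) auto
qed

text \<open>The mean value theorem is applied on the segment from \<open>w0\<close> to
  \<open>w\<close>, which stays in \<open>S\<close>; each intermediate point is compared with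
  \<open>w0\<close>, as \<open>\<phi>''_bound\<close> permits.\<close>

lemma \<phi>'_expansion:
  "\<exists>C\<ge>0. \<forall>\<^sub>F w in nhds w0. w \<in> S \<longrightarrow> (\<forall>b\<in>S.
     \<bar>\<phi>' w b - \<phi>'' w0 (w - w0) b\<bar> \<le> C * (norm (w - w0))\<^sup>2 * norm b)"
proof -
  obtain C where C: "C \<ge> 0" and ev: "\<forall>\<^sub>F w in nhds w0. w \<in> S \<longrightarrow> (\<forall>a\<in>S. \<forall>b\<in>S.
     \<bar>\<phi>'' w a b - \<phi>'' w0 a b\<bar> \<le> C * norm (w - w0) * norm a * norm b)"
    using \<phi>''_bound by blast
  obtain \<delta> where \<delta>: "\<delta> > 0" "\<And>w. dist w w0 < \<delta> \<Longrightarrow> w \<in> W"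
      "\<And>w a b. dist w w0 < \<delta> \<Longrightarrow> w \<in> S \<Longrightarrow> a \<in> S \<Longrightarrow> b \<in> S \<Longrightarrow>
        \<bar>\<phi>'' w a b - \<phi>'' w0 a b\<bar> \<le> C * norm (w - w0) * norm a * norm b"
    using eventually_conj[OF ev eventually_in_W[OF w0(2)]] unfolding eventually_nhds_metric by blast
  have "\<bar>\<phi>' w b - \<phi>'' w0 (w - w0) b\<bar> \<le> C * (norm (w - w0))\<^sup>2 * norm b"
    if w: "dist w w0 < \<delta>" "w \<in> S" and b: "b \<in> S" for w b
  proof -
    define e where "e = w - w0"
    have e: "e \<in> S" unfolding e_def by (intro subspace_diff subspace_S w w0)
    have wt: "w0 + t *\<^sub>R e \<in> S" "dist (w0 + t *\<^sub>R e) w0 < \<delta>" "norm (w0 + t *\<^sub>R e - w0) \<le> norm e"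
      if "0 \<le> t" "t \<le> 1" for t
    proof -
      show "w0 + t *\<^sub>R e \<in> S" by (intro subspace_add subspace_scale subspace_S e w0)
      show "norm (w0 + t *\<^sub>R e - w0) \<le> norm e" using that by (simp add: mult_left_le_one_le)
      then show "dist (w0 + t *\<^sub>R e) w0 < \<delta>" using w(1) unfolding e_def dist_norm by simp
    qed
    define r where "r t = \<phi>' (w0 + t *\<^sub>R e) b - t * \<phi>'' w0 e b" for t
    have "\<bar>r 1 - r 0\<bar> \<le> C * (norm e)\<^sup>2 * norm b"
    proof (rule DERIV_bound_unit_interval)
      fix t :: real assume t: "0 \<le> t" "t \<le> 1"
      have line: "((\<lambda>t. w0 + t *\<^sub>R e) has_vector_derivative e) (at t)"
        by (auto intro!: derivative_eq_intros)
      have "((\<lambda>t. \<phi>' (w0 + t *\<^sub>R e)) has_vector_derivative \<phi>'' (w0 + t *\<^sub>R e) e) (at t)"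
        using has_vector_derivative_compose[OF line deriv2_\<phi>] \<delta>(2)[OF wt(2)[OF t]] by blast
      then have "((\<lambda>t. \<phi>' (w0 + t *\<^sub>R e) b) has_vector_derivative \<phi>'' (w0 + t *\<^sub>R e) e b) (at t)"
        by (rule bounded_linear.has_vector_derivative[OF blinfun.bounded_linear_left])
      then have d: "((\<lambda>t. \<phi>' (w0 + t *\<^sub>R e) b) has_real_derivative \<phi>'' (w0 + t *\<^sub>R e) e b) (at t)"
        by (simp add: has_real_derivative_iff_has_vector_derivative)
      have "((\<lambda>t. t * \<phi>'' w0 e b) has_real_derivative \<phi>'' w0 e b) (at t)"
        by (auto intro!: derivative_eq_intros)
      then show "(r has_real_derivative \<phi>'' (w0 + t *\<^sub>R e) e b - \<phi>'' w0 e b) (at t)"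
        unfolding r_def by (rule DERIV_diff[OF d])
      have "\<bar>\<phi>'' (w0 + t *\<^sub>R e) e b - \<phi>'' w0 e b\<bar> \<le> C * norm (w0 + t *\<^sub>R e - w0) * norm e * norm b"
        using \<delta>(3)[OF wt(2,1)[OF t] e b] .
      also have "\<dots> \<le> C * norm e * norm e * norm b"
        using wt(3)[OF t] C by (intro mult_right_mono mult_left_mono) auto
      finally show "\<bar>\<phi>'' (w0 + t *\<^sub>R e) e b - \<phi>'' w0 e b\<bar> \<le> C * (norm e)\<^sup>2 * norm b"
        by (simp add: power2_eq_square algebra_simps)
    qed
    then show ?thesis
      unfolding r_def using \<phi>'_w0[OF b] by (simp add: e_def)
  qed
  then show ?thesis
    using C \<delta>(1) unfolding eventually_nhds_metric by blast
qed

lemma \<phi>_expansion: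
  "\<exists>C\<ge>0. \<forall>\<^sub>F w in nhds w0. w \<in> S \<longrightarrow>
     \<bar>\<phi> w - \<phi> w0 - \<phi>'' w0 (w - w0) (w - w0) / 2\<bar> \<le> C * norm (w - w0) ^ 3"
proof -
  obtain C where C: "C \<ge> 0" and ev: "\<forall>\<^sub>F w in nhds w0. w \<in> S \<longrightarrow> (\<forall>b\<in>S.
     \<bar>\<phi>' w b - \<phi>'' w0 (w - w0) b\<bar> \<le> C * (norm (w - w0))\<^sup>2 * norm b)"
    using \<phi>'_expansion by blast
  obtain \<delta> where \<delta>: "\<delta> > 0" "\<And>w. dist w w0 < \<delta> \<Longrightarrow> w \<in> W"
      "\<And>w b. dist w w0 < \<delta> \<Longrightarrow> w \<in> S \<Longrightarrow> b \<in> S \<Longrightarrow>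
        \<bar>\<phi>' w b - \<phi>'' w0 (w - w0) b\<bar> \<le> C * (norm (w - w0))\<^sup>2 * norm b"
    using eventually_conj[OF ev eventually_in_W[OF w0(2)]] unfolding eventually_nhds_metric by blast
  have "\<bar>\<phi> w - \<phi> w0 - \<phi>'' w0 (w - w0) (w - w0) / 2\<bar> \<le> C * norm (w - w0) ^ 3"
    if w: "dist w w0 < \<delta>" "w \<in> S" for w
  proof -
    define e where "e = w - w0"
    have e: "e \<in> S" unfolding e_def by (intro subspace_diff subspace_S w w0)
    have wt: "w0 + t *\<^sub>R e \<in> S" "dist (w0 + t *\<^sub>R e) w0 < \<delta>" "norm (w0 + t *\<^sub>R e - w0) \<le> norm e"
      if "0 \<le> t" "t \<le> 1" for t
    proof -
      show "w0 + t *\<^sub>R e \<in> S" by (intro subspace_add subspace_scale subspace_S e w0)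
      show "norm (w0 + t *\<^sub>R e - w0) \<le> norm e" using that by (simp add: mult_left_le_one_le)
      then show "dist (w0 + t *\<^sub>R e) w0 < \<delta>" using w(1) unfolding e_def dist_norm by simp
    qed
    define r where "r t = \<phi> (w0 + t *\<^sub>R e) - t\<^sup>2 / 2 * \<phi>'' w0 e e" for t
    have "\<bar>r 1 - r 0\<bar> \<le> C * norm e ^ 3"
    proof (rule DERIV_bound_unit_interval)
      fix t :: real assume t: "0 \<le> t" "t \<le> 1"
      have line: "((\<lambda>t. w0 + t *\<^sub>R e) has_vector_derivative e) (at t)"
        by (auto intro!: derivative_eq_intros)
      have "((\<lambda>t. \<phi> (w0 + t *\<^sub>R e)) has_vector_derivative \<phi>' (w0 + t *\<^sub>R e) e) (at t)"
        using has_vector_derivative_compose[OF line deriv_\<phi>] \<delta>(2)[OF wt(2)[OF t]] by blast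
      then have d: "((\<lambda>t. \<phi> (w0 + t *\<^sub>R e)) has_real_derivative \<phi>' (w0 + t *\<^sub>R e) e) (at t)"
        by (simp add: has_real_derivative_iff_has_vector_derivative)
      have "((\<lambda>t. t\<^sup>2 / 2 * \<phi>'' w0 e e) has_real_derivative t * \<phi>'' w0 e e) (at t)"
        by (auto intro!: derivative_eq_intros)
      then show "(r has_real_derivative \<phi>' (w0 + t *\<^sub>R e) e - t * \<phi>'' w0 e e) (at t)"
        unfolding r_def by (rule DERIV_diff[OF d])
      have "\<bar>\<phi>' (w0 + t *\<^sub>R e) e - \<phi>'' w0 (w0 + t *\<^sub>R e - w0) e\<bar>
          \<le> C * (norm (w0 + t *\<^sub>R e - w0))\<^sup>2 * norm e"
        using \<delta>(3)[OF wt(2,1)[OF t] e] .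
      also have "\<dots> \<le> C * (norm e)\<^sup>2 * norm e"
        using wt(3)[OF t] C by (intro mult_right_mono mult_left_mono power_mono) auto
      finally show "\<bar>\<phi>' (w0 + t *\<^sub>R e) e - t * \<phi>'' w0 e e\<bar> \<le> C * norm e ^ 3"
        by (simp add: blinfun.bilinear_simps power2_eq_square power3_eq_cube algebra_simps)
    qed
    then show ?thesis
      unfolding r_def by (simp add: e_def algebra_simps)
  qed
  then show ?thesis
    using C \<delta>(1) unfolding eventually_nhds_metric by blast
qed

end

text \<open>Positivity becomes uniform by compactness of the unit sphere of \<open>S\<close>. For a
  zero-dimensional manifold this sphere is empty and any positive constant works.\<close>

lemma \<phi>''_coercive:
  assumes pd: "pos_def_on (tangent_space M (\<Psi> w0)) (riem_hess M h (\<Psi> w0))"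
  shows "\<exists>\<mu>>0. \<forall>b\<in>S. \<mu> * (norm b)\<^sup>2 \<le> \<phi>'' w0 b b"
proof -
  have pos: "\<phi>'' w0 b b > 0" if b: "b \<in> S" "b \<noteq> 0" for b
  proof -
    have "\<Psi>' w0 b \<noteq> 0" using \<Phi>'\<Psi>'[OF w0(2), of b] b(2) by (auto simp: blinfun.zero_right)
    then have "riem_hess M h (\<Psi> w0) (\<Psi>' w0 b) \<bullet> \<Psi>' w0 b > 0"
      using pd tangent_frame[OF w0 b(1)] unfolding pos_def_on_def by blast
    then show ?thesis
      using riem_hess_inner[OF w0 tangent_frame[OF w0 b(1)] b(1)] \<Phi>'\<Psi>'[OF w0(2)] crit by simp
  qed
  let ?K = "S \<inter> sphere 0 1"
  show ?thesis
  proof (cases "?K = {}")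
    case True
    have zero: "b = 0" if "b \<in> S" for b
    proof (rule ccontr)
      assume "b \<noteq> 0"
      then have "(1 / norm b) *\<^sub>R b \<in> ?K" using that by (auto intro: subspace_scale subspace_S)
      with True show False by blast
    qed
    have "1 * (norm b)\<^sup>2 \<le> \<phi>'' w0 b b" if "b \<in> S" for b
      unfolding zero[OF that] by (simp add: blinfun.bilinear_simps)
    then show ?thesis using zero_less_one by blast
  next
    case False
    have "compact ?K" using closed_subspace[OF subspace_S] by (intro closed_Int_compact) auto
    moreover have "continuous_on ?K (\<lambda>b. \<phi>'' w0 b b)" by (intro continuous_intros)
    ultimately obtain m where m: "m \<in> ?K" "\<And>b. b \<in> ?K \<Longrightarrow> \<phi>'' w0 m m \<le> \<phi>'' w0 b b"
      using continuous_attains_inf[OF _ False] by blast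
    have "\<phi>'' w0 m m * (norm b)\<^sup>2 \<le> \<phi>'' w0 b b" if b: "b \<in> S" for b
    proof (cases "b = 0")
      case False
      then have "(1 / norm b) *\<^sub>R b \<in> ?K" using b by (auto intro: subspace_scale subspace_S)
      from m(2)[OF this] show ?thesis
        using False by (simp add: blinfun.bilinear_simps field_simps power2_eq_square)
    qed (simp add: blinfun.bilinear_simps)
    moreover have "\<phi>'' w0 m m > 0" using m(1) by (intro pos) auto
    ultimately show ?thesis by blast
  qed
qed

end

end

section \<open>The Riemannian Newton step\<close>

lemma eventually_norm_diff_small:
  fixes x0 :: "'a::real_normed_vector"
  assumes "\<epsilon> > 0"
  shows "\<forall>\<^sub>F x in nhds x0. C * norm (x - x0) < \<epsilon>"
proof -
  have "((\<lambda>x. C * norm (x - x0)) \<longlongrightarrow> C * norm (x0 - x0)) (nhds x0)"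
    by (intro tendsto_intros filterlim_ident)
  then show ?thesis using assms by (intro order_tendstoD(2)) auto
qed

context slice_chart
begin

text \<open>The C2 extension \<open>H\<close> is expanded from \<open>(x, 0)\<close> to
  \<open>(x, d)\<close>. As \<open>H\<close> agrees with \<open>R\<close> on the tangent bundle
  alone, its derivative in direction \<open>(0, d)\<close> is identified as \<open>d\<close> along
  the curve \<open>t *\<^sub>R d\<close>.\<close>

lemma retraction_expansion:
  assumes R: "manifold_retraction M R" and x0: "x0 \<in> M" "x0 \<in> U"
  shows "\<exists>\<delta>>0. \<exists>C\<ge>0. \<forall>x d. x \<in> M \<longrightarrow> x \<in> U \<longrightarrow> d \<in> tangent_space M x \<longrightarrow>
    dist x x0 < \<delta> \<longrightarrow> norm d < \<delta> \<longrightarrow> norm (R x d - x - d) \<le> C * (norm d)\<^sup>2"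
proof -
  have T: "subspace (tangent_space M x)" if "x \<in> M" "x \<in> U" for x
    using subspace_tangent[OF \<Phi>_slice[OF that] \<Phi>_mem[OF that(2)]] that(2) by simp
  have "(x0, 0) \<in> tangent_bundle M"
    unfolding tangent_bundle_def using x0 T subspace_0 by blast
  then have "C2_restriction_at (tangent_bundle M) (\<lambda>(x, v). R x v) (x0, 0)"
    using R unfolding manifold_retraction_def by blast
  then obtain V H where V: "(x0, 0) \<in> V" "C2_on V H"
    and H: "\<And>z. z \<in> tangent_bundle M \<inter> V \<Longrightarrow> H z = (case z of (x, v) \<Rightarrow> R x v)"
    unfolding C2_restriction_at_def by blast
  obtain H' H'' where "open V"
    and H': "\<And>x. x \<in> V \<Longrightarrow> (H has_derivative blinfun_apply (H' x)) (at x)"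
    and H'': "\<And>x. x \<in> V \<Longrightarrow> (H' has_derivative blinfun_apply (H'' x)) (at x)" "continuous_on V H''"
    using V(2) unfolding C2_on_def by blast
  obtain \<delta> C where \<delta>: "\<delta> > 0" "C \<ge> 0" "ball (x0, 0) \<delta> \<subseteq> V"
    and taylor: "\<And>p q. p \<in> ball (x0, 0) \<delta> \<Longrightarrow> q \<in> ball (x0, 0) \<delta> \<Longrightarrow>
      norm (H q - H p - H' p (q - p)) \<le> C * (norm (q - p))\<^sup>2"
    using C2_taylor[OF \<open>open V\<close> V(1) H' H''] by blast
  have "norm (R x d - x - d) \<le> C * (norm d)\<^sup>2"
    if x: "x \<in> M" "x \<in> U" and d: "d \<in> tangent_space M x"
      and small: "dist x x0 < \<delta> / 2" "norm d < \<delta> / 2" for x d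
  proof -
    \<comment> \<open>Halving the radius leaves room for both components, because the norm of a pair
      is at most the sum of the norms.\<close>
    have in_ball: "(x, v) \<in> ball (x0, 0) \<delta>" if "norm v < \<delta> / 2" for v
    proof -
      have "dist (x0, 0) (x, v) \<le> dist x0 x + dist 0 v"
        unfolding dist_Pair_Pair by (rule sqrt_sum_squares_le_sum) auto
      then show ?thesis using small(1) that by (simp add: dist_commute)
    qed
    have eq: "H (x, v) = R x v" if "v \<in> tangent_space M x" "norm v < \<delta> / 2" for v
      using H[of "(x, v)"] in_ball[OF that(2)] \<delta>(3) that(1) x(1)
      unfolding tangent_bundle_def by auto
    have R0: "R x 0 = x" and dR: "(R x has_derivative (\<lambda>v. v)) (at 0 within tangent_space M x)"
      using R x(1) unfolding manifold_retraction_def by blast+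
    have xV: "(x, 0) \<in> V" using in_ball[of 0] \<delta>(1,3) by auto
    have td: "t *\<^sub>R d \<in> tangent_space M x" for t by (intro subspace_scale T x d)
    have line: "((\<lambda>t::real. t *\<^sub>R d) has_vector_derivative d) (at 0)"
      by (auto intro!: derivative_eq_intros)
    have "(R x has_derivative (\<lambda>v. v)) (at (0 *\<^sub>R d) within range (\<lambda>t. t *\<^sub>R d))"
      using has_derivative_subset[OF dR, of "range (\<lambda>t. t *\<^sub>R d)"] td by auto
    from vector_derivative_diff_chain_within[OF line this]
    have 1: "((\<lambda>t. R x (t *\<^sub>R d)) has_vector_derivative d) (at 0)" by (simp add: comp_def)
    have "((\<lambda>t::real. (x, t *\<^sub>R d)) has_vector_derivative (0, d)) (at 0)"
      using has_derivative_Pair[OF has_derivative_const line[unfolded has_vector_derivative_def]]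
      unfolding has_vector_derivative_def by simp
    from has_vector_derivative_compose[OF this, of H "H' (x, 0)"]
    have 2: "((\<lambda>t. H (x, t *\<^sub>R d)) has_vector_derivative H' (x, 0) (0, d)) (at 0)"
      using H'[OF xV] by simp
    have "\<forall>\<^sub>F t::real in nhds 0. norm d * norm (t - 0) < \<delta> / 2"
      using \<delta>(1) by (intro eventually_norm_diff_small) simp
    then have "\<forall>\<^sub>F t::real in nhds 0. t \<in> UNIV \<longrightarrow> R x (t *\<^sub>R d) = H (x, t *\<^sub>R d)"
      by eventually_elim (auto simp: eq[OF td] mult.commute)
    then have "((\<lambda>t. R x (t *\<^sub>R d)) has_vector_derivative H' (x, 0) (0, d)) (at 0)"
      using 2 by (subst has_vector_derivative_cong_ev) (auto dest: eventually_nhds_x_imp_x)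
    with 1 have "d = H' (x, 0) (0, d)" by (rule vector_derivative_unique_at)
    moreover have "norm (H (x, d) - H (x, 0) - H' (x, 0) ((x, d) - (x, 0))) \<le> C * (norm ((x, d) - (x, 0)))\<^sup>2"
      using \<delta>(1) by (intro taylor in_ball small) simp
    moreover have "H (x, 0) = x" using eq[of 0] R0 \<delta>(1) subspace_0[OF T[OF x]] by simp
    moreover have "H (x, d) = R x d" using eq[OF d small(2)] .
    ultimately show ?thesis by (simp add: norm_Pair)
  qed
  then show ?thesis using \<delta>(1,2) by (intro exI[of _ "\<delta> / 2"] conjI exI[of _ C]) auto
qed

end

context slice_chart_function
begin

definition newton_direction where
  "newton_direction x d \<longleftrightarrow> d \<in> tangent_space M x \<and> riem_grad M h x + riem_hess M h x d = 0"

context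
  fixes w0 :: 'a
  assumes w0: "w0 \<in> S" "w0 \<in> W" and crit: "G w0 = 0"
    and lip: "hess_locally_lipschitz M h (\<Psi> w0)"
    and pd: "pos_def_on (tangent_space M (\<Psi> w0)) (riem_hess M h (\<Psi> w0))"
begin

text \<open>The ideal step in coordinates is \<open>- e\<close>, and \<open>z = a + e\<close> is the
  deviation from it. Testing the Newton equation with \<open>z\<close> and replacing both of its
  terms by their values at \<open>w0\<close> leaves \<open>\<phi>'' w0 z z\<close> of size
  \<open>n * norm a * norm z + n\<^sup>2 * norm z\<close>, up to constants. Coercivity bounds
  \<open>z\<close>, the part proportional to \<open>norm z\<close> being absorbed since
  \<open>C1 * n < \<mu> / 2\<close>.\<close>

lemma newton_coords:
  "\<exists>C\<ge>0. \<forall>\<^sub>F w in nhds w0. w \<in> S \<longrightarrow> (\<forall>d. newton_direction (\<Psi> w) d \<longrightarrow>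
     norm (\<Phi>' (\<Psi> w) d + (w - w0)) \<le> C * (norm (w - w0))\<^sup>2)"
proof -
  obtain C1 where C1: "C1 \<ge> 0" "\<forall>\<^sub>F w in nhds w0. w \<in> S \<longrightarrow> (\<forall>a\<in>S. \<forall>b\<in>S.
     \<bar>(\<phi>'' w a b - G w \<bullet> \<Psi>'' w a b) - \<phi>'' w0 a b\<bar> \<le> C1 * norm (w - w0) * norm a * norm b)"
    using hess_form_bound[OF w0 crit lip] by blast
  obtain C2 where C2: "C2 \<ge> 0" "\<forall>\<^sub>F w in nhds w0. w \<in> S \<longrightarrow> (\<forall>b\<in>S.
     \<bar>\<phi>' w b - \<phi>'' w0 (w - w0) b\<bar> \<le> C2 * (norm (w - w0))\<^sup>2 * norm b)"
    using \<phi>'_expansion[OF w0 crit lip] by blast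
  obtain \<mu> where \<mu>: "\<mu> > 0" "\<And>b. b \<in> S \<Longrightarrow> \<mu> * (norm b)\<^sup>2 \<le> \<phi>'' w0 b b"
    using \<phi>''_coercive[OF w0 crit pd] by blast
  have small: "\<forall>\<^sub>F w in nhds w0. C1 * norm (w - w0) < \<mu> / 2"
    using \<mu>(1) by (intro eventually_norm_diff_small) simp
  have "\<forall>\<^sub>F w in nhds w0. w \<in> S \<longrightarrow> (\<forall>d. newton_direction (\<Psi> w) d \<longrightarrow>
     norm (\<Phi>' (\<Psi> w) d + (w - w0)) \<le> (2 * (C1 + C2) / \<mu>) * (norm (w - w0))\<^sup>2)"
    using C1(2) C2(2) small eventually_in_W[OF w0(2)]
  proof eventually_elim
    case (elim w)
    show ?case
    proof (intro impI allI)
      fix d assume "w \<in> S" and d: "newton_direction (\<Psi> w) d"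
      note w = \<open>w \<in> S\<close> elim(4)
      define e where "e = w - w0"
      define n where "n = norm e"
      define a where "a = \<Phi>' (\<Psi> w) d"
      define z where "z = a + e"
      have dT: "d \<in> tangent_space M (\<Psi> w)" and dn: "G w + riem_hess M h (\<Psi> w) d = 0"
        using d unfolding newton_direction_def by auto
      have a: "a \<in> S" unfolding a_def using tangent_coords(1)[OF w dT] .
      have e: "e \<in> S" unfolding e_def by (intro subspace_diff subspace_S w w0)
      have z: "z \<in> S" unfolding z_def by (intro subspace_add subspace_S a e)
      have n: "n \<ge> 0" unfolding n_def by simp
      let ?Hw = "\<phi>'' w a z - G w \<bullet> \<Psi>'' w a z"
      have "(G w + riem_hess M h (\<Psi> w) d) \<bullet> \<Psi>' w z = 0" unfolding dn by simp
      then have zero: "\<phi>' w z + ?Hw = 0"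
        unfolding inner_add_left riem_grad_inner[OF w z] riem_hess_inner[OF w dT z] a_def .
      have 1: "\<bar>?Hw - \<phi>'' w0 a z\<bar> \<le> C1 * n * norm a * norm z"
        using elim(1) w(1) a z unfolding n_def e_def by blast
      have 2: "\<bar>\<phi>' w z - \<phi>'' w0 e z\<bar> \<le> C2 * n\<^sup>2 * norm z"
        using elim(2) w(1) z unfolding n_def e_def by blast
      have "norm a \<le> norm z + n" unfolding z_def n_def by (metis add_diff_cancel norm_triangle_ineq4)
      then have "C1 * n * norm a * norm z \<le> C1 * n * (norm z + n) * norm z"
        using C1(1) n by (intro mult_right_mono mult_left_mono) auto
      moreover have "\<phi>'' w0 z z = \<phi>'' w0 a z + \<phi>'' w0 e z"
        unfolding z_def by (simp add: blinfun.bilinear_simps)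
      ultimately have "\<mu> * (norm z)\<^sup>2 \<le> C1 * n * (norm z + n) * norm z + C2 * n\<^sup>2 * norm z"
        using \<mu>(2)[OF z] 1 2 zero by linarith
      then have "(\<mu> * norm z) * norm z \<le> (C1 * n * (norm z + n) + C2 * n\<^sup>2) * norm z"
        by (simp add: power2_eq_square algebra_simps)
      then have "\<mu> * norm z \<le> C1 * n * (norm z + n) + C2 * n\<^sup>2"
        using C1(1) C2(1) n by (cases "z = 0") auto
      also have "\<dots> = (C1 * n) * norm z + (C1 + C2) * n\<^sup>2"
        by (simp add: power2_eq_square algebra_simps)
      also have "\<dots> \<le> \<mu> / 2 * norm z + (C1 + C2) * n\<^sup>2"
        using elim(3) unfolding n_def e_def by (intro add_right_mono mult_right_mono) auto
      finally have "norm z \<le> (2 * (C1 + C2) / \<mu>) * n\<^sup>2"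
        using \<mu>(1) by (simp add: field_simps)
      then show "norm (\<Phi>' (\<Psi> w) d + (w - w0)) \<le> (2 * (C1 + C2) / \<mu>) * (norm (w - w0))\<^sup>2"
        unfolding z_def a_def n_def e_def .
    qed
  qed
  then show ?thesis using C1(1) C2(1) \<mu>(1) by (intro exI[of _ "2 * (C1 + C2) / \<mu>"]) auto
qed

context
  fixes R assumes R: "manifold_retraction M R"
begin

lemma newton_quadratic_coords:
  "\<exists>C\<ge>0. \<forall>\<^sub>F w in nhds w0. w \<in> S \<longrightarrow> (\<forall>d. newton_direction (\<Psi> w) d \<longrightarrow>
     norm (R (\<Psi> w) d - \<Psi> w0) \<le> C * (norm (w - w0))\<^sup>2)"
proof -
  obtain C1 where C1: "C1 \<ge> 0" "\<forall>\<^sub>F w in nhds w0. w \<in> S \<longrightarrow> (\<forall>d. newton_direction (\<Psi> w) d \<longrightarrow>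
     norm (\<Phi>' (\<Psi> w) d + (w - w0)) \<le> C1 * (norm (w - w0))\<^sup>2)"
    using newton_coords by blast
  obtain \<delta>2 C2 where C2: "\<delta>2 > 0" "C2 \<ge> 0"
    "\<And>v w. v \<in> ball w0 \<delta>2 \<Longrightarrow> w \<in> ball w0 \<delta>2 \<Longrightarrow> norm (\<Psi> w - \<Psi> v - \<Psi>' v (w - v)) \<le> C2 * (norm (w - v))\<^sup>2"
    using C2_taylor[OF open_W w0(2) deriv_\<Psi> deriv2_\<Psi> cont_\<Psi>''] by blast
  obtain A where A: "A > 0" "\<forall>\<^sub>F w in nhds w0. norm (\<Psi>' w) \<le> A"
    using tendsto_nhds_norm_bounded[OF isCont_\<Psi>'[OF w0(2)]] by blast
  obtain \<delta>3 C3 where \<delta>3: "\<delta>3 > 0" "C3 \<ge> 0" and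
    ret: "\<And>x d. x \<in> M \<Longrightarrow> x \<in> U \<Longrightarrow> d \<in> tangent_space M x \<Longrightarrow>
      dist x (\<Psi> w0) < \<delta>3 \<Longrightarrow> norm d < \<delta>3 \<Longrightarrow> norm (R x d - x - d) \<le> C3 * (norm d)\<^sup>2"
    using retraction_expansion[OF R \<Psi>_slice[OF w0] \<Psi>_mem[OF w0(2)]] by blast
  have near: "\<forall>\<^sub>F w in nhds w0. dist (\<Psi> w) (\<Psi> w0) < \<delta>3"
  proof (rule tendstoD[OF _ \<delta>3(1)])
    show "(\<Psi> \<longlongrightarrow> \<Psi> w0) (nhds w0)"
      using isCont_\<Psi>[OF w0(2)] by (simp add: isCont_def tendsto_at_iff_tendsto_nhds)
  qed
  \<comment> \<open>This will give \<open>norm d \<le> B * n\<close>: the coordinates of the step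
    are at most \<open>(1 + C1) * n\<close> when \<open>n \<le> 1\<close>, and the frame costs a
    factor \<open>A\<close>.\<close>
  define B where "B = A * (1 + C1)"
  have s1: "\<forall>\<^sub>F w in nhds w0. 1 * norm (w - w0) < min 1 \<delta>2" "\<forall>\<^sub>F w in nhds w0. B * norm (w - w0) < \<delta>3"
    using C2(1) \<delta>3(1) by (intro eventually_norm_diff_small; simp)+
  have "\<forall>\<^sub>F w in nhds w0. w \<in> S \<longrightarrow> (\<forall>d. newton_direction (\<Psi> w) d \<longrightarrow>
     norm (R (\<Psi> w) d - \<Psi> w0) \<le> (C3 * B\<^sup>2 + C2 + A * C1) * (norm (w - w0))\<^sup>2)"
    using C1(2) A(2) near s1 eventually_in_W[OF w0(2)]
  proof eventually_elim
    case (elim w)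
    show ?case
    proof (intro impI allI)
      fix d assume "w \<in> S" and d: "newton_direction (\<Psi> w) d"
      note w = \<open>w \<in> S\<close> elim(6)
      define e where "e = w - w0"
      define n where "n = norm e"
      define a where "a = \<Phi>' (\<Psi> w) d"
      have dT: "d \<in> tangent_space M (\<Psi> w)" using d unfolding newton_direction_def by auto
      have n: "n \<ge> 0" "n \<le> 1" "n < \<delta>2" using elim(4) unfolding n_def e_def by auto
      have ae: "norm (a + e) \<le> C1 * n\<^sup>2" using elim(1) w(1) d unfolding a_def e_def n_def by blast
      have "n\<^sup>2 \<le> n" using n by (simp add: power2_eq_square mult_left_le_one_le)
      then have "C1 * n\<^sup>2 \<le> C1 * n" using C1(1) by (rule mult_left_mono)
      moreover have "norm a \<le> norm (a + e) + n" unfolding n_def by (metis add_diff_cancel norm_triangle_ineq4)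
      ultimately have an: "norm a \<le> (1 + C1) * n" using ae by (simp add: algebra_simps)
      have \<Psi>A: "norm (\<Psi>' w v) \<le> A * norm v" for v
        using norm_blinfun[of "\<Psi>' w" v] elim(2) by (meson mult_right_mono norm_ge_zero order_trans)
      have da: "\<Psi>' w a = d" unfolding a_def using tangent_coords(2)[OF w dT] .
      have "norm d \<le> A * norm a" using \<Psi>A[of a] unfolding da .
      also have "\<dots> \<le> A * ((1 + C1) * n)" using an A(1) by (intro mult_left_mono) auto
      finally have dn: "norm d \<le> B * n" unfolding B_def by (simp add: algebra_simps)
      have "norm (R (\<Psi> w) d - \<Psi> w - d) \<le> C3 * (norm d)\<^sup>2"
        using dn elim(3,5) unfolding n_def e_def
        by (intro ret \<Psi>_slice[OF w] \<Psi>_mem[OF w(2)] dT) auto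
      also have "\<dots> \<le> C3 * (B * n)\<^sup>2"
        using dn \<delta>3(2) by (intro mult_left_mono power_mono) auto
      finally have 1: "norm (R (\<Psi> w) d - \<Psi> w - d) \<le> C3 * B\<^sup>2 * n\<^sup>2"
        by (simp add: power_mult_distrib algebra_simps)
      have "norm (\<Psi> w0 - \<Psi> w - \<Psi>' w (w0 - w)) \<le> C2 * (norm (w0 - w))\<^sup>2"
        using n(3) C2(1) unfolding n_def e_def
        by (intro C2(3)) (auto simp: dist_norm norm_minus_commute)
      then have 2: "norm (\<Psi> w0 - \<Psi> w - \<Psi>' w (w0 - w)) \<le> C2 * n\<^sup>2"
        unfolding n_def e_def by (simp add: norm_minus_commute)
      have "norm (\<Psi>' w (a + e)) \<le> A * norm (a + e)" by (rule \<Psi>A)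
      also have "\<dots> \<le> A * (C1 * n\<^sup>2)" using ae A(1) by (intro mult_left_mono) auto
      finally have 3: "norm (\<Psi>' w (a + e)) \<le> A * C1 * n\<^sup>2" by (simp add: algebra_simps)
      \<comment> \<open>The error splits into the retraction remainder, the Taylor remainder of
        \<open>\<Psi>\<close> from \<open>w\<close> back to \<open>w0\<close>, and the Newton error
        in coordinates carried by the frame. Each is quadratic.\<close>
      have eq: "R (\<Psi> w) d - \<Psi> w0 = (R (\<Psi> w) d - \<Psi> w - d) - (\<Psi> w0 - \<Psi> w - \<Psi>' w (w0 - w)) + \<Psi>' w (a + e)"
        unfolding e_def by (simp add: blinfun.bilinear_simps da algebra_simps)
      have "norm (R (\<Psi> w) d - \<Psi> w0) \<le> norm (R (\<Psi> w) d - \<Psi> w - d)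
          + norm (\<Psi> w0 - \<Psi> w - \<Psi>' w (w0 - w)) + norm (\<Psi>' w (a + e))"
        unfolding eq using norm_triangle_ineq[of "(R (\<Psi> w) d - \<Psi> w - d) - (\<Psi> w0 - \<Psi> w - \<Psi>' w (w0 - w))" "\<Psi>' w (a + e)"]
          norm_triangle_ineq4[of "R (\<Psi> w) d - \<Psi> w - d" "\<Psi> w0 - \<Psi> w - \<Psi>' w (w0 - w)"] by linarith
      also have "\<dots> \<le> (C3 * B\<^sup>2 + C2 + A * C1) * n\<^sup>2"
        using 1 2 3 by (simp add: algebra_simps)
      finally show "norm (R (\<Psi> w) d - \<Psi> w0) \<le> (C3 * B\<^sup>2 + C2 + A * C1) * (norm (w - w0))\<^sup>2"
        unfolding n_def e_def .
    qed
  qed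
  moreover have "C3 * B\<^sup>2 + C2 + A * C1 \<ge> 0" using C1(1) C2(2) \<delta>3(2) A(1) by simp
  ultimately show ?thesis by blast
qed

text \<open>With \<open>qe = \<phi>'' w0 e e\<close>, the old value exceeds the minimal one by about
  \<open>qe / 2\<close>, the slope is about \<open>- qe\<close>, and the new excess is of higher
  order. Acceptance thus amounts to \<open>(1 / 2 - m) * qe\<close> dominating cubic errors, which
  follows from \<open>m < 1 / 2\<close> and coercivity.\<close>

lemma newton_full_step_armijo_coords:
  assumes m: "0 < m" "m < 1 / 2"
  shows "\<forall>\<^sub>F w in nhds w0. w \<in> S \<longrightarrow> (\<forall>d. newton_direction (\<Psi> w) d \<longrightarrow>
     h (R (\<Psi> w) d) \<le> h (\<Psi> w) + m * (G w \<bullet> d))"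
proof -
  obtain C1 where C1: "C1 \<ge> 0" "\<forall>\<^sub>F w in nhds w0. w \<in> S \<longrightarrow> (\<forall>d. newton_direction (\<Psi> w) d \<longrightarrow>
     norm (\<Phi>' (\<Psi> w) d + (w - w0)) \<le> C1 * (norm (w - w0))\<^sup>2)"
    using newton_coords by blast
  obtain C2 where C2: "C2 \<ge> 0" "\<forall>\<^sub>F w in nhds w0. w \<in> S \<longrightarrow> (\<forall>b\<in>S.
     \<bar>\<phi>' w b - \<phi>'' w0 (w - w0) b\<bar> \<le> C2 * (norm (w - w0))\<^sup>2 * norm b)"
    using \<phi>'_expansion[OF w0 crit lip] by blast
  obtain C3 where C3: "C3 \<ge> 0" "\<forall>\<^sub>F w in nhds w0. w \<in> S \<longrightarrow> (\<forall>d. newton_direction (\<Psi> w) d \<longrightarrow>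
     norm (R (\<Psi> w) d - \<Psi> w0) \<le> C3 * (norm (w - w0))\<^sup>2)"
    using newton_quadratic_coords by blast
  obtain C5 where C5: "C5 \<ge> 0" and ev5: "\<forall>\<^sub>F w in nhds w0. w \<in> S \<longrightarrow>
     \<bar>\<phi> w - \<phi> w0 - \<phi>'' w0 (w - w0) (w - w0) / 2\<bar> \<le> C5 * norm (w - w0) ^ 3"
    using \<phi>_expansion[OF w0 crit lip] by blast
  obtain \<mu> where \<mu>: "\<mu> > 0" "\<And>b. b \<in> S \<Longrightarrow> \<mu> * (norm b)\<^sup>2 \<le> \<phi>'' w0 b b"
    using \<phi>''_coercive[OF w0 crit pd] by blast
  define x0 where "x0 = \<Psi> w0"
  have x0: "x0 \<in> U" "\<Phi> x0 = w0" unfolding x0_def using w0 \<Psi>_mem by auto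
  obtain K where K: "K \<ge> 0" and evK: "\<forall>\<^sub>F y in nhds x0. norm (\<Phi> y - \<Phi> x0) \<le> K * norm (y - x0)"
    using has_derivative_bound_near[OF deriv_\<Phi>[OF x0(1)]] by blast
  obtain \<delta>5 where \<delta>5: "\<delta>5 > 0" "\<And>w. dist w w0 < \<delta>5 \<Longrightarrow> w \<in> S \<Longrightarrow>
     \<bar>\<phi> w - \<phi> w0 - \<phi>'' w0 (w - w0) (w - w0) / 2\<bar> \<le> C5 * norm (w - w0) ^ 3"
    using ev5 unfolding eventually_nhds_metric by blast
  obtain \<rho> where \<rho>: "\<rho> > 0" "\<And>y. dist y x0 < \<rho> \<Longrightarrow> y \<in> U \<and> norm (\<Phi> y - w0) \<le> K * norm (y - x0)"
    using eventually_conj[OF eventually_nhds_in_open[OF open_U x0(1)] evK] x0(2)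
    unfolding eventually_nhds_metric by auto
  define q where "q = norm (\<phi>'' w0)"
  have Q: "\<bar>\<phi>'' w0 u v\<bar> \<le> q * norm u * norm v" for u v
    using norm_blinfun2[of "\<phi>'' w0" u v] unfolding q_def by simp
  \<comment> \<open>\<open>C6\<close> bounds the excess value after the step, through the squared
    coordinate error \<open>(K * C3 * n\<^sup>2)\<^sup>2\<close>; \<open>C7\<close> collects the
    errors of the slope, from the direction and from the expansion of
    \<open>\<phi>'\<close>.\<close>
  define C6 where "C6 = (q + C5) * (K * C3)\<^sup>2"
  define C7 where "C7 = q * C1 + C2 * (1 + C1)"
  have s: "\<forall>\<^sub>F w in nhds w0. 1 * norm (w - w0) < 1" "\<forall>\<^sub>F w in nhds w0. C3 * norm (w - w0) < \<rho>"
    "\<forall>\<^sub>F w in nhds w0. K * C3 * norm (w - w0) < min 1 \<delta>5"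
    "\<forall>\<^sub>F w in nhds w0. (C6 + C5 + m * C7) * norm (w - w0) < (1 / 2 - m) * \<mu>"
    using \<rho>(1) \<delta>5(1) m(2) \<mu>(1) by (intro eventually_norm_diff_small; simp)+
  show ?thesis
    using C1(2) C2(2) C3(2) ev5 s eventually_in_W[OF w0(2)]
  proof eventually_elim
    case (elim w)
    show ?case
    proof (intro impI allI)
      fix d assume "w \<in> S" and d: "newton_direction (\<Psi> w) d"
      note w = \<open>w \<in> S\<close> elim(9)
      define e where "e = w - w0"
      define n where "n = norm e"
      define a where "a = \<Phi>' (\<Psi> w) d"
      define y where "y = R (\<Psi> w) d"
      define v where "v = \<Phi> y"
      have dT: "d \<in> tangent_space M (\<Psi> w)" using d unfolding newton_direction_def by auto
      have a: "a \<in> S" "\<Psi>' w a = d" unfolding a_def using tangent_coords[OF w dT] .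
      have e: "e \<in> S" unfolding e_def by (intro subspace_diff subspace_S w w0)
      have n: "n \<ge> 0" "n \<le> 1" using elim(5) unfolding n_def e_def by auto
      have n2: "n\<^sup>2 \<le> n" using n by (simp add: power2_eq_square mult_left_le_one_le)
      have ae: "norm (a + e) \<le> C1 * n\<^sup>2" using elim(1) w(1) d unfolding a_def e_def n_def by blast
      have "C1 * n\<^sup>2 \<le> C1 * n" using C1(1) n2 by (rule mult_left_mono[rotated])
      moreover have "norm a \<le> norm (a + e) + n" unfolding n_def by (metis add_diff_cancel norm_triangle_ineq4)
      ultimately have an: "norm a \<le> (1 + C1) * n" using ae by (simp add: algebra_simps)
      have yx: "norm (y - x0) \<le> C3 * n\<^sup>2"
        using elim(3) w(1) d unfolding y_def x0_def e_def n_def by blast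
      have "C3 * n\<^sup>2 \<le> C3 * n" using C3(1) n2 by (rule mult_left_mono[rotated])
      then have "dist y x0 < \<rho>" using yx elim(6) unfolding n_def e_def dist_norm by linarith
      from \<rho>(2)[OF this] have yU: "y \<in> U" and "norm (v - w0) \<le> K * norm (y - x0)"
        unfolding v_def by auto
      then have vn2: "norm (v - w0) \<le> K * C3 * n\<^sup>2"
        using mult_left_mono[OF yx K] by (simp add: algebra_simps)
      have "K * C3 * n\<^sup>2 \<le> K * C3 * n" using C3(1) K n2 by (intro mult_left_mono) auto
      then have vn: "norm (v - w0) < min 1 \<delta>5" using vn2 elim(7) unfolding n_def e_def by linarith
      have yM: "y \<in> M"
        using R dT \<Psi>_slice[OF w] unfolding manifold_retraction_def tangent_bundle_def y_def by auto
      have vS: "v \<in> S" unfolding v_def by (rule \<Phi>_slice[OF yM yU])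
      have hy: "h y = \<phi> v" unfolding v_def by (rule h_eq[OF yM yU])
      have hx: "h (\<Psi> w) = \<phi> w" by (rule h_\<phi>[OF w])
      have i: "\<phi> v - \<phi> w0 \<le> C6 * n ^ 3"
      proof -
        have "\<bar>\<phi> v - \<phi> w0 - \<phi>'' w0 (v - w0) (v - w0) / 2\<bar> \<le> C5 * norm (v - w0) ^ 3"
          using \<delta>5(2)[of v] vn vS by (simp add: dist_norm)
        also have "\<dots> \<le> C5 * norm (v - w0) ^ 2"
          using C5 vn by (intro mult_left_mono power_decreasing) auto
        finally have "\<phi> v - \<phi> w0 \<le> \<phi>'' w0 (v - w0) (v - w0) / 2 + C5 * norm (v - w0) ^ 2" by linarith
        moreover have "\<phi>'' w0 (v - w0) (v - w0) \<le> q * norm (v - w0) ^ 2"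
          using Q[of "v - w0" "v - w0"] by (simp add: power2_eq_square algebra_simps)
        moreover have "q * norm (v - w0) ^ 2 \<ge> 0" unfolding q_def by simp
        ultimately have "\<phi> v - \<phi> w0 \<le> (q + C5) * norm (v - w0) ^ 2" by (simp add: algebra_simps)
        also have "\<dots> \<le> (q + C5) * (K * C3 * n\<^sup>2) ^ 2"
          using C5 vn2 unfolding q_def by (intro mult_left_mono power_mono) auto
        also have "\<dots> = C6 * n ^ 4"
          unfolding C6_def by (simp add: power_mult_distrib power_mult[symmetric] algebra_simps)
        \<comment> \<open>The fourth power is weakened, using \<open>n \<le> 1\<close>, so that all
          error terms share the power 3.\<close>
        also have "\<dots> \<le> C6 * n ^ 3"
          using n C5 unfolding C6_def q_def by (intro mult_left_mono power_decreasing) auto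
        finally show ?thesis .
      qed
      define qe where "qe = \<phi>'' w0 e e"
      have ii: "\<phi> w - \<phi> w0 \<ge> qe / 2 - C5 * n ^ 3"
        using elim(4) w(1) unfolding qe_def n_def e_def by (auto simp: abs_le_iff)
      have iii: "G w \<bullet> d \<ge> - qe - C7 * n ^ 3"
      proof -
        have "G w \<bullet> d = \<phi>' w a" using riem_grad_inner[OF w a(1)] a(2) by simp
        moreover have "\<bar>\<phi>' w a - \<phi>'' w0 e a\<bar> \<le> C2 * n\<^sup>2 * norm a"
          using elim(2) w(1) a(1) unfolding n_def e_def by blast
        moreover have "C2 * n\<^sup>2 * norm a \<le> C2 * n\<^sup>2 * ((1 + C1) * n)"
          using an C2(1) by (intro mult_left_mono) auto
        moreover have "\<phi>'' w0 e a = - qe + \<phi>'' w0 e (a + e)"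
          unfolding qe_def by (simp add: blinfun.bilinear_simps)
        moreover have "\<bar>\<phi>'' w0 e (a + e)\<bar> \<le> q * n * (C1 * n\<^sup>2)"
        proof -
          have "\<bar>\<phi>'' w0 e (a + e)\<bar> \<le> q * n * norm (a + e)" unfolding n_def by (rule Q)
          also have "\<dots> \<le> q * n * (C1 * n\<^sup>2)" using ae n unfolding q_def by (intro mult_left_mono) auto
          finally show ?thesis .
        qed
        moreover have "C7 * n ^ 3 = C2 * n\<^sup>2 * ((1 + C1) * n) + q * n * (C1 * n\<^sup>2)"
          unfolding C7_def by (simp add: power2_eq_square power3_eq_cube algebra_simps)
        ultimately show ?thesis by linarith
      qed
      have "(C6 + C5 + m * C7) * n ^ 3 = ((C6 + C5 + m * C7) * n) * n\<^sup>2"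
        by (simp add: power2_eq_square power3_eq_cube)
      also have "\<dots> \<le> ((1 / 2 - m) * \<mu>) * n\<^sup>2"
        using elim(8) unfolding n_def e_def by (intro mult_right_mono) auto
      also have "\<dots> \<le> (1 / 2 - m) * qe"
        using mult_left_mono[OF \<mu>(2)[OF e], of "1 / 2 - m"] m(2) unfolding qe_def n_def by simp
      finally have "C6 * n ^ 3 + C5 * n ^ 3 + m * (C7 * n ^ 3) \<le> qe / 2 - m * qe"
        by (simp add: algebra_simps)
      moreover have "m * (G w \<bullet> d) \<ge> m * (- qe - C7 * n ^ 3)"
        using iii m(1) by (intro mult_left_mono) auto
      then have "m * (G w \<bullet> d) \<ge> - (m * qe) - m * (C7 * n ^ 3)" by (simp add: algebra_simps)
      ultimately have "\<phi> v \<le> \<phi> w + m * (G w \<bullet> d)" using i ii by linarith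
      then show "h (R (\<Psi> w) d) \<le> h (\<Psi> w) + m * (G w \<bullet> d)"
        unfolding hx y_def[symmetric] hy .
    qed
  qed
qed

text \<open>Coordinate estimates return to the manifold through \<open>\<Phi>\<close>: continuity
  transports the neighbourhood and the linear bound \<open>K\<close> transports the error.\<close>

lemma newton_step_near:
  assumes m: "0 < m" "m < 1 / 2"
  shows "\<exists>C\<ge>0. \<forall>\<^sub>F x in nhds (\<Psi> w0). x \<in> M \<longrightarrow> (\<forall>d. newton_direction x d \<longrightarrow>
     norm (R x d - \<Psi> w0) \<le> C * (norm (x - \<Psi> w0))\<^sup>2 \<and>
     h (R x d) \<le> h x + m * (riem_grad M h x \<bullet> d))"
proof -
  define x0 where "x0 = \<Psi> w0"
  have x0: "x0 \<in> U" "\<Phi> x0 = w0" unfolding x0_def using w0 \<Psi>_mem by auto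
  have lim: "filterlim \<Phi> (nhds w0) (nhds x0)"
    using isCont_\<Phi>[OF x0(1)] x0(2)
    by (simp add: isCont_def tendsto_at_iff_tendsto_nhds[of \<Phi> x0, unfolded x0(2)])
  obtain K where K: "K \<ge> 0" and evK: "\<forall>\<^sub>F y in nhds x0. norm (\<Phi> y - \<Phi> x0) \<le> K * norm (y - x0)"
    using has_derivative_bound_near[OF deriv_\<Phi>[OF x0(1)]] by blast
  obtain C where C: "C \<ge> 0" and evC: "\<forall>\<^sub>F w in nhds w0. w \<in> S \<longrightarrow> (\<forall>d. newton_direction (\<Psi> w) d \<longrightarrow>
     norm (R (\<Psi> w) d - \<Psi> w0) \<le> C * (norm (w - w0))\<^sup>2)"
    using newton_quadratic_coords by blast
  have "\<forall>\<^sub>F x in nhds x0. x \<in> M \<longrightarrow> (\<forall>d. newton_direction x d \<longrightarrow>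
     norm (R x d - x0) \<le> (C * K\<^sup>2) * (norm (x - x0))\<^sup>2 \<and> h (R x d) \<le> h x + m * (riem_grad M h x \<bullet> d))"
    using eventually_compose_filterlim[OF evC lim] evK eventually_nhds_in_open[OF open_U x0(1)]
      eventually_compose_filterlim[OF newton_full_step_armijo_coords[OF m] lim]
  proof eventually_elim
    case (elim x)
    show ?case
    proof (intro impI allI)
      fix d assume x: "x \<in> M" and d: "newton_direction x d"
      have \<Psi>\<Phi>x: "\<Psi> (\<Phi> x) = x" using elim(3) by simp
      have \<Phi>x: "\<Phi> x \<in> S" by (rule \<Phi>_slice[OF x elim(3)])
      have "norm (R x d - x0) \<le> C * (norm (\<Phi> x - w0))\<^sup>2"
        using elim(1) \<Phi>x d unfolding \<Psi>\<Phi>x x0_def by blast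
      also have "\<dots> \<le> C * (K * norm (x - x0))\<^sup>2"
        using elim(2) C unfolding x0(2) by (intro mult_left_mono power_mono) auto
      finally have "norm (R x d - x0) \<le> (C * K\<^sup>2) * (norm (x - x0))\<^sup>2"
        by (simp add: power_mult_distrib algebra_simps)
      then show "norm (R x d - x0) \<le> (C * K\<^sup>2) * (norm (x - x0))\<^sup>2 \<and>
          h (R x d) \<le> h x + m * (riem_grad M h x \<bullet> d)"
        using elim(4) \<Phi>x d unfolding \<Psi>\<Phi>x by blast
    qed
  qed
  then show ?thesis using C unfolding x0_def by (intro exI[of _ "C * K\<^sup>2"]) auto
qed

end

end

end

section \<open>Existence of charts and the Riemannian distance\<close>

lemma C2_on_subset: "C2_on U f \<Longrightarrow> open V \<Longrightarrow> V \<subseteq> U \<Longrightarrow> C2_on V f"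
  unfolding C2_on_def by (meson continuous_on_subset subsetD)

lemma C2_on_add:
  assumes "C2_on U f" "C2_on U g"
  shows "C2_on U (\<lambda>x. f x + g x)"
proof -
  obtain f' f'' where f: "open U" "\<And>x. x \<in> U \<Longrightarrow> (f has_derivative blinfun_apply (f' x)) (at x)"
    "\<And>x. x \<in> U \<Longrightarrow> (f' has_derivative blinfun_apply (f'' x)) (at x)" "continuous_on U f''"
    using assms(1) unfolding C2_on_def by blast
  obtain g' g'' where g: "\<And>x. x \<in> U \<Longrightarrow> (g has_derivative blinfun_apply (g' x)) (at x)"
    "\<And>x. x \<in> U \<Longrightarrow> (g' has_derivative blinfun_apply (g'' x)) (at x)" "continuous_on U g''"
    using assms(2) unfolding C2_on_def by blast
  define H' where "H' x = f' x + g' x" for x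
  define H'' where "H'' x = f'' x + g'' x" for x
  have 1: "((\<lambda>x. f x + g x) has_derivative blinfun_apply (H' x)) (at x)" if "x \<in> U" for x
    using has_derivative_add[OF f(2) g(1), OF that that] by (simp add: H'_def plus_blinfun.rep_eq)
  have 2: "(H' has_derivative blinfun_apply (H'' x)) (at x)" if "x \<in> U" for x
  proof -
    have "(H' has_derivative (\<lambda>v. f'' x v + g'' x v)) (at x)"
      unfolding H'_def by (rule has_derivative_add[OF f(3) g(2), OF that that])
    then show ?thesis by (simp add: H''_def plus_blinfun.rep_eq)
  qed
  have 3: "continuous_on U H''" unfolding H''_def by (intro continuous_intros f g)
  show ?thesis
    unfolding C2_on_def
  proof (rule conjI[OF f(1)], rule exI[of _ H'], rule exI[of _ H''], intro conjI ballI)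
    show "((\<lambda>x. f x + g x) has_derivative blinfun_apply (H' x)) (at x)" if "x \<in> U" for x
      by (rule 1[OF that])
    show "(H' has_derivative blinfun_apply (H'' x)) (at x)" if "x \<in> U" for x
      by (rule 2[OF that])
    show "continuous_on U H''" by (rule 3)
  qed
qed

text \<open>The chart domain is cut down to \<open>V\<close>, so that the C2 extension
  \<open>F\<close> of \<open>h\<close> and the chart live on the same set and \<open>\<phi>\<close>
  can be \<open>F\<close> composed with \<open>\<Psi>\<close>.\<close>

lemma slice_chart_function_exists:
  fixes M :: "'a::euclidean_space set"
  assumes M: "C2_submanifold_around p M x0" and V: "x0 \<in> V" "C2_on V F"
    and h: "\<And>z. z \<in> M \<Longrightarrow> z \<in> V \<Longrightarrow> h z = F z"
  shows "\<exists>S U W \<Phi> \<Psi> \<Phi>' \<Psi>' \<Psi>'' \<phi> \<phi>' \<phi>''. x0 \<in> U \<and> U \<subseteq> V \<and>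
    slice_chart_function M S U W \<Phi> \<Psi> \<Phi>' \<Psi>' \<Psi>'' h \<phi> \<phi>' \<phi>''"
proof -
  have "\<exists>U W \<Phi> \<Psi> (S :: 'a set). x0 \<in> U \<and> C2_on U \<Phi> \<and> C2_on W \<Psi> \<and> homeomorphism U W \<Phi> \<Psi> \<and>
      subspace S \<and> dim S = p \<and> \<Phi> ` (M \<inter> U) = S \<inter> W"
    using M unfolding C2_submanifold_around_def by (rule conjunct2)
  then obtain U0 W0 \<Phi> \<Psi> and S :: "'a set" where
    chart0: "x0 \<in> U0 \<and> C2_on U0 \<Phi> \<and> C2_on W0 \<Psi> \<and> homeomorphism U0 W0 \<Phi> \<Psi> \<and>
      subspace S \<and> dim S = p \<and> \<Phi> ` (M \<inter> U0) = S \<inter> W0"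
    by (elim exE) (rule that)
  have x0: "x0 \<in> M" "x0 \<in> U0" and C2: "C2_on U0 \<Phi>" "C2_on W0 \<Psi>"
    and hom: "homeomorphism U0 W0 \<Phi> \<Psi>" and S: "subspace S" and slice: "\<Phi> ` (M \<inter> U0) = S \<inter> W0"
    using chart0 M unfolding C2_submanifold_around_def by simp_all
  obtain \<Phi>' \<Phi>'' where \<Phi>: "open U0" "\<And>x. x \<in> U0 \<Longrightarrow> (\<Phi> has_derivative blinfun_apply (\<Phi>' x)) (at x)"
    "\<And>x. x \<in> U0 \<Longrightarrow> (\<Phi>' has_derivative blinfun_apply (\<Phi>'' x)) (at x)"
    using C2(1) unfolding C2_on_def by blast
  obtain \<Psi>' \<Psi>'' where \<Psi>: "open W0" "\<And>x. x \<in> W0 \<Longrightarrow> (\<Psi> has_derivative blinfun_apply (\<Psi>' x)) (at x)"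
    "\<And>x. x \<in> W0 \<Longrightarrow> (\<Psi>' has_derivative blinfun_apply (\<Psi>'' x)) (at x)" "continuous_on W0 \<Psi>''"
    using C2(2) unfolding C2_on_def by blast
  obtain F' F'' where F: "open V" "\<And>x. x \<in> V \<Longrightarrow> (F has_derivative blinfun_apply (F' x)) (at x)"
    "\<And>x. x \<in> V \<Longrightarrow> (F' has_derivative blinfun_apply (F'' x)) (at x)"
    using V(2) unfolding C2_on_def by blast
  have hom': "\<And>x. x \<in> U0 \<Longrightarrow> \<Phi> x \<in> W0 \<and> \<Psi> (\<Phi> x) = x" "\<And>w. w \<in> W0 \<Longrightarrow> \<Psi> w \<in> U0 \<and> \<Phi> (\<Psi> w) = w"
    and cont: "continuous_on W0 \<Psi>"
    using hom unfolding homeomorphism_def by auto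
  define U where "U = U0 \<inter> V"
  define W where "W = W0 \<inter> \<Psi> -` V"
  have "open U" unfolding U_def by (intro open_Int \<Phi>(1) F(1))
  moreover have "open W" unfolding W_def by (rule continuous_open_preimage[OF cont \<Psi>(1) F(1)])
  moreover have "continuous_on U \<Phi>'"
    using \<Phi>(3) unfolding U_def
    by (intro continuous_at_imp_continuous_on ballI has_derivative_continuous) auto
  moreover have "continuous_on W \<Psi>''" using \<Psi>(4) unfolding W_def by (rule continuous_on_subset) auto
  moreover have img: "\<Phi> ` U = W"
  proof
    show "W \<subseteq> \<Phi> ` U"
    proof
      fix w assume "w \<in> W"
      then have "\<Psi> w \<in> U" "\<Phi> (\<Psi> w) = w" using hom'(2) unfolding U_def W_def by auto
      then show "w \<in> \<Phi> ` U" by (metis imageI)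
    qed
  qed (use hom'(1) in \<open>auto simp: U_def W_def\<close>)
  then have "homeomorphism U W \<Phi> \<Psi>"
    using homeomorphism_of_subsets[OF hom, of U W W] unfolding U_def W_def by auto
  moreover have "\<Phi> ` (M \<inter> U) = S \<inter> W"
  proof
    show "S \<inter> W \<subseteq> \<Phi> ` (M \<inter> U)"
    proof
      fix w assume w: "w \<in> S \<inter> W"
      then have "w \<in> \<Phi> ` (M \<inter> U0)" unfolding slice W_def by auto
      then obtain x where x: "x \<in> M" "x \<in> U0" "w = \<Phi> x" by blast
      then have "x \<in> V" using w hom'(1) unfolding W_def by auto
      with x show "w \<in> \<Phi> ` (M \<inter> U)" unfolding U_def by blast
    qed
    show "\<Phi> ` (M \<inter> U) \<subseteq> S \<inter> W" using slice img unfolding U_def by blast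
  qed
  ultimately have chart: "slice_chart M S U W \<Phi> \<Psi> \<Phi>' \<Psi>' \<Psi>''"
    using \<Phi>(2) \<Psi>(2,3) S by unfold_locales (auto simp: U_def W_def)
  define \<phi> where "\<phi> w = F (\<Psi> w)" for w
  define \<phi>' where "\<phi>' w = F' (\<Psi> w) o\<^sub>L \<Psi>' w" for w
  \<comment> \<open>Second derivative of the composition, from the product rule for
    \<open>F' (\<Psi> w) o\<^sub>L \<Psi>' w\<close>.\<close>
  define D where "D w = (\<lambda>v. (F' (\<Psi> w) o\<^sub>L \<Psi>'' w v) + (F'' (\<Psi> w) (\<Psi>' w v) o\<^sub>L \<Psi>' w))" for w
  have \<phi>1: "(\<phi> has_derivative blinfun_apply (\<phi>' w)) (at w)" if "w \<in> W" for w
  proof -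
    have "w \<in> W0" "\<Psi> w \<in> V" using that unfolding W_def by auto
    from has_derivative_compose[OF \<Psi>(2)[OF this(1)] F(2)[OF this(2)]]
    show ?thesis unfolding \<phi>_def \<phi>'_def by (simp add: blinfun_compose.rep_eq comp_def)
  qed
  have \<phi>2: "(\<phi>' has_derivative D w) (at w)" if "w \<in> W" for w
  proof -
    have w: "w \<in> W0" "\<Psi> w \<in> V" using that unfolding W_def by auto
    have "((\<lambda>w. F' (\<Psi> w)) has_derivative (\<lambda>v. F'' (\<Psi> w) (\<Psi>' w v))) (at w)"
      using has_derivative_compose[OF \<Psi>(2)[OF w(1)] F(3)[OF w(2)]] .
    from bounded_bilinear.FDERIV[OF bounded_bilinear_blinfun_compose this \<Psi>(3)[OF w(1)]]
    show ?thesis unfolding \<phi>'_def D_def .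
  qed
  have "slice_chart_function M S U W \<Phi> \<Psi> \<Phi>' \<Psi>' \<Psi>'' h \<phi> \<phi>' (\<lambda>w. Blinfun (D w))"
  proof (intro slice_chart_function.intro chart slice_chart_function_axioms.intro)
    fix w assume w: "w \<in> W"
    show "(\<phi> has_derivative blinfun_apply (\<phi>' w)) (at w)" by (rule \<phi>1[OF w])
    show "(\<phi>' has_derivative blinfun_apply (Blinfun (D w))) (at w)"
      using \<phi>2[OF w] by (simp add: bounded_linear_Blinfun_apply has_derivative_bounded_linear[OF \<phi>2[OF w]])
    assume "w \<in> S"
    then have "w \<in> \<Phi> ` (M \<inter> U0)" using w unfolding slice W_def by auto
    then have "\<Psi> w \<in> M" using hom'(1) by auto
    then show "h (\<Psi> w) = \<phi> w" using w unfolding \<phi>_def W_def by (auto intro: h)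
  qed
  moreover have "x0 \<in> U" "U \<subseteq> V" using x0 V(1) unfolding U_def by auto
  ultimately show ?thesis by blast
qed

text \<open>A chord is no longer than any path. The fundamental theorem yields a gauge integral,
  whereas the length is a Lebesgue integral that may be infinite; in the finite case the derivative
  is Lebesgue integrable and the two integrals agree.\<close>

lemma dist_le_riem_dist: "ennreal (dist x y) \<le> riem_dist M x (y :: 'a::euclidean_space)"
  unfolding riem_dist_def
proof (rule INF_greatest)
  fix c assume "c \<in> {c. valid_path c \<and> path_image c \<subseteq> M \<and> pathstart c = x \<and> pathfinish c = y}"
  then have vp: "valid_path c" and c: "c 0 = x" "c 1 = y"
    by (auto simp: pathstart_def pathfinish_def)
  define c' where "c' t = vector_derivative c (at t)" for t
  obtain A where A: "finite A" "c C1_differentiable_on ({0..1} - A)" and cont: "continuous_on {0..1} c"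
    using vp unfolding valid_path_def piecewise_C1_differentiable_on_def by blast
  have d: "(c has_vector_derivative c' t) (at t)" if "t \<in> {0..1} - A" for t
    using A(2) that unfolding C1_differentiable_on_eq c'_def by (simp add: vector_derivative_works)
  have cc: "continuous_on ({0..1} - A) c'"
    using A(2) unfolding C1_differentiable_on_eq c'_def by blast
  have fi: "(c' has_integral (c 1 - c 0)) {0..1}"
    by (rule fundamental_theorem_of_calculus_interior_strong[OF A(1) _ _ cont]) (auto intro: d)
  \<comment> \<open>The derivative is set to zero outside the interval and on the finite exceptional
    set, where \<open>vector_derivative\<close> need not be meaningful; this makes it Borel
    measurable.\<close>
  define k where "k t = indicator ({0..1} - A) t *\<^sub>R c' t" for t
  have km: "k \<in> borel_measurable borel"
    unfolding k_def using A(1)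
    by (intro borel_measurable_continuous_on_indicator cc sets.Diff) (auto intro: finite_imp_closed borel_closed)
  have kn: "(\<integral>\<^sup>+t. ennreal (norm (k t)) \<partial>lborel) \<le> (\<integral>\<^sup>+t\<in>{0..1}. ennreal (norm (c' t)) \<partial>lborel)"
    by (rule nn_integral_mono) (auto simp: k_def indicator_def)
  show "ennreal (dist x y) \<le> (\<integral>\<^sup>+t\<in>{0..1}. ennreal (norm (vector_derivative c (at t))) \<partial>lborel)"
  proof (cases "(\<integral>\<^sup>+t\<in>{0..1}. ennreal (norm (c' t)) \<partial>lborel) = \<infinity>")
    case True
    then show ?thesis unfolding c'_def by simp
  next
    case False
    then have "(\<integral>\<^sup>+t. ennreal (norm (k t)) \<partial>lborel) < \<infinity>"
      using kn by (simp add: less_top order_le_less_trans)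
    then have int: "integrable lborel k" using km by (intro integrableI_bounded) auto
    have "(k has_integral (c 1 - c 0)) {0..1}"
      by (rule has_integral_spike_finite[OF A(1) _ fi]) (auto simp: k_def)
    then have "(k has_integral (c 1 - c 0)) UNIV"
      by (rule has_integral_on_superset) (auto simp: k_def)
    moreover have "(k has_integral (\<integral>t. k t \<partial>lborel)) UNIV"
      by (rule has_integral_integral_lborel[OF int])
    ultimately have "c 1 - c 0 = (\<integral>t. k t \<partial>lborel)" by (rule has_integral_unique)
    then have "ennreal (norm (c 1 - c 0)) \<le> (\<integral>\<^sup>+t. ennreal (norm (k t)) \<partial>lborel)"
      using integral_norm_bound_ennreal[OF int] by simp
    also note kn
    finally show ?thesis unfolding c c'_def by (simp add: dist_norm norm_minus_commute)
  qed
qed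

context slice_chart
begin

text \<open>The competitor path is the image of the straight segment in \<open>S\<close>.
  \<open>A\<close> bounds the stretching by the frame, \<open>K\<close> that by the chart.\<close>

lemma riem_dist_le:
  assumes x0: "x0 \<in> M" "x0 \<in> U"
  shows "\<exists>C\<ge>0. \<forall>\<^sub>F x in nhds x0. x \<in> M \<longrightarrow> riem_dist M x x0 \<le> ennreal (C * dist x x0)"
proof -
  define w0 where "w0 = \<Phi> x0"
  have w0: "w0 \<in> S" "w0 \<in> W" "\<Psi> w0 = x0"
    unfolding w0_def using x0 \<Phi>_slice \<Phi>_mem by auto
  obtain A where A: "A > 0" "\<forall>\<^sub>F w in nhds w0. norm (\<Psi>' w) \<le> A"
    using tendsto_nhds_norm_bounded[OF isCont_\<Psi>'[OF w0(2)]] by blast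
  obtain \<delta> where \<delta>: "\<delta> > 0" "\<And>w. w \<in> ball w0 \<delta> \<Longrightarrow> w \<in> W \<and> norm (\<Psi>' w) \<le> A"
    using eventually_conj[OF eventually_in_W[OF w0(2)] A(2)]
    unfolding eventually_nhds_metric by (auto simp: dist_commute)
  obtain K where K: "K \<ge> 0" "\<forall>\<^sub>F y in nhds x0. norm (\<Phi> y - \<Phi> x0) \<le> K * norm (y - x0)"
    using has_derivative_bound_near[OF deriv_\<Phi>[OF x0(2)]] by blast
  have small: "\<forall>\<^sub>F y in nhds x0. K * norm (y - x0) < \<delta>" using \<delta>(1) by (rule eventually_norm_diff_small)
  have "\<forall>\<^sub>F x in nhds x0. x \<in> M \<longrightarrow> riem_dist M x x0 \<le> ennreal ((A * K) * dist x x0)"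
    using K(2) small eventually_nhds_in_open[OF open_U x0(2)]
  proof eventually_elim
    case (elim x)
    show ?case
    proof
      assume x: "x \<in> M"
      define w where "w = \<Phi> x"
      have w: "w \<in> S" "\<Psi> w = x" unfolding w_def using \<Phi>_slice[OF x elim(3)] elim(3) by auto
      have wn: "norm (w - w0) \<le> K * norm (x - x0)" using elim(1) unfolding w_def w0_def .
      define e where "e = w0 - w"
      define c where "c t = \<Psi> (w + t *\<^sub>R e)" for t
      have seg: "w + t *\<^sub>R e \<in> ball w0 \<delta>" if "t \<in> {0..1}" for t
      proof -
        have "w + t *\<^sub>R e - w0 = (1 - t) *\<^sub>R (w - w0)" unfolding e_def by (simp add: algebra_simps)
        then have "norm (w + t *\<^sub>R e - w0) = (1 - t) * norm (w - w0)" using that by simp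
        also have "\<dots> \<le> norm (w - w0)" using that by (simp add: mult_left_le_one_le)
        finally show ?thesis using wn elim(2) by (simp add: dist_norm norm_minus_commute)
      qed
      have segS: "w + t *\<^sub>R e \<in> S" for t
        unfolding e_def by (intro subspace_add subspace_scale subspace_diff subspace_S w w0)
      have d: "(c has_vector_derivative \<Psi>' (w + t *\<^sub>R e) e) (at t)" if "t \<in> {0..1}" for t
      proof -
        have "((\<lambda>t. w + t *\<^sub>R e) has_vector_derivative e) (at t)" by (auto intro!: derivative_eq_intros)
        from has_vector_derivative_compose[OF this deriv_\<Psi>] \<delta>(2)[OF seg[OF that]]
        show ?thesis unfolding c_def by blast
      qed
      have "continuous_on {0..1} (\<lambda>t. \<Psi>' (w + t *\<^sub>R e) e)"
        by (intro continuous_intros continuous_on_compose2[OF cont_\<Psi>']) (use \<delta>(2) seg in auto)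
      then have "c C1_differentiable_on {0..1}"
        unfolding C1_differentiable_on_def using d
        by (intro exI[of _ "\<lambda>t. \<Psi>' (w + t *\<^sub>R e) e"] conjI ballI)
      then have "valid_path c"
        unfolding valid_path_def by (rule C1_differentiable_imp_piecewise)
      moreover have "path_image c \<subseteq> M"
        unfolding path_image_def c_def using \<Psi>_slice segS \<delta>(2) seg by blast
      moreover have "pathstart c = x" "pathfinish c = x0"
        unfolding pathstart_def pathfinish_def c_def e_def using w w0 by simp_all
      ultimately have "riem_dist M x x0 \<le> (\<integral>\<^sup>+t\<in>{0..1}. ennreal (norm (vector_derivative c (at t))) \<partial>lborel)"
        unfolding riem_dist_def by (intro INF_lower) auto
      also have "\<dots> \<le> (\<integral>\<^sup>+t\<in>{0..1::real}. ennreal (A * norm e) \<partial>lborel)"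
      proof (rule nn_integral_mono)
        fix t :: real
        show "ennreal (norm (vector_derivative c (at t))) * indicator {0..1} t \<le> ennreal (A * norm e) * indicator {0..1} t"
        proof (cases "t \<in> {0..1}")
          case True
          have "norm (\<Psi>' (w + t *\<^sub>R e) e) \<le> norm (\<Psi>' (w + t *\<^sub>R e)) * norm e" by (rule norm_blinfun)
          also have "\<dots> \<le> A * norm e" using \<delta>(2)[OF seg[OF True]] by (intro mult_right_mono) auto
          finally show ?thesis
            unfolding vector_derivative_at[OF d[OF True]] by (intro mult_right_mono ennreal_leI) auto
        qed simp
      qed
      also have "\<dots> = ennreal (A * norm e)"
        by (simp add: nn_integral_cmult_indicator)
      also have "\<dots> \<le> ennreal ((A * K) * dist x x0)"
      proof (rule ennreal_leI)
        have "norm e = norm (w - w0)" unfolding e_def by (rule norm_minus_commute)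
        then show "A * norm e \<le> (A * K) * dist x x0"
          using mult_left_mono[OF wn, of A] A(1) by (simp add: dist_norm algebra_simps)
      qed
      finally show "riem_dist M x x0 \<le> ennreal ((A * K) * dist x x0)" .
    qed
  qed
  then show ?thesis using A(1) K(1) by (intro exI[of _ "A * K"]) auto
qed

end

section \<open>Identification of the manifold\<close>

text \<open>Base point and minimiser coincide, so the terms on the minimiser's side vanish and a
  global quadratic minorant of \<open>g\<close> remains.\<close>

lemma prox_grad_growth:
  assumes "r > 0" and x0: "x0 \<in> prox (1 / r) g (x0 - (1 / r) *\<^sub>R D)"
    and "g x0 = ereal g0" "g u = ereal gu"
  shows "g0 \<le> gu + D \<bullet> (u - x0) + r / 2 * (norm (u - x0))\<^sup>2"
  using prox_grad_le[OF x0 _ assms(3,4)] \<open>r > 0\<close> by simp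

text \<open>Minimality of \<open>p\<close>, tested at \<open>x0\<close>, is added to the growth
  inequality at \<open>x0\<close>, tested at \<open>p\<close>. The values of \<open>g\<close>
  cancel, the quadratic terms leave the coefficient \<open>\<kappa> > 0\<close>, and the rest is at
  most a multiple of \<open>norm (p - x0) * norm (y - x0)\<close>.\<close>

lemma prox_grad_error_bound:
  fixes f :: "'a::euclidean_space \<Rightarrow> real"
  assumes st: "standing_assumptions f g L" and \<gamma>: "\<gamma> > 0" and r: "0 < r" "r < 1 / \<gamma>"
    and x0: "prox (1 / r) g (x0 - (1 / r) *\<^sub>R gradient f x0) = {x0}"
  shows "\<exists>C\<ge>0. \<forall>y p. p \<in> prox \<gamma> g (y - \<gamma> *\<^sub>R gradient f y) \<longrightarrow> norm (p - x0) \<le> C * norm (y - x0)"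
proof -
  define k where "k = 1 / (2 * \<gamma>)"
  define \<kappa> where "\<kappa> = k - r / 2"
  have k: "k > 0" and \<kappa>: "\<kappa> > 0" unfolding \<kappa>_def k_def using r \<gamma> by (simp_all add: field_simps)
  have lip: "lipschitz_on L UNIV (gradient f)" using st unfolding standing_assumptions_def by blast
  have L: "L \<ge> 0" using lip by (rule lipschitz_on_nonneg)
  have x0p: "x0 \<in> prox (1 / r) g (x0 - (1 / r) *\<^sub>R gradient f x0)" using x0 by simp
  obtain g0 where g0: "g x0 = ereal g0" using standing_assumptions_finite[OF st x0p] by blast
  have "norm (p - x0) \<le> ((2 * k + L) / \<kappa>) * norm (y - x0)"
    if p: "p \<in> prox \<gamma> g (y - \<gamma> *\<^sub>R gradient f y)" for y p
  proof -
    obtain gp where gp: "g p = ereal gp" using standing_assumptions_finite[OF st p] by blast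
    define D where "D = gradient f y - gradient f x0"
    have 1: "gp + gradient f y \<bullet> (p - y) + k * (norm (p - y))\<^sup>2
        \<le> g0 + gradient f y \<bullet> (x0 - y) + k * (norm (x0 - y))\<^sup>2"
      using prox_grad_le[OF p \<gamma> gp g0] unfolding k_def .
    have 2: "g0 \<le> gp + gradient f x0 \<bullet> (p - x0) + r / 2 * (norm (p - x0))\<^sup>2"
      by (rule prox_grad_growth[OF r(1) x0p g0 gp])
    have 3: "(norm (p - y))\<^sup>2 = (norm (p - x0))\<^sup>2 - 2 * ((p - x0) \<bullet> (y - x0)) + (norm (x0 - y))\<^sup>2"
      by (simp add: power2_norm_eq_inner inner_diff_left inner_diff_right inner_commute algebra_simps)
    have 4: "gradient f y \<bullet> (p - y) - gradient f y \<bullet> (x0 - y) - gradient f x0 \<bullet> (p - x0) = D \<bullet> (p - x0)"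
      unfolding D_def by (simp add: inner_diff_left inner_diff_right algebra_simps)
    have "k * (norm (p - y))\<^sup>2 = k * (norm (p - x0))\<^sup>2 - 2 * k * ((p - x0) \<bullet> (y - x0)) + k * (norm (x0 - y))\<^sup>2"
      unfolding 3 by (simp add: algebra_simps)
    then have "k * (norm (p - x0))\<^sup>2 - r / 2 * (norm (p - x0))\<^sup>2
        \<le> 2 * k * ((p - x0) \<bullet> (y - x0)) + - D \<bullet> (p - x0)"
      using 1 2 4 by simp
    also have "\<dots> \<le> 2 * k * (norm (p - x0) * norm (y - x0)) + (L * norm (y - x0)) * norm (p - x0)"
    proof (intro add_mono mult_left_mono norm_cauchy_schwarz)
      have "- D \<bullet> (p - x0) \<le> norm (- D) * norm (p - x0)" by (rule norm_cauchy_schwarz)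
      also have "\<dots> \<le> (L * norm (y - x0)) * norm (p - x0)"
        using lipschitz_onD[OF lip, of y x0] unfolding D_def
        by (intro mult_right_mono) (auto simp: dist_norm norm_minus_commute)
      finally show "- D \<bullet> (p - x0) \<le> (L * norm (y - x0)) * norm (p - x0)" .
    qed (use k in simp)
    finally have "(\<kappa> * norm (p - x0)) * norm (p - x0) \<le> ((2 * k + L) * norm (y - x0)) * norm (p - x0)"
      unfolding \<kappa>_def by (simp add: power2_eq_square algebra_simps)
    then have "\<kappa> * norm (p - x0) \<le> (2 * k + L) * norm (y - x0)"
      using k L by (cases "p = x0") auto
    then show ?thesis using \<kappa> by (simp add: field_simps)
  qed
  moreover have "(2 * k + L) / \<kappa> \<ge> 0" using k L \<kappa> by simp
  ultimately show ?thesis by blast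
qed

lemma regular_subdiff_subset_limiting: "regular_subdiff g x \<subseteq> limiting_subdiff g x"
proof
  fix v assume v: "v \<in> regular_subdiff g x"
  then have "\<bar>g x\<bar> \<noteq> \<infinity>" unfolding regular_subdiff_def by simp
  moreover have "\<exists>vs xs. (\<forall>k. vs k \<in> regular_subdiff g (xs k)) \<and> vs \<longlonglongrightarrow> v \<and> xs \<longlonglongrightarrow> x \<and>
      (\<lambda>k::nat. g (xs k)) \<longlonglongrightarrow> g x"
    using v by (intro exI[of _ "\<lambda>_. v"] exI[of _ "\<lambda>_. x"]) simp
  ultimately show "v \<in> limiting_subdiff g x"
    unfolding limiting_subdiff_def by simp
qed

context slice_chart
begin

text \<open>The squared distance to \<open>a\<close> along a chart line in the given direction has a
  local minimum at 0, so its derivative vanishes.\<close>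

lemma nearest_point_orthogonal:
  assumes q: "q \<in> M" "q \<in> U" and b: "b \<in> S"
    and near: "\<forall>\<^sub>F z in nhds q. z \<in> M \<longrightarrow> dist a q \<le> dist a z"
  shows "(a - q) \<bullet> \<Psi>' (\<Phi> q) b = 0"
proof -
  have w: "\<Phi> q \<in> S" "\<Phi> q \<in> W" "\<Psi> (\<Phi> q) = q" using q \<Phi>_slice \<Phi>_mem by auto
  define v where "v = \<Psi>' (\<Phi> q) b"
  define c where "c t = \<Psi> (\<Phi> q + t *\<^sub>R b)" for t
  have c: "curve_through M q v c" using curve_chart_line[OF w(1,2) b] unfolding w(3) v_def c_def .
  have c0: "c 0 = q" and cd: "(c has_vector_derivative v) (at 0)"
    using c unfolding curve_through_def by blast+
  have "((\<lambda>t. a - c t) has_vector_derivative - v) (at 0)"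
    using has_vector_derivative_diff[OF has_vector_derivative_const cd, of a] by simp
  from has_vector_derivative_bilinear[OF bounded_bilinear_inner this this]
  have d: "((\<lambda>t. (a - c t) \<bullet> (a - c t)) has_real_derivative (- 2 * ((a - q) \<bullet> v))) (at 0)"
    unfolding c0 by (simp add: has_real_derivative_iff_has_vector_derivative inner_commute)
  have "isCont c 0" using cd by (rule has_vector_derivative_continuous)
  then have "filterlim c (nhds q) (nhds 0)"
    unfolding c0[symmetric] by (simp add: isCont_def tendsto_at_iff_tendsto_nhds)
  from eventually_compose_filterlim[OF near this] curve_in_chart(1)[OF c q(2)]
  have "\<forall>\<^sub>F t in nhds 0. (a - c 0) \<bullet> (a - c 0) \<le> (a - c t) \<bullet> (a - c t)"
  proof eventually_elim
    case (elim t)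
    then have "(norm (a - c 0))\<^sup>2 \<le> (norm (a - c t))\<^sup>2"
      unfolding c0 dist_norm by (intro power_mono) auto
    then show ?case by (simp add: power2_norm_eq_inner)
  qed
  then obtain \<delta> where "\<delta> > 0" "\<And>t. dist t 0 < \<delta> \<Longrightarrow> (a - c 0) \<bullet> (a - c 0) \<le> (a - c t) \<bullet> (a - c t)"
    unfolding eventually_nhds_metric by blast
  then have "- 2 * ((a - q) \<bullet> v) = 0"
    using DERIV_local_min[OF d] by (simp add: dist_real_def)
  then show ?thesis unfolding v_def by simp
qed

text \<open>Hare and Lewis: if \<open>p n\<close> stayed off \<open>M\<close>, its unit normal offset from the nearest point \<open>q n\<close>
  of \<open>M\<close> would converge to some unit normal \<open>\<nu>\<close>. As \<open>v\<close> is relatively interior, \<open>v + \<epsilon> *\<^sub>R \<nu>\<close> is still a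
  subgradient and hence a limit of subgradients at \<open>q n\<close>; adding the prox-regularity
  inequalities at \<open>p n\<close> (near \<open>v\<close>) and at \<open>q n\<close> (near \<open>v + \<epsilon> *\<^sub>R \<nu>\<close>) forces \<open>\<epsilon> \<le> 0\<close>.\<close>

lemma partly_smooth_identification:
  fixes g :: "'a \<Rightarrow> ereal"
  assumes x0: "x0 \<in> U" and pr: "prox_regular r g x0" and ps: "partly_smooth g M x0"
    and v: "v \<in> rel_interior (limiting_subdiff g x0)"
    and V: "open V" "x0 \<in> V" and gH: "\<And>z. z \<in> M \<Longrightarrow> z \<in> V \<Longrightarrow> g z = ereal (H z)"
    and H: "isCont H x0"
    and p: "p \<longlonglongrightarrow> x0" and vs: "vs \<longlonglongrightarrow> v" "\<And>n. vs n \<in> limiting_subdiff g (p n)"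
    and gp: "\<And>\<epsilon>. \<epsilon> > 0 \<Longrightarrow> \<forall>\<^sub>F n in sequentially. g (p n) < g x0 + ereal \<epsilon>"
  shows "\<exists>n::nat. p n \<in> M"
proof (rule ccontr)
  assume "\<not> ?thesis"
  then have off: "p n \<notin> M" for n by blast
  have x0M: "x0 \<in> M" using ps unfolding partly_smooth_def by blast
  have aff: "\<exists>a. affine hull (limiting_subdiff g x0) = (+) a ` normal_space M x0"
    and scont: "set_valued_continuous_at M (limiting_subdiff g) x0"
    using ps unfolding partly_smooth_def by blast+
  define w0 where "w0 = \<Phi> x0"
  have w0: "w0 \<in> S" "w0 \<in> W" "\<Psi> w0 = x0" unfolding w0_def using x0 x0M \<Phi>_slice \<Phi>_mem by auto
  obtain \<rho> where \<rho>: "\<rho> > 0" "cball x0 \<rho> \<subseteq> U \<inter> V"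
    using open_Int[OF open_U V(1)] x0 V(2) unfolding open_contains_cball by blast
  \<comment> \<open>\<open>M\<close> need not be closed. In a closed ball inside the chart domain it
    is the preimage of the closed subspace \<open>S\<close>, so nearest points exist.\<close>
  define K where "K = M \<inter> cball x0 \<rho>"
  have x0K: "x0 \<in> K" unfolding K_def using x0M \<rho>(1) by simp
  have "x \<in> M \<longleftrightarrow> \<Phi> x \<in> S" if "x \<in> U" for x
    using \<Phi>_slice[OF _ that] \<Psi>_slice[OF _ \<Phi>_mem[OF that]] that by auto
  then have "M \<inter> cball x0 \<rho> = cball x0 \<rho> \<inter> \<Phi> -` S"
    using \<rho>(2) by blast
  moreover have "closed (cball x0 \<rho> \<inter> \<Phi> -` S)"
    using \<rho>(2) by (intro continuous_closed_preimage closed_subspace[OF subspace_S] continuous_on_subset[OF cont_\<Phi>]) auto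
  ultimately have K: "closed K" unfolding K_def by simp
  define q where "q n = closest_point K (p n)" for n
  have qK: "q n \<in> K" and qmin: "\<And>z. z \<in> K \<Longrightarrow> dist (p n) (q n) \<le> dist (p n) z" for n
    unfolding q_def using closest_point_exists[OF K] x0K by auto
  have qM: "q n \<in> M" "q n \<in> U" "q n \<in> V" for n using qK[of n] \<rho>(2) unfolding K_def by auto
  have pq: "(\<lambda>n. p n - q n) \<longlonglongrightarrow> 0"
  proof (rule Lim_null_comparison)
    show "\<forall>\<^sub>F n in sequentially. norm (p n - q n) \<le> dist (p n) x0"
      using qmin[OF x0K] by (auto simp: dist_norm)
    show "(\<lambda>n. dist (p n) x0) \<longlonglongrightarrow> 0" using iffD1[OF tendsto_dist_iff p] .
  qed
  from tendsto_diff[OF p this] have q: "q \<longlonglongrightarrow> x0" by simp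
  have pq0: "norm (p n - q n) > 0" for n using off[of n] qM(1)[of n] by auto
  define u where "u n = (1 / norm (p n - q n)) *\<^sub>R (p n - q n)" for n
  have un: "norm (u n) = 1" for n unfolding u_def using pq0[of n] by simp
  then have "\<forall>n. u n \<in> sphere 0 1" by simp
  moreover have "compact (sphere (0 :: 'a) 1)" by simp
  ultimately obtain \<nu> \<sigma> where \<nu>: "\<nu> \<in> sphere 0 1" and \<sigma>: "strict_mono (\<sigma> :: nat \<Rightarrow> nat)" "(u \<circ> \<sigma>) \<longlonglongrightarrow> \<nu>"
    unfolding compact_def by blast
  have sub: "(\<lambda>k. X (\<sigma> k)) \<longlonglongrightarrow> l" if "X \<longlonglongrightarrow> l" for X :: "nat \<Rightarrow> 'a" and l
    using LIMSEQ_subseq_LIMSEQ[OF that \<sigma>(1)] by (simp add: comp_def)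
  have sube: "\<forall>\<^sub>F k in sequentially. P (\<sigma> k)" if "\<forall>\<^sub>F k in sequentially. P k" for P
    using that filterlim_subseq[OF \<sigma>(1)] by (rule eventually_compose_filterlim)
  have u: "(\<lambda>k. u (\<sigma> k)) \<longlonglongrightarrow> \<nu>" using \<sigma>(2) by (simp add: comp_def)
  \<comment> \<open>Eventually \<open>q n\<close> lies in the open ball, where the constraint
    defining \<open>K\<close> is inactive, so it is a local nearest point of \<open>M\<close>
    itself.\<close>
  have orth: "\<forall>\<^sub>F n in sequentially. u n \<bullet> \<Psi>' (\<Phi> (q n)) b = 0" if b: "b \<in> S" for b
  proof -
    have "\<forall>\<^sub>F n in sequentially. q n \<in> ball x0 \<rho>"
      using q open_ball \<rho>(1) by (intro topological_tendstoD[OF q]) auto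
    then show ?thesis
    proof eventually_elim
      case (elim n)
      have "\<forall>\<^sub>F z in nhds (q n). z \<in> M \<longrightarrow> dist (p n) (q n) \<le> dist (p n) z"
        using eventually_nhds_in_open[OF open_ball elim]
        by eventually_elim (auto intro!: qmin simp: K_def)
      from nearest_point_orthogonal[OF qM(1,2) b this] show ?case unfolding u_def by simp
    qed
  qed
  have "\<nu> \<bullet> \<Psi>' w0 b = 0" if b: "b \<in> S" for b
  proof -
    have "(\<lambda>k. \<Phi> (q (\<sigma> k))) \<longlonglongrightarrow> w0"
      unfolding w0_def by (intro isCont_tendsto_compose[OF isCont_\<Phi>[OF x0]] sub q)
    then have "(\<lambda>k. \<Psi>' (\<Phi> (q (\<sigma> k)))) \<longlonglongrightarrow> \<Psi>' w0"
      by (rule isCont_tendsto_compose[OF isCont_\<Psi>'[OF w0(2)]])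
    then have "(\<lambda>k. u (\<sigma> k) \<bullet> \<Psi>' (\<Phi> (q (\<sigma> k))) b) \<longlonglongrightarrow> \<nu> \<bullet> \<Psi>' w0 b"
      by (intro tendsto_intros u)
    moreover have "(\<lambda>k. u (\<sigma> k) \<bullet> \<Psi>' (\<Phi> (q (\<sigma> k))) b) \<longlonglongrightarrow> 0"
      by (rule tendsto_eventually) (rule sube[OF orth[OF b]])
    ultimately show ?thesis by (rule LIMSEQ_unique)
  qed
  then have \<nu>N: "\<nu> \<in> normal_space M x0"
    unfolding normal_space_def orthogonal_comp_def orthogonal_def
    using tangent_space_eq[OF w0(1,2)] w0(3) by (auto simp: inner_commute)
  obtain e where vS: "v \<in> limiting_subdiff g x0" and e: "e > 0"
    "ball v e \<inter> affine hull (limiting_subdiff g x0) \<subseteq> limiting_subdiff g x0"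
    using v unfolding mem_rel_interior_ball by blast
  \<comment> \<open>Since \<open>\<nu>\<close> has norm 1, half of \<open>e\<close> keeps
    \<open>v + \<epsilon> *\<^sub>R \<nu>\<close> in the open ball.\<close>
  define \<epsilon> where "\<epsilon> = e / 2"
  have \<epsilon>: "\<epsilon> > 0" unfolding \<epsilon>_def using e(1) by simp
  have v\<epsilon>: "v + \<epsilon> *\<^sub>R \<nu> \<in> limiting_subdiff g x0"
  proof -
    obtain a where a: "affine hull (limiting_subdiff g x0) = (+) a ` normal_space M x0"
      using aff by blast
    have N: "subspace (normal_space M x0)"
      unfolding normal_space_def by (rule subspace_orthogonal_comp)
    have "v \<in> affine hull (limiting_subdiff g x0)" using vS by (rule hull_inc)
    then obtain n where n: "n \<in> normal_space M x0" "v = a + n" unfolding a by blast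
    have "v + \<epsilon> *\<^sub>R \<nu> = a + (n + \<epsilon> *\<^sub>R \<nu>)" unfolding n(2) by simp
    moreover have "n + \<epsilon> *\<^sub>R \<nu> \<in> normal_space M x0"
      by (intro subspace_add subspace_scale N n(1) \<nu>N)
    ultimately have "v + \<epsilon> *\<^sub>R \<nu> \<in> affine hull (limiting_subdiff g x0)" unfolding a by blast
    moreover have "v + \<epsilon> *\<^sub>R \<nu> \<in> ball v e" using \<nu> e(1) unfolding \<epsilon>_def by (simp add: dist_norm)
    ultimately show ?thesis using e(2) by blast
  qed
  \<comment> \<open>Inner semicontinuity of the subdifferential along \<open>M\<close> is used here,
    at the points \<open>q (\<sigma> k)\<close>.\<close>
  obtain ws where ws: "\<forall>\<^sub>F k in sequentially. ws k \<in> limiting_subdiff g (q (\<sigma> k))"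
    "ws \<longlonglongrightarrow> v + \<epsilon> *\<^sub>R \<nu>"
    using scont v\<epsilon> sub[OF q] qM(1) unfolding set_valued_continuous_at_def by meson
  obtain \<epsilon>1 where \<epsilon>1: "\<epsilon>1 > 0" "\<And>x x' y. y \<in> limiting_subdiff g x \<Longrightarrow> norm (x - x0) < \<epsilon>1 \<Longrightarrow>
      norm (x' - x0) < \<epsilon>1 \<Longrightarrow> norm (y - (v + \<epsilon> *\<^sub>R \<nu>)) < \<epsilon>1 \<Longrightarrow> g x < g x0 + ereal \<epsilon>1 \<Longrightarrow>
      g x' \<ge> g x + ereal (y \<bullet> (x' - x) - r / 2 * (norm (x' - x))\<^sup>2)"
    using pr v\<epsilon> unfolding prox_regular_def by blast
  obtain \<epsilon>2 where \<epsilon>2: "\<epsilon>2 > 0" "\<And>x x' y. y \<in> limiting_subdiff g x \<Longrightarrow> norm (x - x0) < \<epsilon>2 \<Longrightarrow>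
      norm (x' - x0) < \<epsilon>2 \<Longrightarrow> norm (y - v) < \<epsilon>2 \<Longrightarrow> g x < g x0 + ereal \<epsilon>2 \<Longrightarrow>
      g x' \<ge> g x + ereal (y \<bullet> (x' - x) - r / 2 * (norm (x' - x))\<^sup>2)"
    using pr vS unfolding prox_regular_def by blast
  have gq: "\<forall>\<^sub>F k in sequentially. g (q (\<sigma> k)) < g x0 + ereal \<epsilon>1"
  proof -
    have "(\<lambda>k. H (q (\<sigma> k))) \<longlonglongrightarrow> H x0" by (intro isCont_tendsto_compose[OF H] sub q)
    then have "\<forall>\<^sub>F k in sequentially. H (q (\<sigma> k)) < H x0 + \<epsilon>1" using \<epsilon>1(1) by (intro order_tendstoD(2)) auto
    then show ?thesis by eventually_elim (simp add: gH qM x0M V)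
  qed
  have close: "\<forall>\<^sub>F k in sequentially. norm (X k - l) < \<eta>" if "X \<longlonglongrightarrow> l" "\<eta> > 0" for X :: "nat \<Rightarrow> 'a" and l \<eta>
    using tendstoD[OF that] by (simp add: dist_norm)
  have "\<forall>\<^sub>F k in sequentially. (ws k - vs (\<sigma> k)) \<bullet> u (\<sigma> k) \<le> r * norm (p (\<sigma> k) - q (\<sigma> k))"
    using ws(1) gq sube[OF gp[OF \<epsilon>2(1)]] close[OF ws(2) \<epsilon>1(1)] close[OF sub[OF vs(1)] \<epsilon>2(1)]
      close[OF sub[OF p] \<epsilon>1(1)] close[OF sub[OF p] \<epsilon>2(1)] close[OF sub[OF q] \<epsilon>1(1)] close[OF sub[OF q] \<epsilon>2(1)]
  proof eventually_elim
    case (elim k)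
    define P where "P = p (\<sigma> k)"
    define Q where "Q = q (\<sigma> k)"
    define y where "y = vs (\<sigma> k)"
    define z where "z = ws k"
    define n where "n = norm (P - Q)"
    have n: "n > 0" unfolding n_def P_def Q_def by (rule pq0)
    have "\<bar>g P\<bar> \<noteq> \<infinity>" using vs(2)[of "\<sigma> k"] unfolding limiting_subdiff_def P_def by simp
    then obtain gP where gP: "g P = ereal gP" by auto
    have gQ: "g Q = ereal (H Q)" unfolding Q_def by (rule gH[OF qM(1,3)])
    have "g P \<ge> g Q + ereal (z \<bullet> (P - Q) - r / 2 * (norm (P - Q))\<^sup>2)"
      unfolding P_def Q_def z_def by (rule \<epsilon>1(2)) (use elim in auto)
    moreover have "g Q \<ge> g P + ereal (y \<bullet> (Q - P) - r / 2 * (norm (Q - P))\<^sup>2)"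
      unfolding P_def Q_def y_def by (rule \<epsilon>2(2)) (use elim vs(2) in auto)
    ultimately have "z \<bullet> (P - Q) + y \<bullet> (Q - P) - r * n\<^sup>2 \<le> 0"
      unfolding gP gQ n_def by (simp add: norm_minus_commute)
    moreover have "z \<bullet> (P - Q) + y \<bullet> (Q - P) = (z - y) \<bullet> (P - Q)"
      by (simp add: inner_diff_left inner_diff_right)
    ultimately have "(z - y) \<bullet> (P - Q) \<le> (r * n) * n" by (simp add: power2_eq_square)
    moreover have "(z - y) \<bullet> u (\<sigma> k) = ((z - y) \<bullet> (P - Q)) / n"
      unfolding u_def P_def Q_def n_def by simp
    ultimately have "(z - y) \<bullet> u (\<sigma> k) \<le> r * n" using n by (simp add: divide_le_eq)
    then show ?case unfolding z_def y_def n_def P_def Q_def .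
  qed
  moreover have "(\<lambda>k. (ws k - vs (\<sigma> k)) \<bullet> u (\<sigma> k)) \<longlonglongrightarrow> (v + \<epsilon> *\<^sub>R \<nu> - v) \<bullet> \<nu>"
    by (intro tendsto_intros ws(2) sub[OF vs(1)] u)
  moreover have "(\<lambda>k. r * norm (p (\<sigma> k) - q (\<sigma> k))) \<longlonglongrightarrow> r * norm (0 :: 'a)"
    by (intro tendsto_intros sub[OF pq])
  ultimately have "(v + \<epsilon> *\<^sub>R \<nu> - v) \<bullet> \<nu> \<le> r * norm (0 :: 'a)"
    by (intro tendsto_le[OF sequentially_bot])
  moreover have "(v + \<epsilon> *\<^sub>R \<nu> - v) \<bullet> \<nu> = \<epsilon>"
    using \<nu> power2_norm_eq_inner[of \<nu>] by simp
  ultimately show False using \<epsilon> by simp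
qed

text \<open>If every radius \<open>1 / (n + 1)\<close> failed, prox points off \<open>M\<close>
  would converge to \<open>x0\<close> by the error bound, and their Fermat subgradients to
  \<open>- gradient f x0\<close>, which is relatively interior. Sequential identification excludes
  this.\<close>

lemma prox_grad_identification:
  fixes g :: "'a \<Rightarrow> ereal"
  assumes st: "standing_assumptions f g L" and \<gamma>: "\<gamma> > 0" "r < 1 / \<gamma>"
    and sc: "structured_critical_point r f g M x0" and x0: "x0 \<in> U"
    and V: "open V" "x0 \<in> V" and gH: "\<And>z. z \<in> M \<Longrightarrow> z \<in> V \<Longrightarrow> g z = ereal (H z)"
    and H: "isCont H x0"
  shows "\<exists>\<delta>>0. \<forall>y p. dist y x0 < \<delta> \<longrightarrow> p \<in> prox \<gamma> g (y - \<gamma> *\<^sub>R gradient f y) \<longrightarrow> p \<in> M"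
proof (rule ccontr)
  assume neg: "\<not> ?thesis"
  have "\<exists>y p. dist y x0 < inverse (real (Suc n)) \<and> p \<in> prox \<gamma> g (y - \<gamma> *\<^sub>R gradient f y) \<and> p \<notin> M" for n
    using neg by (meson inverse_positive_iff_positive of_nat_0_less_iff zero_less_Suc)
  then obtain y p where y: "\<And>n. dist (y n) x0 < inverse (real (Suc n))"
    and p: "\<And>n. p n \<in> prox \<gamma> g (y n - \<gamma> *\<^sub>R gradient f (y n))" and off: "\<And>n. p n \<notin> M"
    by metis
  have r: "r > 0" and prx: "prox (1 / r) g (x0 - (1 / r) *\<^sub>R gradient f x0) = {x0}"
    and ri: "0 \<in> rel_interior ((+) (gradient f x0) ` limiting_subdiff g x0)"
    and pr: "prox_regular r g x0" and ps: "partly_smooth g M x0"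
    using sc unfolding structured_critical_point_def by blast+
  have lip: "lipschitz_on L UNIV (gradient f)" and proper: "proper g"
    using st unfolding standing_assumptions_def by blast+
  have ylim: "y \<longlonglongrightarrow> x0"
    by (rule iffD2[OF tendsto_dist_iff], rule tendsto_sandwich[OF _ _ tendsto_const LIMSEQ_inverse_real_of_nat])
      (use less_imp_le[OF y] in \<open>auto intro!: always_eventually\<close>)
  obtain C where C: "\<And>n. norm (p n - x0) \<le> C * norm (y n - x0)"
    using prox_grad_error_bound[OF st \<gamma>(1) r \<gamma>(2) prx] p by blast
  have "(\<lambda>n. C * norm (y n - x0)) \<longlonglongrightarrow> C * norm (x0 - x0)"
    by (intro tendsto_intros ylim)
  then have lim0: "(\<lambda>n. C * norm (y n - x0)) \<longlonglongrightarrow> 0" by simp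
  have "(\<lambda>n. p n - x0) \<longlonglongrightarrow> 0"
    by (rule Lim_null_comparison[OF always_eventually lim0]) (simp add: C)
  then have plim: "p \<longlonglongrightarrow> x0" by (simp add: LIM_zero_iff)
  have "continuous_on UNIV (gradient f)" using lip by (rule lipschitz_on_continuous_on)
  then have gr: "(\<lambda>n. gradient f (y n)) \<longlonglongrightarrow> gradient f x0"
    by (rule continuous_on_tendsto_compose[OF _ ylim]) auto
  define v where "v n = (1 / \<gamma>) *\<^sub>R (y n - \<gamma> *\<^sub>R gradient f (y n) - p n)" for n
  have vmem: "v n \<in> limiting_subdiff g (p n)" for n
    using prox_regular_subdiff[OF p \<gamma>(1) proper] regular_subdiff_subset_limiting unfolding v_def by blast
  have "v \<longlonglongrightarrow> (1 / \<gamma>) *\<^sub>R (x0 - \<gamma> *\<^sub>R gradient f x0 - x0)"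
    unfolding v_def by (intro tendsto_intros ylim plim gr)
  then have vlim: "v \<longlonglongrightarrow> - gradient f x0" using \<gamma>(1) by simp
  have "rel_interior ((+) (gradient f x0) ` limiting_subdiff g x0)
      = (+) (gradient f x0) ` rel_interior (limiting_subdiff g x0)"
    by (rule rel_interior_translation)
  with ri obtain s where s: "s \<in> rel_interior (limiting_subdiff g x0)" "0 = gradient f x0 + s" by auto
  then have s': "- gradient f x0 \<in> rel_interior (limiting_subdiff g x0)"
    by (metis add.inverse_unique)
  obtain g0 where g0: "g x0 = ereal g0"
    using standing_assumptions_finite[OF st, of x0 "1 / r"] prx by blast
  \<comment> \<open>Testing the prox minimality at \<open>x0\<close> bounds \<open>g (p n)\<close>
    from above by \<open>g x0\<close> plus the vanishing quantity \<open>t n\<close>.\<close>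
  have gp: "\<forall>\<^sub>F n in sequentially. g (p n) < g x0 + ereal \<epsilon>" if \<epsilon>: "\<epsilon> > 0" for \<epsilon>
  proof -
    define t where "t n = gradient f (y n) \<bullet> (x0 - y n) + 1 / (2 * \<gamma>) * (norm (x0 - y n))\<^sup>2
        - gradient f (y n) \<bullet> (p n - y n) - 1 / (2 * \<gamma>) * (norm (p n - y n))\<^sup>2" for n
    have "t \<longlonglongrightarrow> gradient f x0 \<bullet> (x0 - x0) + 1 / (2 * \<gamma>) * (norm (x0 - x0))\<^sup>2
        - gradient f x0 \<bullet> (x0 - x0) - 1 / (2 * \<gamma>) * (norm (x0 - x0))\<^sup>2"
      unfolding t_def by (intro tendsto_intros ylim plim gr)
    then have "\<forall>\<^sub>F n in sequentially. t n < \<epsilon>" using \<epsilon> by (intro order_tendstoD(2)) auto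
    then show ?thesis
    proof eventually_elim
      case (elim n)
      obtain gn where gn: "g (p n) = ereal gn" using standing_assumptions_finite[OF st p] by blast
      have "gn \<le> g0 + t n" using prox_grad_le[OF p \<gamma>(1) gn g0] unfolding t_def by simp
      then show ?case using elim unfolding gn g0 by simp
    qed
  qed
  obtain n where "p n \<in> M"
    using partly_smooth_identification[OF x0 pr ps s' V gH H plim vlim vmem gp] by blast
  with off show False by blast
qed

end

context slice_chart_function
begin

text \<open>The growth inequality says that \<open>\<theta>\<close> has a local minimum at 0 along
  every chart line. Its linear term cancels the derivative of \<open>f\<close> and its quadratic
  term is flat at \<open>x0\<close>, so the derivative of \<open>h\<close> alone must
  vanish.\<close>

lemma riem_grad_structured_critical:
  assumes st: "standing_assumptions f g L" and sc: "structured_critical_point r f g M x0" and x0: "x0 \<in> U"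
    and hg: "\<And>z. z \<in> M \<Longrightarrow> z \<in> U \<Longrightarrow> objective f g z = ereal (h z)"
  shows "riem_grad M h x0 = 0"
proof -
  have r: "r > 0" and x0M: "x0 \<in> M"
    and prx: "x0 \<in> prox (1 / r) g (x0 - (1 / r) *\<^sub>R gradient f x0)"
    using sc unfolding structured_critical_point_def by blast+
  have g: "g z = ereal (h z - f z)" if "z \<in> M" "z \<in> U" for z
    using hg[OF that] unfolding objective_def by (cases "g z") auto
  define w0 where "w0 = \<Phi> x0"
  have w0: "w0 \<in> S" "w0 \<in> W" "\<Psi> w0 = x0" unfolding w0_def using x0 x0M \<Phi>_slice \<Phi>_mem by auto
  have "riem_grad M h (\<Psi> w0) = 0"
  proof (rule tangent_eqI[OF w0(1,2) riem_grad_tangent[OF w0(1,2)] subspace_0[OF subspace_tangent[OF w0(1,2)]]])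
    fix b assume b: "b \<in> S"
    define c where "c t = \<Psi> (w0 + t *\<^sub>R b)" for t
    define v where "v = \<Psi>' w0 b"
    have c: "curve_through M (\<Psi> w0) v c" using curve_chart_line[OF w0(1,2) b] unfolding v_def c_def .
    have c0: "c 0 = x0" and cd: "(c has_vector_derivative v) (at 0)"
      using c unfolding curve_through_def w0(3) by blast+
    have 1: "((\<lambda>t. h (c t)) has_real_derivative \<phi>' w0 b) (at 0)"
      using deriv_h_curve[OF w0(1,2) c] \<Phi>'\<Psi>'[OF w0(2)] unfolding v_def by simp
    have "(f has_derivative (\<lambda>u. u \<bullet> gradient f x0)) (at (c 0))"
      using C2_GDERIV[of f x0] st unfolding standing_assumptions_def gderiv_def c0 by blast
    from has_vector_derivative_compose[OF cd this]
    have 2: "((\<lambda>t. f (c t)) has_real_derivative v \<bullet> gradient f x0) (at 0)"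
      by (simp add: has_real_derivative_iff_has_vector_derivative)
    have "((\<lambda>t. c t - x0) has_vector_derivative v) (at 0)"
      using has_vector_derivative_diff[OF cd has_vector_derivative_const, of x0] by simp
    from has_vector_derivative_bilinear[OF bounded_bilinear_inner this this]
      bounded_linear.has_vector_derivative[OF bounded_linear_inner_right this]
    have 3: "((\<lambda>t. (c t - x0) \<bullet> (c t - x0)) has_real_derivative 0) (at 0)"
      and 4: "((\<lambda>t. gradient f x0 \<bullet> (c t - x0)) has_real_derivative gradient f x0 \<bullet> v) (at 0)"
      by (simp_all add: has_real_derivative_iff_has_vector_derivative c0)
    define \<theta> where "\<theta> t = h (c t) - f (c t) + gradient f x0 \<bullet> (c t - x0)
        + r / 2 * ((c t - x0) \<bullet> (c t - x0))" for t
    have "(\<theta> has_real_derivative \<phi>' w0 b - v \<bullet> gradient f x0 + gradient f x0 \<bullet> v + r / 2 * 0) (at 0)"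
      unfolding \<theta>_def by (intro DERIV_add DERIV_diff DERIV_cmult 1 2 3 4)
    then have d: "(\<theta> has_real_derivative \<phi>' w0 b) (at 0)" by (simp add: inner_commute)
    have "\<forall>\<^sub>F t in nhds 0. \<theta> 0 \<le> \<theta> t"
      using curve_in_chart(1)[OF c \<Psi>_mem[OF w0(2)]]
    proof eventually_elim
      case (elim t)
      then have "h x0 - f x0 \<le> (h (c t) - f (c t)) + gradient f x0 \<bullet> (c t - x0) + r / 2 * (norm (c t - x0))\<^sup>2"
        by (intro prox_grad_growth[OF r prx] g x0M x0) auto
      then show ?case unfolding \<theta>_def c0 by (simp add: power2_norm_eq_inner)
    qed
    then obtain \<delta> where "\<delta> > 0" "\<And>t. dist t 0 < \<delta> \<Longrightarrow> \<theta> 0 \<le> \<theta> t"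
      unfolding eventually_nhds_metric by blast
    then have "\<phi>' w0 b = 0"
      using DERIV_local_min[OF d] by (simp add: dist_real_def)
    then show "riem_grad M h (\<Psi> w0) \<bullet> \<Psi>' w0 b = 0 \<bullet> \<Psi>' w0 b"
      using riem_grad_inner[OF w0(1,2) b] by simp
  qed
  then show ?thesis unfolding w0(3) .
qed

end

section \<open>Local quadratic convergence\<close>

lemma backtracking_full_step:
  assumes "backtracking_step f g m \<beta> M R x d \<alpha>" and "armijo f g m M R x d 1"
  shows "\<alpha> = 1"
proof -
  obtain j where j: "\<alpha> = \<beta> ^ j" "\<forall>i<j. \<not> armijo f g m M R x d (\<beta> ^ i)"
    using assms(1) unfolding backtracking_step_def by blast
  have "j = 0" using j(2) assms(2) by (metis gr0I power_0)
  then show ?thesis using j(1) by simp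
qed

text \<open>A single neighbourhood carries a C2 representative of the objective and the matching
  real form of \<open>g\<close>, so the chart and the identification argument can share it.\<close>

lemma objective_C2_near:
  fixes f :: "'a::euclidean_space \<Rightarrow> real"
  assumes f: "C2_on UNIV f" and g: "C2_restriction_ereal_at M g x0"
  shows "\<exists>V F. x0 \<in> V \<and> C2_on V F \<and> (\<forall>z\<in>M \<inter> V. g z = ereal (F z - f z) \<and>
    objective_real f g z = F z \<and> objective f g z = ereal (F z))"
proof -
  obtain h where h: "C2_restriction_at M h x0" "\<forall>\<^sub>F z in nhds x0. z \<in> M \<longrightarrow> g z = ereal (h z)"
    using g unfolding C2_restriction_ereal_at_def by blast
  obtain U H where U: "x0 \<in> U" "C2_on U H" "\<And>z. z \<in> M \<inter> U \<Longrightarrow> H z = h z"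
    using h(1) unfolding C2_restriction_at_def by blast
  obtain V1 where V1: "open V1" "x0 \<in> V1" "\<And>z. z \<in> V1 \<Longrightarrow> z \<in> M \<Longrightarrow> g z = ereal (h z)"
    using h(2) unfolding eventually_nhds by blast
  define V where "V = U \<inter> V1"
  have "open U" using U(2) unfolding C2_on_def by blast
  then have V: "open V" "x0 \<in> V" unfolding V_def using U(1) V1 by auto
  have "C2_on V (\<lambda>z. f z + H z)"
    using C2_on_subset[OF f V(1)] C2_on_subset[OF U(2) V(1)] unfolding V_def
    by (intro C2_on_add) auto
  moreover have "g z = ereal (H z)" if "z \<in> M \<inter> V" for z
    using U(3)[of z] V1(3)[of z] that unfolding V_def by auto
  ultimately show ?thesis
    using V(2) by (intro exI[of _ V] exI[of _ "\<lambda>z. f z + H z"])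
      (auto simp: objective_real_def objective_def)
qed

context
  fixes f :: "'a::euclidean_space \<Rightarrow> real" and g :: "'a \<Rightarrow> ereal"
    and L \<gamma> m\<^sub>1 \<beta> :: real
    and R :: "'a set \<Rightarrow> 'a \<Rightarrow> 'a \<Rightarrow> 'a"
    and Ms :: "nat \<Rightarrow> 'a set"
    and x d y :: "nat \<Rightarrow> 'a" and \<alpha> :: "nat \<Rightarrow> real"
    and M :: "'a set" and xs :: 'a and r \<delta>0 :: real
  assumes st: "standing_assumptions f g L"
    and \<gamma>: "\<gamma> > 0"
    and m1: "0 < m\<^sub>1" "m\<^sub>1 < 1 / 2"
    and alg: "newton_prox_gradient f g \<gamma> m\<^sub>1 \<beta> R Ms x d \<alpha> y"
    and lp: "seq_limit_point y xs"
    and M: "C2_submanifold M"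
    and sc: "structured_critical_point r f g M xs" and r: "r < 1 / \<gamma>"
    and pd: "pos_def_on (tangent_space M xs) (riem_hess M (objective_real f g) xs)"
    and lip: "hess_locally_lipschitz M (objective_real f g) xs"
    and \<delta>0: "\<delta>0 > 0" "\<And>k. k \<ge> 1 \<Longrightarrow> x k \<in> M \<Longrightarrow> dist (x k) xs < \<delta>0 \<Longrightarrow> Ms k = M"
begin

lemma local_quadratic_convergence:
  "(\<forall>\<^sub>F k in sequentially. x k \<in> M) \<and> x \<longlonglongrightarrow> xs \<and>
   (\<lambda>k. riem_dist M (x k) xs) \<longlonglongrightarrow> 0 \<and>
   (\<exists>c>0. \<forall>\<^sub>F k in sequentially.
      riem_dist M (x (Suc k)) xs \<le> ennreal c * (riem_dist M (x k) xs)\<^sup>2)"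
proof -
  let ?h = "objective_real f g"
  have xsM: "xs \<in> M" and r0: "r > 0" and ps: "partly_smooth g M xs"
    and prx: "prox (1 / r) g (xs - (1 / r) *\<^sub>R gradient f xs) = {xs}"
    using sc unfolding structured_critical_point_def by blast+
  have fC2: "C2_on UNIV f" using st unfolding standing_assumptions_def by blast
  have "C2_restriction_ereal_at M g xs" using ps unfolding partly_smooth_def by blast
  from objective_C2_near[OF fC2 this] obtain V F where V: "xs \<in> V" "C2_on V F"
    and g: "\<And>z. z \<in> M \<Longrightarrow> z \<in> V \<Longrightarrow> g z = ereal (F z - f z)"
    and h: "\<And>z. z \<in> M \<Longrightarrow> z \<in> V \<Longrightarrow> ?h z = F z"
    and obj: "\<And>z. z \<in> M \<Longrightarrow> z \<in> V \<Longrightarrow> objective f g z = ereal (F z)"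
    by blast
  obtain p where "C2_submanifold_around p M xs"
    using M xsM unfolding C2_submanifold_def by blast
  then have "\<exists>S U W \<Phi> \<Psi> \<Phi>' \<Psi>' \<Psi>'' \<phi> \<phi>' \<phi>''. xs \<in> U \<and> U \<subseteq> V \<and>
      slice_chart_function M S U W \<Phi> \<Psi> \<Phi>' \<Psi>' \<Psi>'' ?h \<phi> \<phi>' \<phi>''"
    by (rule slice_chart_function_exists[OF _ V]) (rule h)
  then obtain S U W \<Phi> \<Psi> \<Phi>' \<Psi>' \<Psi>'' \<phi> \<phi>' \<phi>'' where U: "xs \<in> U" "U \<subseteq> V"
    and chart: "slice_chart_function M S U W \<Phi> \<Psi> \<Phi>' \<Psi>' \<Psi>'' ?h \<phi> \<phi>' \<phi>''"
    by (elim exE conjE) (rule that)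
  interpret slice_chart_function M S U W \<Phi> \<Psi> \<Phi>' \<Psi>' \<Psi>'' ?h \<phi> \<phi>' \<phi>''
    by (rule chart)
  define w0 where "w0 = \<Phi> xs"
  have w0: "w0 \<in> S" "w0 \<in> W" "\<Psi> w0 = xs"
    unfolding w0_def using xsM U(1) \<Phi>_slice \<Phi>_mem by auto
  have crit: "riem_grad M ?h (\<Psi> w0) = 0"
    unfolding w0(3)
    by (rule riem_grad_structured_critical[OF st sc U(1)]) (use U(2) h obj in auto)
  obtain C2 where C2: "C2 \<ge> 0" "\<And>y p. p \<in> prox \<gamma> g (y - \<gamma> *\<^sub>R gradient f y) \<Longrightarrow>
      norm (p - xs) \<le> C2 * norm (y - xs)"
    using prox_grad_error_bound[OF st \<gamma> r0 r prx] by blast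
  have contH: "isCont (\<lambda>z. F z - f z) xs"
  proof (rule isCont_diff)
    show "isCont F xs" using V unfolding C2_on_def by (meson has_derivative_continuous)
    show "isCont f xs" using fC2 unfolding C2_on_def by (meson UNIV_I has_derivative_continuous)
  qed
  have oV: "open V" using V(2) unfolding C2_on_def by blast
  obtain \<delta>2 where \<delta>2: "\<delta>2 > 0" "\<And>y p. dist y xs < \<delta>2 \<Longrightarrow> p \<in> prox \<gamma> g (y - \<gamma> *\<^sub>R gradient f y) \<Longrightarrow> p \<in> M"
    using prox_grad_identification[OF st \<gamma> r sc U(1) oV V(1) g contH] by blast
  have prox: "x (Suc k) \<in> prox \<gamma> g (y k - \<gamma> *\<^sub>R gradient f (y k))" for k
    using alg unfolding newton_prox_gradient_def
    by (metis One_nat_def diff_Suc_1 le_add1 plus_1_eq_Suc)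
  \<comment> \<open>The limit point is assumed for \<open>y\<close>; the error bound and
    identification transfer it to the subsequent iterate of \<open>x\<close>.\<close>
  have hit: "\<exists>k. x (Suc k) \<in> M \<and> dist (x (Suc k)) xs < \<delta>" if \<delta>: "\<delta> > 0" for \<delta>
  proof -
    obtain s where "(y \<circ> s) \<longlonglongrightarrow> xs" using lp unfolding seq_limit_point_def by blast
    then have ys: "(\<lambda>j. y (s j)) \<longlonglongrightarrow> xs" by (simp add: comp_def)
    then have "(\<lambda>j. C2 * norm (y (s j) - xs)) \<longlonglongrightarrow> C2 * norm (xs - xs)" by (intro tendsto_intros)
    then have "\<forall>\<^sub>F j in sequentially. C2 * norm (y (s j) - xs) < \<delta>"
      using \<delta> by (intro order_tendstoD(2)) auto
    from eventually_happens'[OF sequentially_bot eventually_conj[OF this tendstoD[OF ys \<delta>2(1)]]]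
    obtain j where "C2 * norm (y (s j) - xs) < \<delta>" "dist (y (s j)) xs < \<delta>2" by blast
    then show ?thesis
      using \<delta>2(2)[OF _ prox] C2(2)[OF prox, of "s j"] unfolding dist_norm
      by (intro exI[of _ "s j"]) auto
  qed
  \<comment> \<open>The algorithm constrains \<open>R\<close> only on manifolds that it uses, so one
    visit with active manifold \<open>M\<close> is needed before anything is known about
    \<open>R M\<close>.\<close>
  have "manifold_retraction M (R M)"
  proof -
    obtain k where k: "x (Suc k) \<in> M" "dist (x (Suc k)) xs < \<delta>0" using hit[OF \<delta>0(1)] by blast
    then have "Ms (Suc k) = M" by (intro \<delta>0(2)) auto
    moreover have "second_order_retraction (Ms (Suc k)) (R (Ms (Suc k)))"
      using alg unfolding newton_prox_gradient_def by simp
    ultimately show ?thesis unfolding second_order_retraction_def by simp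
  qed
  note R = this
  obtain C1 where C1: "C1 \<ge> 0" and ev1: "\<forall>\<^sub>F z in nhds xs. z \<in> M \<longrightarrow> (\<forall>d. newton_direction z d \<longrightarrow>
     norm (R M z d - xs) \<le> C1 * (norm (z - xs))\<^sup>2 \<and> ?h (R M z d) \<le> ?h z + m\<^sub>1 * (riem_grad M ?h z \<bullet> d))"
    using newton_step_near[OF w0(1,2) crit _ _ R m1] lip pd unfolding w0(3) by blast
  obtain K where K: "K \<ge> 0" and evK: "\<forall>\<^sub>F z in nhds xs. z \<in> M \<longrightarrow> riem_dist M z xs \<le> ennreal (K * dist z xs)"
    using riem_dist_le[OF xsM U(1)] by blast
  obtain \<rho> where \<rho>: "\<rho> > 0" "ball xs \<rho> \<subseteq> V" using oV V(1) by (meson openE)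
  have "\<forall>\<^sub>F z in nhds xs. (z \<in> M \<longrightarrow> (\<forall>d. newton_direction z d \<longrightarrow>
     norm (R M z d - xs) \<le> C1 * (norm (z - xs))\<^sup>2 \<and> ?h (R M z d) \<le> ?h z + m\<^sub>1 * (riem_grad M ?h z \<bullet> d)))
     \<and> (z \<in> M \<longrightarrow> riem_dist M z xs \<le> ennreal (K * dist z xs)) \<and> z \<in> V"
    by (intro eventually_conj ev1 evK eventually_nhds_in_open oV V(1))
  then obtain \<delta>1 where \<delta>1: "\<delta>1 > 0" and
    near: "\<And>z d. dist z xs < \<delta>1 \<Longrightarrow> z \<in> M \<Longrightarrow> newton_direction z d \<Longrightarrow>
      norm (R M z d - xs) \<le> C1 * (norm (z - xs))\<^sup>2 \<and> ?h (R M z d) \<le> ?h z + m\<^sub>1 * (riem_grad M ?h z \<bullet> d)"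
      "\<And>z. dist z xs < \<delta>1 \<Longrightarrow> z \<in> M \<Longrightarrow> riem_dist M z xs \<le> ennreal (K * dist z xs)"
      "\<And>z. dist z xs < \<delta>1 \<Longrightarrow> z \<in> V"
    unfolding eventually_nhds_metric by blast
  \<comment> \<open>In order: \<open>n\<^sup>2 \<le> n\<close>; the active manifold is
    \<open>M\<close>; the Newton estimates apply; the full step stays where the objective is
    real-valued on \<open>M\<close>; it stays in the identification ball; the quadratic bound halves
    the error. Adding 1 keeps the denominators positive.\<close>
  define \<delta> where "\<delta> = Min {1, \<delta>0, \<delta>1, \<rho> / (C1 + 1), \<delta>2 / (C1 + 1), 1 / (2 * (C1 * C2 + 1))}"
  have CC: "C1 * C2 \<ge> 0" using C1 C2(1) by simp
  have \<delta>: "\<delta> > 0" "\<delta> \<le> 1" "\<delta> \<le> \<delta>0" "\<delta> \<le> \<delta>1" "\<delta> \<le> \<rho> / (C1 + 1)" "\<delta> \<le> \<delta>2 / (C1 + 1)"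
    "\<delta> \<le> 1 / (2 * (C1 * C2 + 1))"
    using \<delta>0(1) \<delta>1 \<rho>(1) \<delta>2(1) C1 CC unfolding \<delta>_def by (auto simp: Min_gr_iff)
  have step: "x (Suc k) \<in> M \<and> norm (x (Suc k) - xs) \<le> C1 * C2 * (norm (x k - xs))\<^sup>2
      \<and> norm (x (Suc k) - xs) \<le> norm (x k - xs) / 2"
    if k: "k \<ge> 1" "x k \<in> M" "dist (x k) xs < \<delta>" for k
  proof -
    define n where "n = norm (x k - xs)"
    have n: "n \<ge> 0" "n < \<delta>" using k(3) unfolding n_def dist_norm by auto
    have near_k: "dist (x k) xs < \<delta>1" "dist (x k) xs < \<delta>0" using k(3) \<delta>(3,4) by auto
    have Mk: "Ms k = M" by (rule \<delta>0(2)[OF k(1,2) near_k(2)])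
    have dT: "d k \<in> tangent_space M (x k)"
      and dn: "riem_grad M ?h (x k) + riem_hess M ?h (x k) (d k) = 0"
      and bt: "backtracking_step f g m\<^sub>1 \<beta> M (R M) (x k) (d k) (\<alpha> k)"
      and yk: "y k = R M (x k) (\<alpha> k *\<^sub>R d k)"
      using alg k(1) unfolding newton_prox_gradient_def Mk[symmetric] by blast+
    have nd: "newton_direction (x k) (d k)" unfolding newton_direction_def using dT dn by blast
    define z where "z = R M (x k) (d k)"
    have zn: "norm (z - xs) \<le> C1 * n\<^sup>2"
      and hz: "?h z \<le> ?h (x k) + m\<^sub>1 * (riem_grad M ?h (x k) \<bullet> d k)"
      using near(1)[OF near_k(1) k(2) nd] unfolding z_def n_def by blast+
    have "n\<^sup>2 \<le> n" using n \<delta>(2) by (simp add: power2_eq_square mult_left_le_one_le)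
    then have "C1 * n\<^sup>2 \<le> (C1 + 1) * n" using C1 n(1) by (intro mult_mono) auto
    moreover have "(C1 + 1) * n < \<rho>" "(C1 + 1) * n < \<delta>2"
      using n(2) \<delta>(5,6) C1 by (simp_all add: pos_le_divide_eq mult.commute)
        (smt (verit) mult_less_cancel_left_pos mult.commute)+
    ultimately have z_near: "dist z xs < \<rho>" "dist z xs < \<delta>2" using zn unfolding dist_norm by linarith+
    have zM: "z \<in> M"
      using R dT k(2) unfolding manifold_retraction_def tangent_bundle_def z_def by auto
    have zV: "z \<in> V" using \<rho>(2) z_near(1) by (auto simp: dist_commute)
    have xV: "x k \<in> V" by (rule near(3)[OF near_k(1)])
    have "armijo f g m\<^sub>1 M (R M) (x k) (d k) 1"
      unfolding armijo_def using hz
      by (simp add: z_def[symmetric] obj[OF zM zV] obj[OF k(2) xV] h[OF zM zV] h[OF k(2) xV])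
    then have "\<alpha> k = 1" by (rule backtracking_full_step[OF bt])
    then have yz: "y k = z" unfolding yk z_def by simp
    have "x (Suc k) \<in> M" using \<delta>2(2)[OF z_near(2)] prox[of k] unfolding yz by blast
    moreover have "norm (x (Suc k) - xs) \<le> C2 * norm (z - xs)"
      using C2(2)[OF prox[of k]] unfolding yz .
    then have q: "norm (x (Suc k) - xs) \<le> C1 * C2 * n\<^sup>2"
      using mult_left_mono[OF zn C2(1)] by (simp add: algebra_simps)
    moreover have "C1 * C2 * n\<^sup>2 \<le> n / 2"
    proof -
      have "(C1 * C2 + 1) * n \<le> (C1 * C2 + 1) * (1 / (2 * (C1 * C2 + 1)))"
        using n \<delta>(7) CC by (intro mult_left_mono) auto
      also have "\<dots> = 1 / 2" using CC by (simp add: field_simps)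
      finally have "C1 * C2 * n \<le> 1 / 2" using n(1) by (simp add: algebra_simps)
      from mult_right_mono[OF this n(1)] show ?thesis by (simp add: power2_eq_square algebra_simps)
    qed
    ultimately show ?thesis unfolding n_def by auto
  qed
  obtain k0 where k0: "x (Suc k0) \<in> M" "dist (x (Suc k0)) xs < \<delta>" using hit[OF \<delta>(1)] by blast
  have all: "x (Suc k0 + j) \<in> M \<and> norm (x (Suc k0 + j) - xs) \<le> (1 / 2) ^ j * norm (x (Suc k0) - xs)" for j
  proof (induction j)
    case (Suc j)
    have "(1 / 2) ^ j * norm (x (Suc k0) - xs) \<le> 1 * norm (x (Suc k0) - xs)"
      by (intro mult_right_mono power_le_one) auto
    then have "norm (x (Suc k0 + j) - xs) \<le> norm (x (Suc k0) - xs)" using Suc.IH by linarith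
    then have "dist (x (Suc k0 + j)) xs < \<delta>" using k0(2) unfolding dist_norm by simp
    from step[OF _ conjunct1[OF Suc.IH] this] Suc.IH show ?case by simp
  qed (use k0 in simp)
  have tail: "x k \<in> M \<and> dist (x k) xs < \<delta>" if k: "k \<ge> Suc k0" for k
  proof -
    obtain j where j: "k = Suc k0 + j" using le_Suc_ex[OF k] by blast
    have "(1 / 2) ^ j * norm (x (Suc k0) - xs) \<le> 1 * norm (x (Suc k0) - xs)"
      by (intro mult_right_mono power_le_one) auto
    then show ?thesis using all[of j] k0(2) unfolding j dist_norm by linarith
  qed
  have evM: "\<forall>\<^sub>F k in sequentially. x k \<in> M"
    unfolding eventually_sequentially using tail by blast
  have "(\<lambda>j. (1 / 2) ^ j * norm (x (Suc k0) - xs)) \<longlonglongrightarrow> 0"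
    by (intro tendsto_mult_left_zero LIMSEQ_power_zero) simp
  then have "(\<lambda>j. x (Suc k0 + j) - xs) \<longlonglongrightarrow> 0"
    by (rule Lim_null_comparison[OF always_eventually, rotated]) (use all in simp)
  then have "(\<lambda>j. x (j + Suc k0)) \<longlonglongrightarrow> xs" by (simp add: LIM_zero_iff add.commute)
  then have conv: "x \<longlonglongrightarrow> xs" by (rule LIMSEQ_offset)
  have "(\<lambda>k. ennreal (K * dist (x k) xs)) \<longlonglongrightarrow> ennreal (K * dist xs xs)"
    by (intro tendsto_intros tendsto_ennrealI conv)
  then have lim0: "(\<lambda>k. ennreal (K * dist (x k) xs)) \<longlonglongrightarrow> 0" by simp
  have le: "\<forall>\<^sub>F k in sequentially. riem_dist M (x k) xs \<le> ennreal (K * dist (x k) xs)"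
    unfolding eventually_sequentially using tail near(2) \<delta>(4) by (meson order_less_le_trans)
  have riem0: "(\<lambda>k. riem_dist M (x k) xs) \<longlonglongrightarrow> 0"
    by (rule tendsto_sandwich[OF always_eventually le tendsto_const lim0]) simp
  \<comment> \<open>The summand 1 makes \<open>c\<close> positive even if
    \<open>K * (C1 * C2)\<close> vanishes.\<close>
  define c where "c = K * (C1 * C2) + 1"
  have c: "c > 0" unfolding c_def using K CC by (simp add: add_nonneg_pos)
  have "riem_dist M (x (Suc k)) xs \<le> ennreal c * (riem_dist M (x k) xs)\<^sup>2" if k: "k \<ge> Suc k0" for k
  proof -
    have "riem_dist M (x (Suc k)) xs \<le> ennreal (K * dist (x (Suc k)) xs)"
      using tail[of "Suc k"] k \<delta>(4) by (intro near(2)) auto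
    also have "\<dots> \<le> ennreal (c * (dist (x k) xs)\<^sup>2)"
    proof (rule ennreal_leI)
      have "K * dist (x (Suc k)) xs \<le> K * (C1 * C2 * (norm (x k - xs))\<^sup>2)"
        using step[of k] tail[OF k] k K unfolding dist_norm by (intro mult_left_mono) auto
      also have "\<dots> \<le> c * (dist (x k) xs)\<^sup>2"
        unfolding c_def dist_norm by (simp add: algebra_simps)
      finally show "K * dist (x (Suc k)) xs \<le> c * (dist (x k) xs)\<^sup>2" .
    qed
    also have "\<dots> = ennreal c * (ennreal (dist (x k) xs))\<^sup>2"
      using c by (simp add: ennreal_mult ennreal_power)
    \<comment> \<open>On this side the Euclidean distance may be enlarged to the Riemannian one, so
      a single comparison constant \<open>K\<close> suffices.\<close>
    also have "\<dots> \<le> ennreal c * (riem_dist M (x k) xs)\<^sup>2"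
      by (intro mult_left_mono power_mono dist_le_riem_dist) auto
    finally show ?thesis .
  qed
  then have "\<exists>c>0. \<forall>\<^sub>F k in sequentially.
      riem_dist M (x (Suc k)) xs \<le> ennreal c * (riem_dist M (x k) xs)\<^sup>2"
    using c unfolding eventually_sequentially by blast
  with evM conv riem0 show ?thesis by blast
qed

end

theorem theorem4p1:
  fixes f :: "'a::euclidean_space \<Rightarrow> real" and g :: "'a \<Rightarrow> ereal"
    and L \<gamma> m\<^sub>1 \<beta> :: real
    and R :: "'a set \<Rightarrow> 'a \<Rightarrow> 'a \<Rightarrow> 'a"
    and Ms :: "nat \<Rightarrow> 'a set"
    and x d y :: "nat \<Rightarrow> 'a" and \<alpha> :: "nat \<Rightarrow> real"
  assumes "standing_assumptions f g L"
    and "\<gamma> \<in> {0<..<1 / L}"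
    and "0 < m\<^sub>1" and "m\<^sub>1 < 1 / 2"
    and "0 < \<beta>" and "\<beta> < 1"
    and "newton_prox_gradient f g \<gamma> m\<^sub>1 \<beta> R Ms x d \<alpha> y"
    and "\<forall>k\<ge>1. pos_def_on (tangent_space (Ms k) (x k))
                 (riem_hess (Ms k) (objective_real f g) (x k))"
  shows "(\<forall>a. seq_limit_point x a \<longrightarrow> critical_point f g a) \<and>
    (\<forall>a b. seq_limit_point x a \<and> seq_limit_point x b \<longrightarrow> objective f g a = objective f g b) \<and>
    (\<forall>(M :: 'a set) xs r.
       seq_limit_point y xs \<and>
       C2_submanifold M \<and>
       structured_critical_point r f g M xs \<and> r < 1 / \<gamma> \<and>
       pos_def_on (tangent_space M xs) (riem_hess M (objective_real f g) xs) \<and>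
       hess_locally_lipschitz M (objective_real f g) xs \<and>
       (\<exists>\<delta>>0. \<forall>k\<ge>1. x k \<in> M \<and> dist (x k) xs < \<delta> \<longrightarrow> Ms k = M)
       \<longrightarrow>
       (\<forall>\<^sub>F k in sequentially. x k \<in> M) \<and>
       x \<longlonglongrightarrow> xs \<and>
       (\<lambda>k. riem_dist M (x k) xs) \<longlonglongrightarrow> 0 \<and>
       (\<exists>c>0. \<forall>\<^sub>F k in sequentially.
          riem_dist M (x (Suc k)) xs \<le> ennreal c * (riem_dist M (x k) xs)\<^sup>2))"
proof (rule conjI[OF _ conjI]; intro allI impI)
  fix a assume "seq_limit_point x a"
  then show "critical_point f g a"
    by (rule iterates_limit_points_critical[OF assms(1-3,5,7,8)])
next
  fix a b assume "seq_limit_point x a \<and> seq_limit_point x b"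
  then show "objective f g a = objective f g b"
    using iterates_limit_points_value[OF assms(1-3,5,7,8)] by blast
next
  fix M xs r
  assume a: "seq_limit_point y xs \<and>
       C2_submanifold M \<and>
       structured_critical_point r f g M xs \<and> r < 1 / \<gamma> \<and>
       pos_def_on (tangent_space M xs) (riem_hess M (objective_real f g) xs) \<and>
       hess_locally_lipschitz M (objective_real f g) xs \<and>
       (\<exists>\<delta>>0. \<forall>k\<ge>1. x k \<in> M \<and> dist (x k) xs < \<delta> \<longrightarrow> Ms k = M)"
  then obtain \<delta> where \<delta>: "\<delta> > 0" "\<And>k. k \<ge> 1 \<Longrightarrow> x k \<in> M \<Longrightarrow> dist (x k) xs < \<delta> \<Longrightarrow> Ms k = M"
    by blast
  have "\<gamma> > 0" using assms(2) by simp
  then show "(\<forall>\<^sub>F k in sequentially. x k \<in> M) \<and>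
       x \<longlonglongrightarrow> xs \<and>
       (\<lambda>k. riem_dist M (x k) xs) \<longlonglongrightarrow> 0 \<and>
       (\<exists>c>0. \<forall>\<^sub>F k in sequentially.
          riem_dist M (x (Suc k)) xs \<le> ennreal c * (riem_dist M (x k) xs)\<^sup>2)"
    using a by (intro local_quadratic_convergence[OF assms(1) _ assms(3,4,7) _ _ _ _ _ _ \<delta>]) auto
qed

end
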